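(* For $l>0$ let $\tilde V^l(\tau)$ be the process defined in the context, with $\tilde V^l(0)=v\in\mathbb{R}$. As $l\to 0$, the time-rescaled process $t\mapsto\tilde V^l(t/l)$ converges weakly to the Ornstein–Uhlenbeck process, i.e. to the solution $X$ with $X_0=v$ of $$dX_t=dB_t-X_t\,dt ,$$ where $B$ is a standard one-dimensional Brownian motion.
   Context: Let $Z(t)\in[0,l]$ be Brownian motion reflected at both endpoints with drift $V$: $Z(t)=B(t)+L_0(t)-L_l(t)+\int_0^tV(s)\,ds$ (so $Z(0)=0$), $V(t)=v+L_0(t)-L_l(t)$, where $B$ is a standard Brownian motion with $B(0)=0$ and $L_0,L_l$ are continuous, nondecreasing, null at $0$, and flat off $\{t:Z(t)=0\}$ and $\{t:Z(t)=l\}$ respectively. Put $L=L_0+L_l$, $L^{-1}(\tau)=\inf\{t:L(t)>\tau\}$, and $\tilde V^l(\tau)=V(L^{-1}(\tau))$; this is a continuous piecewise linear process with slopes $\pm1$. Weak convergence is in $C([0,\infty),\mathbb{R})$. *)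

theory Defs
  imports "HOL-Probability.Probability"
begin

section \<open>The path space\<close>

text \<open>
  The space \<open>C([0,\<infinity>), \<real>)\<close>. HOL functions are total, so a path is extended to negative
  times by its value at \<open>0\<close>; this makes a path determined by its values on \<open>[0,\<infinity>)\<close>.
\<close>

typedef cpath =
  "{f :: real \<Rightarrow> real. continuous_on {0..} f \<and> (\<forall>t<0. f t = f 0)}"
  morphisms path_at Abs_cpath
  by (rule exI[of _ "\<lambda>_. 0"]) simp

text \<open>The topology of uniform convergence on compact subsets of \<open>[0,\<infinity>)\<close>.\<close>

instantiation cpath :: topological_space
begin

definition open_cpath :: "cpath set \<Rightarrow> bool" where
  "open_cpath U \<longleftrightarrow>
    (\<forall>x\<in>U. \<exists>T. \<exists>e>0. \<forall>y. (\<forall>t\<in>{0..T}. \<bar>path_at y t - path_at x t\<bar> < e) \<longrightarrow> y \<in> U)"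

instance
proof
  show "open (UNIV :: cpath set)"
    by (auto simp: open_cpath_def intro: exI[of _ "1::real"])
next
  fix S T :: "cpath set"
  assume S: "open S" and T: "open T"
  show "open (S \<inter> T)"
    unfolding open_cpath_def
  proof
    fix x assume x: "x \<in> S \<inter> T"
    obtain a d where d: "d > 0"
      and a: "\<And>y. (\<forall>t\<in>{0..a}. \<bar>path_at y t - path_at x t\<bar> < d) \<Longrightarrow> y \<in> S"
      using S x unfolding open_cpath_def by blast
    obtain b e where e: "e > 0"
      and b: "\<And>y. (\<forall>t\<in>{0..b}. \<bar>path_at y t - path_at x t\<bar> < e) \<Longrightarrow> y \<in> T"
      using T x unfolding open_cpath_def by blast
    show "\<exists>c. \<exists>r>0. \<forall>y. (\<forall>t\<in>{0..c}. \<bar>path_at y t - path_at x t\<bar> < r) \<longrightarrow> y \<in> S \<inter> T"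
    proof (rule exI[of _ "max a b"], rule exI[of _ "min d e"], intro conjI allI impI)
      show "min d e > 0" using d e by simp
    next
      fix y assume y: "\<forall>t\<in>{0..max a b}. \<bar>path_at y t - path_at x t\<bar> < min d e"
      have "y \<in> S" by (rule a) (use y in \<open>auto simp: le_max_iff_disj\<close>)
      moreover have "y \<in> T" by (rule b) (use y in \<open>auto simp: le_max_iff_disj\<close>)
      ultimately show "y \<in> S \<inter> T" by simp
    qed
  qed
next
  fix K :: "cpath set set"
  assume "\<forall>S\<in>K. open S"
  then show "open (\<Union>K)"
    unfolding open_cpath_def by (meson UnionE UnionI)
qed

end

section \<open>Weak convergence\<close>

definition weakly_converges ::
    "'i filter \<Rightarrow> ('i \<Rightarrow> 'a :: topological_space measure) \<Rightarrow> 'a measure \<Rightarrow> bool" where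
  "weakly_converges F \<mu> \<nu> \<longleftrightarrow>
    (\<forall>f :: 'a \<Rightarrow> real. continuous_on UNIV f \<and> bounded (range f) \<longrightarrow>
      ((\<lambda>i. integral\<^sup>L (\<mu> i) f) \<longlongrightarrow> integral\<^sup>L \<nu> f) F)"

text \<open>
  A process whose paths are only almost surely continuous on \<open>[0,\<infinity>)\<close> is regarded as a random
  element of \<open>C([0,\<infinity>), \<real>)\<close> by changing it on a null set. Any two such versions agree almost
  surely, so they have the same law.
\<close>

definition path_version ::
    "'a measure \<Rightarrow> (real \<Rightarrow> 'a \<Rightarrow> real) \<Rightarrow> ('a \<Rightarrow> cpath) \<Rightarrow> bool" where
  "path_version M Y P \<longleftrightarrow>
    P \<in> borel_measurable M \<and> (AE \<omega> in M. \<forall>t\<ge>0. path_at (P \<omega>) t = Y t \<omega>)"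

text \<open>The processes may live on different probability spaces.\<close>

definition processes_converge_weakly ::
    "'i filter \<Rightarrow> ('i \<Rightarrow> 'a measure) \<Rightarrow> ('i \<Rightarrow> real \<Rightarrow> 'a \<Rightarrow> real) \<Rightarrow>
      'b measure \<Rightarrow> (real \<Rightarrow> 'b \<Rightarrow> real) \<Rightarrow> bool" where
  "processes_converge_weakly F M Y N X \<longleftrightarrow>
    (\<exists>P Q. (\<forall>\<^sub>F i in F. path_version (M i) (Y i) (P i)) \<and> path_version N X Q \<and>
      weakly_converges F (\<lambda>i. distr (M i) borel (P i)) (distr N borel Q))"

section \<open>Brownian motion\<close>

definition standard_brownian_motion ::
    "'a measure \<Rightarrow> (real \<Rightarrow> 'a \<Rightarrow> real) \<Rightarrow> bool" where
  "standard_brownian_motion M B \<longleftrightarrow>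
    prob_space M \<and>
    (\<forall>t\<ge>0. B t \<in> borel_measurable M) \<and>
    (AE \<omega> in M. B 0 \<omega> = 0) \<and>
    (\<forall>(n::nat) (t :: nat \<Rightarrow> real). 0 \<le> t 0 \<and> (\<forall>i<n. t i \<le> t (Suc i)) \<longrightarrow>
      prob_space.indep_vars M (\<lambda>_. borel) (\<lambda>i \<omega>. B (t (Suc i)) \<omega> - B (t i) \<omega>) {..<n}) \<and>
    (\<forall>s t. 0 \<le> s \<and> s < t \<longrightarrow>
      distributed M lborel (\<lambda>\<omega>. B t \<omega> - B s \<omega>) (normal_density 0 (sqrt (t - s)))) \<and>
    (AE \<omega> in M. continuous_on {0..} (\<lambda>t. B t \<omega>))"

section \<open>Reflected Brownian motion with inert drift\<close>

text \<open>\<open>L\<close> does not increase on any time interval that misses \<open>A\<close>.\<close>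

definition flat_off :: "(real \<Rightarrow> real) \<Rightarrow> real set \<Rightarrow> bool" where
  "flat_off L A \<longleftrightarrow> (\<forall>s t. 0 \<le> s \<and> s \<le> t \<and> {s..t} \<inter> A = {} \<longrightarrow> L s = L t)"

definition boundary_local_time :: "(real \<Rightarrow> real) \<Rightarrow> real set \<Rightarrow> bool" where
  "boundary_local_time L A \<longleftrightarrow>
    continuous_on {0..} L \<and> mono_on {0..} L \<and> L 0 = 0 \<and> flat_off L A"

definition inert_drift_path ::
    "real \<Rightarrow> real \<Rightarrow> (real \<Rightarrow> real) \<Rightarrow> (real \<Rightarrow> real) \<Rightarrow> (real \<Rightarrow> real) \<Rightarrow>
      (real \<Rightarrow> real) \<Rightarrow> (real \<Rightarrow> real) \<Rightarrow> bool" where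
  "inert_drift_path l v b z V L\<^sub>0 L\<^sub>l \<longleftrightarrow>
    (\<forall>t\<ge>0. z t \<in> {0..l}) \<and>
    (\<forall>t\<ge>0. z t = b t + L\<^sub>0 t - L\<^sub>l t + integral {0..t} V) \<and>
    (\<forall>t\<ge>0. V t = v + L\<^sub>0 t - L\<^sub>l t) \<and>
    boundary_local_time L\<^sub>0 {t. z t = 0} \<and>
    boundary_local_time L\<^sub>l {t. z t = l}"

definition reflected_bm_inert_drift ::
    "'a measure \<Rightarrow> real \<Rightarrow> real \<Rightarrow> (real \<Rightarrow> 'a \<Rightarrow> real) \<Rightarrow> (real \<Rightarrow> 'a \<Rightarrow> real) \<Rightarrow>
      (real \<Rightarrow> 'a \<Rightarrow> real) \<Rightarrow> (real \<Rightarrow> 'a \<Rightarrow> real) \<Rightarrow> (real \<Rightarrow> 'a \<Rightarrow> real) \<Rightarrow> bool" where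
  "reflected_bm_inert_drift M l v B Z V L\<^sub>0 L\<^sub>l \<longleftrightarrow>
    standard_brownian_motion M B \<and>
    (\<forall>t\<ge>0. Z t \<in> borel_measurable M \<and> V t \<in> borel_measurable M \<and>
      L\<^sub>0 t \<in> borel_measurable M \<and> L\<^sub>l t \<in> borel_measurable M) \<and>
    (AE \<omega> in M. inert_drift_path l v (\<lambda>t. B t \<omega>) (\<lambda>t. Z t \<omega>) (\<lambda>t. V t \<omega>)
      (\<lambda>t. L\<^sub>0 t \<omega>) (\<lambda>t. L\<^sub>l t \<omega>))"

text \<open>
  The infimum is a junk value when \<open>L\<close> never exceeds \<open>\<tau>\<close>; for the total boundary local time
  this happens with probability zero.
\<close>

definition right_inverse :: "(real \<Rightarrow> real) \<Rightarrow> real \<Rightarrow> real" where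
  "right_inverse L \<tau> = Inf {t. 0 \<le> t \<and> L t > \<tau>}"

definition time_changed_drift ::
    "(real \<Rightarrow> 'a \<Rightarrow> real) \<Rightarrow> (real \<Rightarrow> 'a \<Rightarrow> real) \<Rightarrow> (real \<Rightarrow> 'a \<Rightarrow> real) \<Rightarrow>
      real \<Rightarrow> 'a \<Rightarrow> real" where
  "time_changed_drift V L\<^sub>0 L\<^sub>l \<tau> \<omega> = V (right_inverse (\<lambda>t. L\<^sub>0 t \<omega> + L\<^sub>l t \<omega>) \<tau>) \<omega>"

section \<open>The Ornstein--Uhlenbeck process\<close>

text \<open>
  The noise in \<open>dX = dB - X dt\<close>, \<open>X\<^sub>0 = v\<close>, is additive, so the integrated form of the equation
  contains no stochastic integral other than \<open>\<integral>\<^sub>0\<^sup>t dB = B\<^sub>t\<close>.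
\<close>

definition ornstein_uhlenbeck ::
    "'a measure \<Rightarrow> real \<Rightarrow> (real \<Rightarrow> 'a \<Rightarrow> real) \<Rightarrow> (real \<Rightarrow> 'a \<Rightarrow> real) \<Rightarrow> bool" where
  "ornstein_uhlenbeck M v B X \<longleftrightarrow>
    standard_brownian_motion M B \<and>
    (\<forall>t\<ge>0. X t \<in> borel_measurable M) \<and>
    (AE \<omega> in M. continuous_on {0..} (\<lambda>t. X t \<omega>) \<and> X 0 \<omega> = v \<and>
      (\<forall>t\<ge>0. X t \<omega> = v + B t \<omega> - integral {0..t} (\<lambda>s. X s \<omega>)))"

end

theory Submission
  imports Defs
begin

text \<open>
  Since \<open>L\<^sub>0 - L\<^sub>l = V - v\<close>, the defining equation \<open>Z = B + L\<^sub>0 - L\<^sub>l + \<integral> V\<close> can be read, in the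
  original time, as \<open>V = (v - B + Z) - \<integral> V\<close>.  This is the Ornstein--Uhlenbeck equation driven by
  \<open>-B\<close>, perturbed by \<open>Z\<close>, and \<open>0 \<le> Z \<le> l\<close>.  The solution operator \<open>relax\<close> of \<open>x = g - \<integral> x\<close> is linear
  and maps functions with values in \<open>[0, l]\<close> to functions bounded by \<open>l\<close>.  Hence, pathwise and for
  all times, \<open>V\<close> is within \<open>l\<close> of the Ornstein--Uhlenbeck path \<open>relax (v - B)\<close>, whose law does not
  depend on \<open>l\<close> (\<open>V_close_to_relax\<close>).

  What remains is the time change: \<open>l L(t)\<close> has to converge to \<open>t\<close>.  Ito's formula for \<open>Z (l - Z)\<close>
  gives \<open>l L(t) = t + Z(t) (l - Z(t)) - \<integral> (l - 2 Z) dB - \<integral> (l - 2 Z) V ds\<close>, where every term but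
  \<open>t\<close> is small: the second is at most \<open>l\<^sup>2\<close>, the martingale has variance at most \<open>l\<^sup>2 t\<close>, and the drift
  term is at most \<open>l t sup \<bar>V\<bar>\<close>, with \<open>V\<close> controlled by the Ornstein--Uhlenbeck path.  No stochastic
  integral is needed.  Telescoping \<open>Z (l - Z)\<close> along a partition yields a pathwise estimate with Riemann
  sums (\<open>occupation_limit\<close>); the quadratic variation of \<open>B\<close> supplies \<open>t\<close>, and the sum
  \<open>\<Sum>(l - 2 Z\<^sub>i) \<Delta>B\<^sub>i\<close> is small in mean square because its terms are orthogonal.  Orthogonality says that
  \<open>Z\<^sub>i\<close> does not anticipate \<open>B\<close>.  As the hypotheses mention no filtration, this is obtained by showing
  that \<open>Z\<^sub>i\<close> is an almost sure limit of an explicit projected Euler scheme, whose state is a function of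
  past increments of \<open>B\<close> (\<open>scheme_tendsto\<close>, \<open>weighted_increments_orthogonal\<close>).  The resulting bound
  is \<open>local_time_tail\<close>.

  By monotonicity of \<open>L\<close>, convergence at finitely many grid times already forces \<open>L\<^sup>-\<^sup>1(t / l)\<close> to be close
  to \<open>t\<close> uniformly (\<open>right_inverse_close\<close>).  So the time-changed drift is close, uniformly on compacts
  and in probability, to a path with the fixed Ornstein--Uhlenbeck law (\<open>time_changed_drift_close\<close>),
  and \<open>weakly_converges_of_close\<close> turns this into weak convergence.  The topology of the path space is
  metrised for this purpose; measurability of random paths and uniqueness of the Wiener law follow by
  approximating a path by its piecewise linear interpolations.  The law of \<open>-B\<close> is again the Wiener law.
\<close>

section \<open>Path space as a metric space\<close>

lemma path_at_continuous: "continuous_on {0..} (path_at x)"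
  and path_at_neg: "t < 0 \<Longrightarrow> path_at x t = path_at x 0"
  using path_at[of x] by auto

lemma cpath_eqI:
  assumes "\<And>t. t \<ge> 0 \<Longrightarrow> path_at x t = path_at y t"
  shows "x = y"
proof -
  have "path_at x t = path_at y t" for t
    using assms path_at_neg[of t x] path_at_neg[of t y] by (cases "t < 0") auto
  then show ?thesis by (metis ext path_at_inject)
qed

definition mk_path :: "(real \<Rightarrow> real) \<Rightarrow> cpath" where
  "mk_path g = Abs_cpath (\<lambda>t. g (max 0 t))"

lemma path_at_mk_path:
  assumes "continuous_on {0..} g" "t \<ge> 0"
  shows "path_at (mk_path g) t = g t"
proof -
  have "continuous_on {0..} (\<lambda>t. g (max 0 t))"
    by (rule continuous_on_cong[THEN iffD1, OF refl _ assms(1)]) (auto simp: max_def)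
  then have "path_at (mk_path g) = (\<lambda>t. g (max 0 t))"
    unfolding mk_path_def by (intro Abs_cpath_inverse) auto
  then show ?thesis using assms(2) by (simp add: max_def)
qed

text \<open>
  One number \<open>e\<close> measures both the accuracy and, through \<open>1 / e\<close>, the length of the time interval.
  The relation is additive in \<open>e\<close> under composition (\<open>path_close_trans\<close>), so that its infimum is a
  metric for locally uniform convergence.
\<close>

definition path_close :: "cpath \<Rightarrow> cpath \<Rightarrow> real \<Rightarrow> bool" where
  "path_close x y e \<longleftrightarrow> e > 0 \<and> (\<forall>t\<in>{0..1/e}. \<bar>path_at x t - path_at y t\<bar> \<le> e)"

lemma path_close_ex: "\<exists>e. path_close x y e"
proof -
  have "continuous_on {0..1} (\<lambda>t. path_at x t - path_at y t)"
    by (intro continuous_intros continuous_on_subset[OF path_at_continuous]) auto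
  then have "bounded ((\<lambda>t. path_at x t - path_at y t) ` {0..1})"
    by (intro compact_imp_bounded compact_continuous_image) auto
  then obtain C where C: "\<And>t. t \<in> {0..1} \<Longrightarrow> \<bar>path_at x t - path_at y t\<bar> \<le> C"
    unfolding bounded_iff by (metis imageI real_norm_def)
  have "path_close x y (max 1 C)"
    unfolding path_close_def
  proof (intro conjI ballI)
    fix t assume "t \<in> {0..1 / max 1 C}"
    moreover have "1 / max 1 C \<le> 1" by simp
    ultimately have "t \<in> {0..1}" by (meson atLeastAtMost_iff order_trans)
    from C[OF this] show "\<bar>path_at x t - path_at y t\<bar> \<le> max 1 C" by simp
  qed simp
  then show ?thesis ..
qed

lemma path_close_mono: "path_close x y e \<Longrightarrow> e \<le> d \<Longrightarrow> path_close x y d"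
  unfolding path_close_def
  by (smt (verit) atLeastAtMost_iff frac_le)

lemma path_close_sym: "path_close x y e \<longleftrightarrow> path_close y x e"
  by (auto simp: path_close_def abs_minus_commute)

text \<open>
  The interval \<open>[0, 1 / (d + e)]\<close> lies in both \<open>[0, 1 / d]\<close> and \<open>[0, 1 / e]\<close>, so on it the two
  bounds add up.
\<close>

lemma path_close_trans:
  assumes "path_close x y d" "path_close y z e"
  shows "path_close x z (d + e)"
proof -
  have de: "d > 0" "e > 0" using assms by (auto simp: path_close_def)
  show ?thesis
    unfolding path_close_def
  proof (intro conjI ballI)
    fix t assume t: "t \<in> {0..1 / (d + e)}"
    have "1 / (d + e) \<le> 1 / d" "1 / (d + e) \<le> 1 / e"
      using de by (auto intro!: frac_le)
    then have "\<bar>path_at x t - path_at y t\<bar> \<le> d" "\<bar>path_at y t - path_at z t\<bar> \<le> e"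
      using assms t by (auto simp: path_close_def)
    then show "\<bar>path_at x t - path_at z t\<bar> \<le> d + e" by linarith
  qed (use de in simp)
qed

instantiation cpath :: metric_space
begin

definition dist_cpath :: "cpath \<Rightarrow> cpath \<Rightarrow> real" where
  "dist_cpath x y = Inf {e. path_close x y e}"

definition uniformity_cpath :: "(cpath \<times> cpath) filter" where
  "uniformity_cpath = (INF e\<in>{0<..}. principal {(x, y). dist x y < e})"

lemma dist_cpath_le:
  assumes "path_close x y e"
  shows "dist x y \<le> e"
  unfolding dist_cpath_def using assms
  by (intro cInf_lower) (auto simp: path_close_def intro!: bdd_belowI[of _ 0])

lemma dist_cpath_less:
  assumes "dist x y < e"
  shows "path_close x y e"
proof -
  obtain d where "path_close x y d" "d < e"
    using cInf_lessD[of "{e. path_close x y e}" e] path_close_ex assms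
    by (auto simp: dist_cpath_def)
  then show ?thesis by (auto intro: path_close_mono)
qed

lemma dist_cpath_nonneg: "0 \<le> dist x (y :: cpath)"
  unfolding dist_cpath_def using path_close_ex
  by (intro cInf_greatest) (auto simp: path_close_def intro: less_imp_le)

instance
proof
  show "uniformity = (INF e\<in>{0<..}. principal {(x :: cpath, y). dist x y < e})"
    by (rule uniformity_cpath_def)
next
  fix U :: "cpath set"
  show "open U \<longleftrightarrow> (\<forall>x\<in>U. \<forall>\<^sub>F (x', y) in uniformity. x' = x \<longrightarrow> y \<in> U)"
    (is "_ \<longleftrightarrow> (\<forall>x\<in>U. ?N x)")
  proof -
    have *: "?N x \<longleftrightarrow> (\<exists>e>0. \<forall>y. dist x y < e \<longrightarrow> y \<in> U)" for x
      unfolding uniformity_cpath_def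
      by (subst eventually_INF_base)
        (auto simp: eventually_principal intro: bexI[of _ "min _ _"])
    have "(\<exists>T. \<exists>e>0. \<forall>y. (\<forall>t\<in>{0..T}. \<bar>path_at y t - path_at x t\<bar> < e) \<longrightarrow> y \<in> U) \<longleftrightarrow>
        (\<exists>e>0. \<forall>y. dist x y < e \<longrightarrow> y \<in> U)" (is "?A \<longleftrightarrow> ?B") for x
    proof
      assume ?A
      then obtain T e where e: "e > 0"
        and U: "\<And>y. (\<forall>t\<in>{0..T}. \<bar>path_at y t - path_at x t\<bar> < e) \<Longrightarrow> y \<in> U" by blast
      \<comment> \<open>Small enough that \<open>[0, T]\<close> is contained in \<open>[0, 1 / d]\<close>.\<close>
      define d where "d = min (e / 2) (1 / max T 1)"
      have d: "d > 0" "d < e" using e by (auto simp: d_def min_def)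
      have "d \<le> 1 / max T 1" by (simp add: d_def)
      then have "d * max T 1 \<le> 1" by (subst (asm) pos_le_divide_eq) auto
      then have "max T 1 \<le> 1 / d" using d(1) by (metis pos_le_divide_eq mult.commute)
      then have T: "T \<le> 1 / d" by simp
      have "y \<in> U" if "dist x y < d" for y
      proof (rule U, intro ballI)
        fix t assume "t \<in> {0..T}"
        then have "\<bar>path_at x t - path_at y t\<bar> \<le> d"
          using dist_cpath_less[OF that] T by (auto simp: path_close_def)
        then show "\<bar>path_at y t - path_at x t\<bar> < e" using d by linarith
      qed
      then show ?B using d by blast
    next
      assume ?B
      then obtain e where e: "e > 0" and U: "\<And>y. dist x y < e \<Longrightarrow> y \<in> U" by blast
      have "y \<in> U" if "\<forall>t\<in>{0..2/e}. \<bar>path_at y t - path_at x t\<bar> < e/2" for y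
      proof -
        have "path_close x y (e/2)"
          unfolding path_close_def using e that
          by (auto simp: abs_minus_commute less_imp_le)
        then have "dist x y \<le> e/2" by (rule dist_cpath_le)
        then show ?thesis using e by (intro U) simp
      qed
      then show ?A using e by (intro exI[of _ "2/e"] exI[of _ "e/2"]) auto
    qed
    then show ?thesis unfolding open_cpath_def * by simp
  qed
next
  fix x y :: cpath
  show "dist x y = 0 \<longleftrightarrow> x = y"
  proof
    assume d: "dist x y = 0"
    show "x = y"
    proof (rule cpath_eqI)
      fix t :: real assume t: "t \<ge> 0"
      have "\<bar>path_at x t - path_at y t\<bar> \<le> e" if "e > 0" for e
      proof -
        define r where "r = min e (1 / (t + 1))"
        have r: "r > 0" using that t by (auto simp: r_def)
        have "t + 1 \<le> 1 / r" using that t by (simp add: r_def field_simps min_def)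
        then have "t \<le> 1 / r" by simp
        then have "\<bar>path_at x t - path_at y t\<bar> \<le> r"
          using dist_cpath_less[of x y r] d r t by (auto simp: path_close_def)
        then show ?thesis by (simp add: r_def)
      qed
      then show "path_at x t = path_at y t"
        by (metis abs_le_zero_iff eq_iff_diff_eq_0 field_le_epsilon add_0)
    qed
  next
    assume "x = y"
    then have "dist x y \<le> e" if "e > 0" for e
      using that by (intro dist_cpath_le) (auto simp: path_close_def)
    then have "dist x y \<le> 0" by (metis field_le_epsilon add_0)
    then show "dist x y = 0" using dist_cpath_nonneg[of x y] by simp
  qed
next
  fix x y z :: cpath
  show "dist x y \<le> dist x z + dist y z"
  proof (rule field_le_epsilon)
    fix e :: real assume e: "e > 0"
    have "path_close x z (dist x z + e/2)" "path_close z y (dist y z + e/2)"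
      using e by (auto intro: dist_cpath_less simp: path_close_sym[of z y])
    from dist_cpath_le[OF path_close_trans[OF this]]
    show "dist x y \<le> dist x z + dist y z + e" by simp
  qed
qed

end

lemma dist_cpath_leI:
  assumes "e > 0" "\<And>t. 0 \<le> t \<Longrightarrow> t \<le> 1 / e \<Longrightarrow> \<bar>path_at x t - path_at y t\<bar> \<le> e"
  shows "dist x y \<le> e"
  using assms by (intro dist_cpath_le) (auto simp: path_close_def)

lemma dist_cpath_lessD:
  assumes "dist x y < e" "0 \<le> t" "t \<le> 1 / e"
  shows "\<bar>path_at x t - path_at y t\<bar> \<le> e"
  using dist_cpath_less[OF assms(1)] assms by (auto simp: path_close_def)

section \<open>Interpolation and random paths\<close>

lemma continuous_on_path_at: "continuous_on UNIV (\<lambda>x. path_at x t)" if t: "t \<ge> 0"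
proof (intro continuous_at_imp_continuous_on ballI)
  fix x
  show "isCont (\<lambda>x. path_at x t) x"
    unfolding continuous_at tendsto_iff
  proof (intro allI impI)
    fix e :: real assume e: "e > 0"
    define d where "d = min (e / 2) (1 / (t + 1))"
    have d: "d > 0" "d < e" using e t by (auto simp: d_def min_def)
    have "d \<le> 1 / (t + 1)" by (simp add: d_def)
    then have "d * (t + 1) \<le> 1" using t by (subst (asm) pos_le_divide_eq) auto
    then have "t + 1 \<le> 1 / d" using d(1) by (metis pos_le_divide_eq mult.commute)
    then have "t \<le> 1 / d" by simp
    then have "dist (path_at y t) (path_at x t) < e" if "dist y x < d" for y
      using dist_cpath_lessD[OF that t] d by (simp add: dist_real_def)
    moreover have "\<forall>\<^sub>F y in at x. dist y x < d"
      using d(1) by (auto simp: eventually_at intro!: exI[of _ d])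
    ultimately show "\<forall>\<^sub>F y in at x. dist (path_at y t) (path_at x t) < e"
      by (auto elim: eventually_mono)
  qed
qed

lemma measurable_path_at: "t \<ge> 0 \<Longrightarrow> (\<lambda>x. path_at x t) \<in> borel_measurable borel"
  by (intro borel_measurable_continuous_onI continuous_on_path_at)

text \<open>
  The piecewise linear B-spline; its integer translates form a partition of unity on the half-line.
\<close>

definition hat :: "real \<Rightarrow> real" where
  "hat x = max 0 (1 - \<bar>x\<bar>)"

lemma hat_bounds: "0 \<le> hat x" "hat x \<le> 1" "hat x > 0 \<Longrightarrow> \<bar>x\<bar> < 1"
  by (auto simp: hat_def)

lemma continuous_on_hat [continuous_intros]:
  "continuous_on S f \<Longrightarrow> continuous_on S (\<lambda>x. hat (f x))"
  unfolding hat_def by (intro continuous_intros)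

lemma sum_hat:
  assumes "0 \<le> y" "y \<le> real N"
  shows "(\<Sum>k\<le>N. hat (y - real k)) = 1"
proof (cases "y = real N")
  case True
  have "(\<Sum>k\<le>N. hat (y - real k)) = (\<Sum>k\<in>{N}. hat (y - real k))"
    by (rule sum.mono_neutral_right) (auto simp: True hat_def)
  then show ?thesis by (simp add: True hat_def)
next
  case False
  define j where "j = nat \<lfloor>y\<rfloor>"
  have j: "real j \<le> y" "y < real j + 1" using assms(1) by (auto simp: j_def)
  have jN: "Suc j \<le> N" using j False assms by linarith
  have "(\<Sum>k\<le>N. hat (y - real k)) = (\<Sum>k\<in>{j, Suc j}. hat (y - real k))"
  proof (rule sum.mono_neutral_right)
    show "\<forall>i\<in>{..N} - {j, Suc j}. hat (y - real i) = 0"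
    proof
      fix i assume i: "i \<in> {..N} - {j, Suc j}"
      then have "i < j \<or> i \<ge> j + 2" by auto
      then have "\<bar>y - real i\<bar> \<ge> 1" using j by linarith
      then show "hat (y - real i) = 0" by (simp add: hat_def)
    qed
  qed (use jN in auto)
  also have "\<dots> = 1" using j by (simp add: hat_def max_def)
  finally show ?thesis .
qed

text \<open>
  The piecewise linear function with values \<open>a k\<close> at \<open>k / n\<close>, used up to time \<open>n\<close>.  Writing it as a
  finite sum of hats makes its continuity, both in time and in \<open>a\<close>, immediate.
\<close>

definition hat_interp :: "nat \<Rightarrow> (nat \<Rightarrow> real) \<Rightarrow> cpath" where
  "hat_interp n a = mk_path (\<lambda>t. \<Sum>k\<le>n * n. a k * hat (real n * t - real k))"

lemma path_at_hat_interp: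
  "t \<ge> 0 \<Longrightarrow> path_at (hat_interp n a) t = (\<Sum>k\<le>n * n. a k * hat (real n * t - real k))"
  unfolding hat_interp_def by (intro path_at_mk_path continuous_intros)

lemma hat_interp_cong: "(\<And>k. k \<le> n * n \<Longrightarrow> a k = b k) \<Longrightarrow> hat_interp n a = hat_interp n b"
  by (simp add: hat_interp_def)

text \<open>
  For \<open>t\<close> in a fixed interval and large \<open>n\<close>, the interpolation at \<open>t\<close> is a convex combination of values
  of \<open>x\<close> at points within \<open>1 / n\<close> of \<open>t\<close>, and \<open>x\<close> is uniformly continuous there.
\<close>

lemma hat_interp_tendsto: "(\<lambda>n. hat_interp n (\<lambda>k. path_at x (real k / real n))) \<longlonglongrightarrow> x"
  unfolding tendsto_iff
proof (intro allI impI)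
  fix e' :: real assume e': "e' > 0"
  define e where "e = e' / 2"
  have e: "e > 0" using e' by (simp add: e_def)
  have "uniformly_continuous_on {0..1/e + 1} (path_at x)"
    by (intro compact_uniformly_continuous continuous_on_subset[OF path_at_continuous]) auto
  then obtain d where d: "d > 0"
    and unif: "\<And>s t. s \<in> {0..1/e + 1} \<Longrightarrow> t \<in> {0..1/e + 1} \<Longrightarrow> dist s t < d \<Longrightarrow>
      dist (path_at x s) (path_at x t) < e"
    using e unfolding uniformly_continuous_on_def by metis
  have ev: "\<forall>\<^sub>F n in sequentially. real n > max (max 1 (1 / d)) (1 / e)"
    by real_asymp
  show "\<forall>\<^sub>F n in sequentially. dist (hat_interp n (\<lambda>k. path_at x (real k / real n))) x < e'"
  proof (rule eventually_mono[OF ev])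
    fix n assume n: "real n > max (max 1 (1 / d)) (1 / e)"
    then have n1: "real n > 1" "1 / real n < d" "1 / e < real n"
      using d by (auto simp: field_simps)
    have "dist (hat_interp n (\<lambda>k. path_at x (real k / real n))) x \<le> e"
    proof (rule dist_cpath_leI[OF e])
      fix t assume t: "0 \<le> t" "t \<le> 1 / e"
      have one: "(\<Sum>k\<le>n * n. hat (real n * t - real k)) = 1"
        using t n1 by (intro sum_hat) (auto intro: mult_left_mono)
      have "path_at (hat_interp n (\<lambda>k. path_at x (real k / real n))) t - path_at x t =
          (\<Sum>k\<le>n * n. (path_at x (real k / real n) - path_at x t) * hat (real n * t - real k))"
        using t one by (simp add: path_at_hat_interp left_diff_distrib sum_subtractf
            flip: sum_distrib_left)
      also have "\<bar>\<dots>\<bar> \<le> (\<Sum>k\<le>n * n. e * hat (real n * t - real k))"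
      proof (rule order_trans[OF sum_abs], rule sum_mono)
        fix k assume "k \<in> {..n * n}"
        show "\<bar>(path_at x (real k / real n) - path_at x t) * hat (real n * t - real k)\<bar> \<le>
          e * hat (real n * t - real k)"
        proof (cases "hat (real n * t - real k) = 0")
          case False
          then have "\<bar>real n * t - real k\<bar> < 1"
            using hat_bounds(1,3)[of "real n * t - real k"] by linarith
          moreover have "real n * t - real k = real n * (t - real k / real n)"
            using n1 by (simp add: field_simps)
          ultimately have "real n * \<bar>t - real k / real n\<bar> < 1"
            using n1 by (simp add: abs_mult)
          then have *: "\<bar>t - real k / real n\<bar> < 1 / real n"
            using n1 by (simp add: field_simps)
          have "real k / real n \<ge> 0" by simp
          moreover have "real k / real n \<le> 1 / e + 1"
          proof -
            have "1 / real n \<le> 1" using n1 by simp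
            then show ?thesis using * t by linarith
          qed
          ultimately have "dist (path_at x (real k / real n)) (path_at x t) < e"
            using * n1 t by (intro unif) (auto simp: dist_real_def)
          then show ?thesis
            using hat_bounds(1) by (auto simp: abs_mult dist_real_def intro!: mult_mono)
        qed simp
      qed
      also have "\<dots> = e" using one by (simp flip: sum_distrib_left)
      finally show "\<bar>path_at (hat_interp n (\<lambda>k. path_at x (real k / real n))) t - path_at x t\<bar> \<le> e" .
    qed
    then show "dist (hat_interp n (\<lambda>k. path_at x (real k / real n))) x < e'"
      using e' by (simp add: e_def)
  qed
qed

lemma dist_hat_interp_le: "dist (hat_interp n a) (hat_interp n b) \<le> (\<Sum>k\<le>n * n. \<bar>a k - b k\<bar>)"
proof (rule field_le_epsilon)
  fix e :: real assume e: "e > 0"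
  have nn: "0 \<le> (\<Sum>k\<le>n * n. \<bar>a k - b k\<bar>)" by (simp add: sum_nonneg)
  show "dist (hat_interp n a) (hat_interp n b) \<le> (\<Sum>k\<le>n * n. \<bar>a k - b k\<bar>) + e"
  proof (rule dist_cpath_leI)
    show "0 < (\<Sum>k\<le>n * n. \<bar>a k - b k\<bar>) + e" using nn e by linarith
    fix t :: real assume t: "0 \<le> t"
    have "\<bar>path_at (hat_interp n a) t - path_at (hat_interp n b) t\<bar> =
        \<bar>\<Sum>k\<le>n * n. (a k - b k) * hat (real n * t - real k)\<bar>"
      using t by (simp add: path_at_hat_interp left_diff_distrib sum_subtractf)
    also have "\<dots> \<le> (\<Sum>k\<le>n * n. \<bar>a k - b k\<bar>)"
      by (rule order_trans[OF sum_abs], rule sum_mono)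
        (auto simp: abs_mult hat_bounds intro!: mult_left_le)
    finally show "\<bar>path_at (hat_interp n a) t - path_at (hat_interp n b) t\<bar> \<le>
        (\<Sum>k\<le>n * n. \<bar>a k - b k\<bar>) + e" using e by linarith
  qed
qed

lemma continuous_on_hat_interp: "continuous_on UNIV (hat_interp n)"
proof (intro continuous_at_imp_continuous_on ballI)
  fix a :: "nat \<Rightarrow> real"
  have "((\<lambda>b. \<Sum>k\<le>n * n. \<bar>b k - a k\<bar>) \<longlongrightarrow> (\<Sum>k\<le>n * n. \<bar>a k - a k\<bar>)) (at a)"
    by (intro tendsto_intros isContD[OF continuous_on_interior[OF continuous_on_product_coordinates]])
       auto
  then have "((\<lambda>b. \<Sum>k\<le>n * n. \<bar>b k - a k\<bar>) \<longlongrightarrow> 0) (at a)" by simp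
  then have "((\<lambda>b. dist (hat_interp n b) (hat_interp n a)) \<longlongrightarrow> 0) (at a)"
    by (rule tendsto_sandwich[OF _ _ tendsto_const, rotated 2])
      (auto simp: dist_hat_interp_le)
  then show "isCont (hat_interp n) a"
    unfolding continuous_at by (subst tendsto_dist_iff)
qed

lemma measurable_hat_interp:
  assumes "\<And>k. (\<lambda>\<omega>. c \<omega> k) \<in> borel_measurable M"
  shows "(\<lambda>\<omega>. hat_interp n (c \<omega>)) \<in> borel_measurable M"
proof -
  have "c \<in> borel_measurable M"
    by (rule measurable_coordinatewise_then_product) (use assms in auto)
  from measurable_compose[OF this borel_measurable_continuous_onI[OF continuous_on_hat_interp]]
  show ?thesis .
qed

text \<open>
  Interpolations depend continuously on finitely many coordinates, hence are measurable, and a pointwise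
  limit of measurable maps into a metric space is measurable.  This replaces an argument by
  separability of the path space.
\<close>

lemma measurable_cpathI:
  assumes "\<And>t. t \<ge> 0 \<Longrightarrow> (\<lambda>\<omega>. path_at (P \<omega>) t) \<in> borel_measurable M"
  shows "P \<in> borel_measurable M"
proof (rule borel_measurable_LIMSEQ_metric)
  show "(\<lambda>\<omega>. hat_interp n (\<lambda>k. path_at (P \<omega>) (real k / real n))) \<in> borel_measurable M" for n
    by (intro measurable_hat_interp assms) simp
  show "(\<lambda>n. hat_interp n (\<lambda>k. path_at (P \<omega>) (real k / real n))) \<longlonglongrightarrow> P \<omega>" for \<omega>
    by (rule hat_interp_tendsto)
qed

text \<open>
  Outside the full-measure event \<open>G\<close> the path is set to zero.  Measurability is demanded only of the
  modified coordinates, since the time-changed drift takes uncontrolled values off \<open>G\<close>.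
\<close>

lemma path_versionI:
  assumes G: "G \<in> sets M" "AE \<omega> in M. \<omega> \<in> G"
    and cont: "\<And>\<omega>. \<omega> \<in> G \<Longrightarrow> continuous_on {0..} (\<lambda>t. Y t \<omega>)"
    and meas: "\<And>t. t \<ge> 0 \<Longrightarrow> (\<lambda>\<omega>. if \<omega> \<in> G then Y t \<omega> else 0) \<in> borel_measurable M"
  shows "path_version M Y (\<lambda>\<omega>. mk_path (\<lambda>t. if \<omega> \<in> G then Y t \<omega> else 0))"
proof -
  have *: "path_at (mk_path (\<lambda>t. if \<omega> \<in> G then Y t \<omega> else 0)) t = (if \<omega> \<in> G then Y t \<omega> else 0)"
    if "t \<ge> 0" for t \<omega>
    using that cont[of \<omega>] by (cases "\<omega> \<in> G") (simp_all add: path_at_mk_path)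
  show ?thesis
    unfolding path_version_def
    using G(2) by (auto intro!: measurable_cpathI simp: * meas)
qed

lemma path_version_exists:
  assumes "\<And>t. t \<ge> 0 \<Longrightarrow> Y t \<in> borel_measurable M"
    and "AE \<omega> in M. continuous_on {0..} (\<lambda>t. Y t \<omega>)"
  shows "\<exists>P. path_version M Y P"
proof -
  obtain G where G: "{\<omega> \<in> space M. \<not> continuous_on {0..} (\<lambda>t. Y t \<omega>)} \<subseteq> G" "G \<in> null_sets M"
    using AE_E[OF assms(2)] by (metis (no_types, lifting) null_setsI)
  have "path_version M Y (\<lambda>\<omega>. mk_path (\<lambda>t. if \<omega> \<in> space M - G then Y t \<omega> else 0))"
  proof (rule path_versionI)
    show "space M - G \<in> sets M" "AE \<omega> in M. \<omega> \<in> space M - G"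
      using G(2) AE_not_in[OF G(2)] by auto
    then show "(\<lambda>\<omega>. if \<omega> \<in> space M - G then Y t \<omega> else 0) \<in> borel_measurable M" if "t \<ge> 0" for t
      using assms(1)[OF that] by measurable
  qed (use G(1) in auto)
  then show ?thesis by blast
qed

text \<open>
  Expectations of bounded continuous functions pass to the limit, and the indicator of a closed set is
  a decreasing limit of such functions of the distance to the set.
\<close>

lemma distr_eq_of_limits:
  fixes P :: "'a \<Rightarrow> 'c :: metric_space" and Q :: "'b \<Rightarrow> 'c"
  assumes "prob_space M" "prob_space N"
    and P: "\<And>n. P' n \<in> borel_measurable M" "\<And>\<omega>. (\<lambda>n. P' n \<omega>) \<longlonglongrightarrow> P \<omega>"
    and Q: "\<And>n. Q' n \<in> borel_measurable N" "\<And>\<omega>. (\<lambda>n. Q' n \<omega>) \<longlonglongrightarrow> Q \<omega>"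
    and eq: "\<And>n. distr M borel (P' n) = distr N borel (Q' n)"
  shows "distr M borel P = distr N borel Q"
proof -
  interpret M: prob_space M by fact
  interpret N: prob_space N by fact
  have Pm: "P \<in> borel_measurable M" by (rule borel_measurable_LIMSEQ_metric[OF P])
  have Qm: "Q \<in> borel_measurable N" by (rule borel_measurable_LIMSEQ_metric[OF Q])
  interpret MP: prob_space "distr M borel P" by (rule M.prob_space_distr[OF Pm])
  interpret NQ: prob_space "distr N borel Q" by (rule N.prob_space_distr[OF Qm])
  have bdd: "(\<integral>x. g x \<partial>distr M borel P) = (\<integral>x. g x \<partial>distr N borel Q)"
    if g: "continuous_on UNIV g" "\<And>x. \<bar>g x\<bar> \<le> 1" for g :: "'c \<Rightarrow> real"
  proof -
    have gm: "g \<in> borel_measurable borel" by (rule borel_measurable_continuous_onI[OF g(1)])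
    have 1: "(\<lambda>n. \<integral>\<omega>. g (P' n \<omega>) \<partial>M) \<longlonglongrightarrow> (\<integral>\<omega>. g (P \<omega>) \<partial>M)"
    proof (rule integral_dominated_convergence[where w="\<lambda>_. 1"])
      show "AE \<omega> in M. (\<lambda>n. g (P' n \<omega>)) \<longlonglongrightarrow> g (P \<omega>)"
        using P(2) g(1) by (auto intro!: continuous_on_tendsto_compose[OF g(1)])
    qed (use gm P(1) Pm g(2) in \<open>auto intro: measurable_compose\<close>)
    have 2: "(\<lambda>n. \<integral>\<omega>. g (Q' n \<omega>) \<partial>N) \<longlonglongrightarrow> (\<integral>\<omega>. g (Q \<omega>) \<partial>N)"
    proof (rule integral_dominated_convergence[where w="\<lambda>_. 1"])
      show "AE \<omega> in N. (\<lambda>n. g (Q' n \<omega>)) \<longlonglongrightarrow> g (Q \<omega>)"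
        using Q(2) g(1) by (auto intro!: continuous_on_tendsto_compose[OF g(1)])
    qed (use gm Q(1) Qm g(2) in \<open>auto intro: measurable_compose\<close>)
    have "(\<integral>\<omega>. g (P' n \<omega>) \<partial>M) = (\<integral>\<omega>. g (Q' n \<omega>) \<partial>N)" for n
      using eq[of n] integral_distr[OF P(1)[of n] gm] integral_distr[OF Q(1)[of n] gm] by simp
    then have "(\<integral>\<omega>. g (P \<omega>) \<partial>M) = (\<integral>\<omega>. g (Q \<omega>) \<partial>N)"
      using LIMSEQ_unique 1 2 by fastforce
    then show ?thesis
      using integral_distr[OF Pm gm] integral_distr[OF Qm gm] by simp
  qed
  have closed: "measure (distr M borel P) C = measure (distr N borel Q) C" if C: "closed C" for C
  proof (cases "C = {}")
    case False
    define g where "g j x = max 0 (1 - real j * infdist x C)" for j :: nat and x :: 'c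
    have g: "continuous_on UNIV (g j)" "\<bar>g j x\<bar> \<le> 1" for j x
      unfolding g_def
      by (intro continuous_intros) (auto simp: infdist_nonneg)
    have gm[measurable]: "g j \<in> borel_measurable borel" for j
      by (rule borel_measurable_continuous_onI[OF g(1)])
    have lim: "(\<lambda>j. g j x) \<longlonglongrightarrow> indicator C x" for x
    proof (cases "x \<in> C")
      case True
      then show ?thesis by (simp add: g_def)
    next
      case x: False
      then have pos: "infdist x C > 0"
        using C False infdist_nonneg[of x C] in_closed_iff_infdist_zero[of C x] by fastforce
      have "\<forall>\<^sub>F j in sequentially. real j > 1 / infdist x C"
        using pos by real_asymp
      then have "\<forall>\<^sub>F j in sequentially. g j x = 0"
        by eventually_elim (use pos in \<open>simp add: g_def field_simps\<close>)
      then show ?thesis using x by (simp add: tendsto_eventually)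
    qed
    have [measurable]: "C \<in> sets borel" using C by simp
    have 1: "(\<lambda>j. \<integral>x. g j x \<partial>distr M borel P) \<longlonglongrightarrow> (\<integral>x. indicator C x \<partial>distr M borel P)"
      by (rule integral_dominated_convergence[where w="\<lambda>_. 1"]) (use lim g in auto)
    have 2: "(\<lambda>j. \<integral>x. g j x \<partial>distr N borel Q) \<longlonglongrightarrow> (\<integral>x. indicator C x \<partial>distr N borel Q)"
      by (rule integral_dominated_convergence[where w="\<lambda>_. 1"]) (use lim g in auto)
    have "(\<integral>x. indicator C x \<partial>distr M borel P) = ((\<integral>x. indicator C x \<partial>distr N borel Q) :: real)"
      using LIMSEQ_unique[OF 1] 2 bdd[OF g] by simp
    then show ?thesis by simp
  qed simp
  show ?thesis
  proof (rule measure_eqI_generator_eq[where E="Collect closed" and \<Omega>=UNIV and A="\<lambda>_. UNIV"])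
    show "Int_stable (Collect closed :: 'c set set)" by (auto simp: Int_stable_def)
    show "emeasure (distr M borel P) X = emeasure (distr N borel Q) X" if "X \<in> Collect closed" for X
      using closed[of X] that by (simp add: MP.emeasure_eq_measure NQ.emeasure_eq_measure)
    show "sets (distr M borel P) = sigma_sets UNIV (Collect closed)"
      "sets (distr N borel Q) = sigma_sets UNIV (Collect closed)"
      by (simp_all add: borel_eq_closed)
    show "emeasure (distr M borel P) UNIV \<noteq> \<infinity>" using MP.emeasure_finite by simp
  qed auto
qed

text \<open>
  A test function \<open>f\<close> need not be uniformly continuous.  But the set of points near which \<open>f\<close> varies by
  more than \<open>r\<close> within distance \<open>1 / m\<close> is open and decreases to the empty set, so it has small measure
  under the common law \<open>\<nu>\<close> of the comparison variables for some \<open>m\<close>; off this set closeness of \<open>P i\<close> and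
  \<open>Q i\<close> is enough.
\<close>

lemma weakly_converges_of_close:
  fixes \<nu> :: "'c :: metric_space measure"
  assumes \<nu>: "prob_space \<nu>" "sets \<nu> = sets borel"
    and ev: "\<forall>\<^sub>F i in F. prob_space (M i) \<and> P i \<in> borel_measurable (M i) \<and>
      Q i \<in> borel_measurable (M i) \<and> distr (M i) borel (Q i) = \<nu>"
    and close: "\<And>\<epsilon> \<delta>. \<epsilon> > 0 \<Longrightarrow> \<delta> > 0 \<Longrightarrow> \<forall>\<^sub>F i in F. \<exists>E\<in>sets (M i).
      measure (M i) E \<le> \<delta> \<and> (AE \<omega> in M i. \<omega> \<notin> E \<longrightarrow> dist (P i \<omega>) (Q i \<omega>) < \<epsilon>)"
  shows "weakly_converges F (\<lambda>i. distr (M i) borel (P i)) \<nu>"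
  unfolding weakly_converges_def
proof (intro allI impI)
  fix f :: "'c \<Rightarrow> real" assume "continuous_on UNIV f \<and> bounded (range f)"
  then have f: "continuous_on UNIV f" and "bounded (range f)" by auto
  then obtain C where "C > 0" and C: "\<And>x. \<bar>f x\<bar> \<le> C"
    by (auto simp: bounded_pos)
  have fm: "f \<in> borel_measurable borel" by (rule borel_measurable_continuous_onI[OF f])
  interpret \<nu>: prob_space \<nu> by fact
  show "((\<lambda>i. \<integral>x. f x \<partial>distr (M i) borel (P i)) \<longlongrightarrow> (\<integral>x. f x \<partial>\<nu>)) F"
    unfolding tendsto_iff
  proof (intro allI impI)
    fix e :: real assume e: "e > 0"
    define r where "r = e / 4"
    have r: "r > 0" using e by (simp add: r_def)
    \<comment> \<open>The points at which \<open>f\<close> is not yet steady at scale \<open>1 / (m + 1)\<close>.\<close>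
    define A where "A m = {x. \<exists>y. dist x y < 1 / real (Suc m) \<and> \<bar>f y - f x\<bar> > r}" for m
    have opA: "open (A m)" for m
    proof -
      have "open {x. dist x y < 1 / real (Suc m) \<and> \<bar>f y - f x\<bar> > r}" for y
        using f by (intro open_Collect_conj open_Collect_less continuous_intros) auto
      then have "open (\<Union>y. {x. dist x y < 1 / real (Suc m) \<and> \<bar>f y - f x\<bar> > r})"
        by blast
      moreover have "(\<Union>y. {x. dist x y < 1 / real (Suc m) \<and> \<bar>f y - f x\<bar> > r}) = A m"
        by (auto simp: A_def)
      ultimately show ?thesis by simp
    qed
    have "(\<lambda>m. measure \<nu> (A m)) \<longlonglongrightarrow> measure \<nu> (\<Inter>m. A m)"
    proof (rule \<nu>.finite_Lim_measure_decseq)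
      show "range A \<subseteq> sets \<nu>" using opA \<nu>(2) by auto
      show "decseq A"
      proof (rule decseq_SucI, rule subsetI)
        fix m x assume "x \<in> A (Suc m)"
        then obtain y where y: "dist x y < 1 / real (Suc (Suc m))" "\<bar>f y - f x\<bar> > r"
          by (auto simp: A_def)
        have "1 / real (Suc (Suc m)) \<le> 1 / real (Suc m)" by (simp add: frac_le)
        then show "x \<in> A m" using y unfolding A_def by force
      qed
    qed
    also have "(\<Inter>m. A m) = {}"
    proof -
      have "\<exists>m. x \<notin> A m" for x
      proof -
        have "isCont f x" using f by (simp add: continuous_on_eq_continuous_at)
        then obtain d where d: "d > 0" "\<And>y. dist y x < d \<Longrightarrow> dist (f y) (f x) < r"
          unfolding continuous_at_eps_delta using r by blast
        obtain m where "1 / real (Suc m) < d"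
          using d(1) nat_approx_posE by blast
        then have "\<bar>f y - f x\<bar> < r" if "dist x y < 1 / real (Suc m)" for y
          using d(2)[of y] that by (simp add: dist_commute dist_real_def)
        then have "x \<notin> A m"
          unfolding A_def by (auto simp: not_less intro: less_imp_le)
        then show ?thesis ..
      qed
      then show ?thesis by blast
    qed
    finally have "(\<lambda>m. measure \<nu> (A m)) \<longlonglongrightarrow> 0" by simp
    then have "\<forall>\<^sub>F m in sequentially. measure \<nu> (A m) < r / (2 * C)"
      using r \<open>C > 0\<close> by (intro order_tendstoD) auto
    then obtain m where m: "measure \<nu> (A m) < r / (2 * C)"
      by (auto simp: eventually_sequentially)
    have "\<forall>\<^sub>F i in F. \<exists>E\<in>sets (M i). measure (M i) E \<le> r / (2 * C) \<and>
       (AE \<omega> in M i. \<omega> \<notin> E \<longrightarrow> dist (P i \<omega>) (Q i \<omega>) < 1 / real (Suc m))"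
      using r \<open>C > 0\<close> by (intro close) auto
    with ev show "\<forall>\<^sub>F i in F. dist (\<integral>x. f x \<partial>distr (M i) borel (P i)) (\<integral>x. f x \<partial>\<nu>) < e"
    proof eventually_elim
      fix i
      assume i: "prob_space (M i) \<and> P i \<in> borel_measurable (M i) \<and>
        Q i \<in> borel_measurable (M i) \<and> distr (M i) borel (Q i) = \<nu>"
      assume "\<exists>E\<in>sets (M i). measure (M i) E \<le> r / (2 * C) \<and>
       (AE \<omega> in M i. \<omega> \<notin> E \<longrightarrow> dist (P i \<omega>) (Q i \<omega>) < 1 / real (Suc m))"
      then obtain E where [measurable]: "E \<in> sets (M i)" and E: "measure (M i) E \<le> r / (2 * C)"
        and AE: "AE \<omega> in M i. \<omega> \<notin> E \<longrightarrow> dist (P i \<omega>) (Q i \<omega>) < 1 / real (Suc m)" by blast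
      interpret M: prob_space "M i" using i by simp
      have Pm[measurable]: "P i \<in> borel_measurable (M i)" and Qm[measurable]: "Q i \<in> borel_measurable (M i)"
        and Q\<nu>: "distr (M i) borel (Q i) = \<nu>" using i by auto
      have Am[measurable]: "A m \<in> sets borel" using opA by simp
      define D where "D = Q i -` A m \<inter> space (M i)"
      have Dm[measurable]: "D \<in> sets (M i)" unfolding D_def by measurable
      have D: "measure (M i) D < r / (2 * C)"
        using m Q\<nu>[symmetric] by (simp add: D_def measure_distr)
      have intP: "integrable (M i) (\<lambda>\<omega>. f (P i \<omega>))" "integrable (M i) (\<lambda>\<omega>. f (Q i \<omega>))"
        using fm C by (auto intro!: M.integrable_const_bound[where B=C] measurable_compose[OF _ fm])
      have int_ind: "integrable (M i) (\<lambda>\<omega>. 2 * C * indicator D \<omega>)"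
          "integrable (M i) (\<lambda>\<omega>. 2 * C * indicator E \<omega>)"
        by (auto simp: M.emeasure_eq_measure intro!: integrable_mult_right integrable_real_indicator)
      have "\<bar>(\<integral>x. f x \<partial>distr (M i) borel (P i)) - (\<integral>x. f x \<partial>\<nu>)\<bar> =
          \<bar>\<integral>\<omega>. f (P i \<omega>) - f (Q i \<omega>) \<partial>M i\<bar>"
        using Q\<nu>[symmetric] intP by (simp add: integral_distr[OF Pm fm] integral_distr[OF Qm fm])
      also have "\<dots> \<le> (\<integral>\<omega>. \<bar>f (P i \<omega>) - f (Q i \<omega>)\<bar> \<partial>M i)"
        by (rule integral_abs_bound)
      also have "\<dots> \<le> (\<integral>\<omega>. r + 2 * C * indicator D \<omega> + 2 * C * indicator E \<omega> \<partial>M i)"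
      proof (rule integral_mono_AE)
        show "AE \<omega> in M i. \<bar>f (P i \<omega>) - f (Q i \<omega>)\<bar> \<le>
            r + 2 * C * indicator D \<omega> + 2 * C * indicator E \<omega>"
          using AE AE_space
        proof eventually_elim
          case (elim \<omega>)
          have "\<bar>f (P i \<omega>) - f (Q i \<omega>)\<bar> \<le> 2 * C"
            using C[of "P i \<omega>"] C[of "Q i \<omega>"] by linarith
          moreover have "\<bar>f (P i \<omega>) - f (Q i \<omega>)\<bar> \<le> r" if "\<omega> \<notin> D" "\<omega> \<notin> E"
            using elim that by (force simp: A_def D_def dist_commute)
          ultimately show ?case using r \<open>C > 0\<close> by (auto simp: indicator_def)
        qed
      qed (use intP int_ind in \<open>auto intro!: Bochner_Integration.integrable_add\<close>)
      also have "\<dots> = r + 2 * C * measure (M i) D + 2 * C * measure (M i) E"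
        using int_ind by (subst Bochner_Integration.integral_add,
            auto intro!: Bochner_Integration.integrable_add simp: M.prob_space)
      also have "\<dots> < r + 2 * C * (r / (2 * C)) + 2 * C * (r / (2 * C))"
        using D E \<open>C > 0\<close> by (intro add_less_le_mono add_strict_left_mono mult_strict_left_mono mult_left_mono) auto
      also have "\<dots> < e" using \<open>C > 0\<close> e by (simp add: r_def)
      finally show "dist (\<integral>x. f x \<partial>distr (M i) borel (P i)) (\<integral>x. f x \<partial>\<nu>) < e"
        by (simp add: dist_real_def)
    qed
  qed
qed

section \<open>Brownian motion\<close>

lemma standard_brownian_motionD:
  assumes "standard_brownian_motion M B"
  shows "prob_space M" "t \<ge> 0 \<Longrightarrow> B t \<in> borel_measurable M" "AE \<omega> in M. B 0 \<omega> = 0"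
    "0 \<le> s \<Longrightarrow> s < t \<Longrightarrow>
      distributed M lborel (\<lambda>\<omega>. B t \<omega> - B s \<omega>) (normal_density 0 (sqrt (t - s)))"
    "AE \<omega> in M. continuous_on {0..} (\<lambda>t. B t \<omega>)"
  using assms unfolding standard_brownian_motion_def by auto

definition increment :: "(real \<Rightarrow> 'a \<Rightarrow> real) \<Rightarrow> real \<Rightarrow> nat \<Rightarrow> 'a \<Rightarrow> real" where
  "increment B h i \<omega> = B (real (Suc i) * h) \<omega> - B (real i * h) \<omega>"

lemma sum_increment: "(\<Sum>i<k. increment B h i \<omega>) = B (real k * h) \<omega> - B 0 \<omega>"
  by (induction k) (simp_all add: increment_def)

context
  fixes M :: "'a measure" and B :: "real \<Rightarrow> 'a \<Rightarrow> real" and h :: real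
  assumes bm: "standard_brownian_motion M B" and h: "h > 0"
begin

interpretation prob_space M by (rule standard_brownian_motionD(1)[OF bm])

lemma measurable_increment: "increment B h i \<in> borel_measurable M"
  unfolding increment_def[abs_def] using h
  by (intro borel_measurable_diff standard_brownian_motionD(2)[OF bm]) auto

lemma indep_increments: "indep_vars (\<lambda>_. borel) (increment B h) {..<n}"
proof -
  have "0 \<le> real 0 * h \<and> (\<forall>i<n. real i * h \<le> real (Suc i) * h)"
    using h by (auto intro!: mult_right_mono)
  moreover have ind: "0 \<le> t 0 \<and> (\<forall>i<n. t i \<le> t (Suc i)) \<Longrightarrow>
      indep_vars (\<lambda>_. borel) (\<lambda>i \<omega>. B (t (Suc i)) \<omega> - B (t i) \<omega>) {..<n}" for t
    using bm unfolding standard_brownian_motion_def by blast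
  ultimately show ?thesis
    unfolding increment_def[abs_def] using ind[of "\<lambda>i. real i * h"] by simp
qed

lemma distributed_increment:
  "distributed M lborel (increment B h i) (normal_density 0 (sqrt h))"
proof -
  have "real (Suc i) * h - real i * h = h" by (simp add: algebra_simps)
  moreover have "real i * h < real (Suc i) * h" using h by (simp add: algebra_simps)
  ultimately show ?thesis
    using standard_brownian_motionD(4)[OF bm, of "real i * h" "real (Suc i) * h"] h
    unfolding increment_def[abs_def] by simp
qed

lemma integrable_increment_power: "integrable M (\<lambda>\<omega>. increment B h i \<omega> ^ k)"
  using integrable_normal_moment[of "sqrt h" 0 k] h
    distributed_integrable[OF distributed_increment[of i], of "\<lambda>x. x ^ k"] by simp

lemma expectation_increment:
  "expectation (increment B h i) = 0"
  "expectation (\<lambda>\<omega>. increment B h i \<omega> ^ 2) = h"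
  "expectation (\<lambda>\<omega>. increment B h i \<omega> ^ 4) = 3 * h\<^sup>2"
proof -
  have *: "expectation (\<lambda>\<omega>. increment B h i \<omega> ^ k) =
      (\<integral>x. normal_density 0 (sqrt h) x * x ^ k \<partial>lborel)" for k
    by (subst distributed_integral[OF distributed_increment[of i]]) auto
  show "expectation (increment B h i) = 0"
    using *[of 1] integral_normal_moment_odd[of "sqrt h" 0 0] h by simp
  show "expectation (\<lambda>\<omega>. increment B h i \<omega> ^ 2) = h"
    using *[of 2] integral_normal_moment_even[of "sqrt h" 0 1] h by (simp add: fact_numeral)
  show "expectation (\<lambda>\<omega>. increment B h i \<omega> ^ 4) = 3 * h\<^sup>2"
    using *[of 4] integral_normal_moment_even[of "sqrt h" 0 2] h
    by (simp add: fact_numeral power_divide power2_eq_square)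
qed

lemma distr_increments:
  assumes "n > 0"
  shows "distr M (PiM {..<n} (\<lambda>_. borel)) (\<lambda>\<omega>. \<lambda>i\<in>{..<n}. increment B h i \<omega>) =
    PiM {..<n} (\<lambda>_. density lborel (normal_density 0 (sqrt h)))"
proof -
  have "distr M borel (increment B h i) = density lborel (normal_density 0 (sqrt h))" for i
    using distributed_distr_eq_density[OF distributed_increment[of i]]
    by (metis distr_cong sets_lborel)
  then show ?thesis
    using indep_increments[of n] assms measurable_increment
    by (subst (asm) indep_vars_iff_distr_eq_PiM) auto
qed

end

lemma standard_brownian_motion_uminus:
  assumes bm: "standard_brownian_motion M B"
  shows "standard_brownian_motion M (\<lambda>t \<omega>. - B t \<omega>)"
proof -
  interpret prob_space M by (rule standard_brownian_motionD(1)[OF bm])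
  show ?thesis
    unfolding standard_brownian_motion_def
  proof (intro conjI allI impI)
    fix n and t :: "nat \<Rightarrow> real" assume "0 \<le> t 0 \<and> (\<forall>i<n. t i \<le> t (Suc i))"
    then have "indep_vars (\<lambda>_. borel) (\<lambda>i \<omega>. B (t (Suc i)) \<omega> - B (t i) \<omega>) {..<n}"
      using bm unfolding standard_brownian_motion_def by blast
    from indep_vars_compose2[OF this, of "\<lambda>_ x. - x" "\<lambda>_. borel"]
    show "indep_vars (\<lambda>_. borel) (\<lambda>i \<omega>. - B (t (Suc i)) \<omega> - - B (t i) \<omega>) {..<n}" by simp
  next
    fix s t :: real assume "0 \<le> s \<and> s < t"
    then show "distributed M lborel (\<lambda>\<omega>. - B t \<omega> - - B s \<omega>) (normal_density 0 (sqrt (t - s)))"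
      using normal_density_affine[OF standard_brownian_motionD(4)[OF bm, of s t], of "-1" 0] by simp
  next
    show "AE \<omega> in M. - B 0 \<omega> = 0"
      using standard_brownian_motionD(3)[OF bm] by simp
    show "AE \<omega> in M. continuous_on {0..} (\<lambda>t. - B t \<omega>)"
      using standard_brownian_motionD(5)[OF bm] by eventually_elim (intro continuous_intros)
  qed (use standard_brownian_motionD[OF bm] prob_space_axioms in auto)
qed

text \<open>
  The interpolation with step \<open>1 / n\<close> is a fixed measurable function of finitely many increments, whose
  joint law is a product of centred normal laws.  Let \<open>n\<close> tend to infinity.
\<close>

lemma brownian_path_law_unique:
  assumes B: "standard_brownian_motion M B" "path_version M B P"
    and W: "standard_brownian_motion N W" "path_version N W Q"
  shows "distr M borel P = distr N borel Q"
proof -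
  define J where "J n y = hat_interp n (\<lambda>k. if k \<le> n * n then \<Sum>i<k. y i else 0)"
    for n and y :: "nat \<Rightarrow> real"
  have J[measurable]: "J n \<in> borel_measurable (PiM {..<n * n} (\<lambda>_. borel))" for n
    unfolding J_def
  proof (intro measurable_hat_interp)
    fix k
    show "(\<lambda>y. if k \<le> n * n then \<Sum>i<k. y i else 0 :: real) \<in>
        borel_measurable (PiM {..<n * n} (\<lambda>_. borel))"
      by (cases "k \<le> n * n") (auto intro!: borel_measurable_sum measurable_component_singleton)
  qed
  have law: "distr M' borel (\<lambda>\<omega>. hat_interp n (\<lambda>k. path_at (R \<omega>) (real k / real n))) =
      distr (PiM {..<n * n} (\<lambda>_. density lborel (normal_density 0 (sqrt (1 / n))))) borel (J n)"
    if bm: "standard_brownian_motion M' Y" and pv: "path_version M' Y R" and n: "n > 0"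
    for M' :: "'c measure" and Y R n
  proof -
    interpret prob_space M' by (rule standard_brownian_motionD(1)[OF bm])
    let ?inc = "\<lambda>\<omega>. \<lambda>i\<in>{..<n * n}. increment Y (1 / n) i \<omega>"
    have h: "1 / real n > 0" using n by simp
    have inc: "?inc \<in> measurable M' (PiM {..<n * n} (\<lambda>_. borel))"
      by (intro measurable_restrict measurable_increment[OF bm h])
    have Rm: "R \<in> borel_measurable M'" using pv by (simp add: path_version_def)
    have "distr M' borel (\<lambda>\<omega>. hat_interp n (\<lambda>k. path_at (R \<omega>) (real k / real n))) =
        distr M' borel (\<lambda>\<omega>. J n (?inc \<omega>))"
    proof (rule distr_cong_AE)
      have "AE \<omega> in M'. \<forall>t\<ge>0. path_at (R \<omega>) t = Y t \<omega>"
        using pv by (simp add: path_version_def)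
      with standard_brownian_motionD(3)[OF bm]
      show "AE \<omega> in M'. hat_interp n (\<lambda>k. path_at (R \<omega>) (real k / real n)) = J n (?inc \<omega>)"
      proof eventually_elim
        case (elim \<omega>)
        have "(\<Sum>i<k. ?inc \<omega> i) = path_at (R \<omega>) (real k / real n)" if "k \<le> n * n" for k
        proof -
          have "(\<Sum>i<k. ?inc \<omega> i) = (\<Sum>i<k. increment Y (1 / n) i \<omega>)"
            using that by (intro sum.cong) auto
          then show ?thesis using elim by (simp add: sum_increment)
        qed
        then show ?case unfolding J_def by (intro hat_interp_cong) auto
      qed
      show "(\<lambda>\<omega>. hat_interp n (\<lambda>k. path_at (R \<omega>) (real k / real n))) \<in> borel_measurable M'"
        by (intro measurable_hat_interp measurable_compose[OF Rm measurable_path_at]) simp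
      show "(\<lambda>\<omega>. J n (?inc \<omega>)) \<in> borel_measurable M'"
        by (rule measurable_compose[OF inc J])
    qed simp_all
    also have "\<dots> = distr (distr M' (PiM {..<n * n} (\<lambda>_. borel)) ?inc) borel (J n)"
      using distr_distr[OF J[of n] inc] by (simp add: comp_def)
    also have "distr M' (PiM {..<n * n} (\<lambda>_. borel)) ?inc =
        PiM {..<n * n} (\<lambda>_. density lborel (normal_density 0 (sqrt (1 / n))))"
      using n by (intro distr_increments[OF bm h]) simp
    finally show ?thesis .
  qed
  have Pm: "P \<in> borel_measurable M" and Qm: "Q \<in> borel_measurable N"
    using B(2) W(2) by (auto simp: path_version_def)
  show ?thesis
  proof (rule distr_eq_of_limits)
    show "prob_space M" "prob_space N"
      using B(1) W(1) by (auto intro: standard_brownian_motionD)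
    show "(\<lambda>n. hat_interp (Suc n) (\<lambda>k. path_at (P \<omega>) (real k / real (Suc n)))) \<longlonglongrightarrow> P \<omega>" for \<omega>
      by (rule LIMSEQ_Suc[OF hat_interp_tendsto])
    show "(\<lambda>n. hat_interp (Suc n) (\<lambda>k. path_at (Q \<omega>) (real k / real (Suc n)))) \<longlonglongrightarrow> Q \<omega>" for \<omega>
      by (rule LIMSEQ_Suc[OF hat_interp_tendsto])
    show "(\<lambda>\<omega>. hat_interp (Suc n) (\<lambda>k. path_at (P \<omega>) (real k / real (Suc n)))) \<in> borel_measurable M" for n
      by (intro measurable_hat_interp measurable_compose[OF Pm measurable_path_at]) simp
    show "(\<lambda>\<omega>. hat_interp (Suc n) (\<lambda>k. path_at (Q \<omega>) (real k / real (Suc n)))) \<in> borel_measurable N" for n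
      by (intro measurable_hat_interp measurable_compose[OF Qm measurable_path_at]) simp
    show "distr M borel (\<lambda>\<omega>. hat_interp (Suc n) (\<lambda>k. path_at (P \<omega>) (real k / real (Suc n)))) =
        distr N borel (\<lambda>\<omega>. hat_interp (Suc n) (\<lambda>k. path_at (Q \<omega>) (real k / real (Suc n))))" for n
      by (simp only: law[OF B, of "Suc n"] law[OF W, of "Suc n"] zero_less_Suc)
  qed
qed

lemma normal_prob_abs_le_less_1:
  assumes "prob_space M" and X: "distributed M lborel X (normal_density 0 \<sigma>)" and \<sigma>: "\<sigma> > 0"
  shows "measure M {\<omega> \<in> space M. \<bar>X \<omega>\<bar> \<le> R} < 1"
proof (rule ccontr)
  interpret prob_space M by fact
  have Xm[measurable]: "X \<in> borel_measurable M"
    using X by (auto simp: distributed_def)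
  assume "\<not> ?thesis"
  then have "prob {\<omega> \<in> space M. \<bar>X \<omega>\<bar> \<le> R} = 1"
    using prob_le_1[of "{\<omega> \<in> space M. \<bar>X \<omega>\<bar> \<le> R}"] by linarith
  then have "AE \<omega> in M. \<bar>X \<omega>\<bar> \<le> R"
    by (subst (asm) prob_Collect_eq_1) auto
  then have "AE \<omega> in M. X \<omega> \<notin> {R<..R+1}" by eventually_elim auto
  then have "AE x in distr M lborel X. x \<notin> {R<..R+1}"
    by (subst AE_distr_iff) auto
  then have "AE x in density lborel (normal_density 0 \<sigma>). x \<notin> {R<..R+1}"
    by (simp only: distributed_distr_eq_density[OF X])
  then have "AE x in lborel. x \<notin> {R<..R+1}"
    using normal_density_pos[OF \<sigma>] by (subst (asm) AE_density) auto
  then have "{R<..R+1} \<in> null_sets lborel"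
    using AE_iff_null_sets[of "{R<..R+1}" lborel] by simp
  then have "emeasure lborel {R<..R+1} = 0" by auto
  then show False by simp
qed

text \<open>
  The increments over unit intervals are independent and identically distributed, and each exceeds \<open>R\<close>
  with a fixed positive probability.
\<close>

lemma brownian_increments_unbounded:
  assumes bm: "standard_brownian_motion M B"
  shows "AE \<omega> in M. \<forall>R. \<exists>n. \<bar>increment B 1 n \<omega>\<bar> > R"
proof -
  interpret prob_space M by (rule standard_brownian_motionD(1)[OF bm])
  note [measurable] = measurable_increment[OF bm zero_less_one]
  have "AE \<omega> in M. \<exists>n. \<bar>increment B 1 n \<omega>\<bar> > real r" for r
  proof -
    define D where "D = {x. \<bar>x\<bar> \<le> real r}"
    define p where "p = measure (density lborel (normal_density 0 (sqrt 1))) D"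
    have D[measurable]: "D \<in> sets borel" unfolding D_def by measurable
    have p: "prob (increment B 1 i -` D \<inter> space M) = p" for i
    proof -
      have "p = measure (distr M lborel (increment B 1 i)) D"
        unfolding p_def by (simp only: distributed_distr_eq_density[OF distributed_increment[OF bm zero_less_one]])
      then show ?thesis by (simp add: measure_distr)
    qed
    have "prob {\<omega> \<in> space M. \<bar>increment B 1 0 \<omega>\<bar> \<le> real r} < 1"
      by (rule normal_prob_abs_le_less_1[OF prob_space_axioms distributed_increment[OF bm zero_less_one]]) simp
    also have "{\<omega> \<in> space M. \<bar>increment B 1 0 \<omega>\<bar> \<le> real r} = increment B 1 0 -` D \<inter> space M"
      by (auto simp: D_def)
    finally have p1: "p < 1" using p by simp
    define A where "A = {\<omega> \<in> space M. \<forall>n. \<bar>increment B 1 n \<omega>\<bar> \<le> real r}"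
    have A[measurable]: "A \<in> sets M" unfolding A_def by measurable
    have "prob A \<le> p ^ Suc n" for n
    proof -
      have "prob A \<le> prob (\<Inter>i\<in>{..<Suc n}. increment B 1 i -` D \<inter> space M)"
        by (rule finite_measure_mono) (auto simp: A_def D_def)
      also have "\<dots> = (\<Prod>i<Suc n. prob (increment B 1 i -` D \<inter> space M))"
        by (rule indep_varsD_finite[OF indep_increments[OF bm zero_less_one]]) auto
      finally show ?thesis by (simp add: p)
    qed
    moreover have "(\<lambda>n. p ^ Suc n) \<longlonglongrightarrow> 0"
      using p1 by (intro LIMSEQ_Suc LIMSEQ_power_zero) (auto simp: p_def)
    ultimately have "prob A \<le> 0"
      by (intro LIMSEQ_le_const[of "\<lambda>n. p ^ Suc n"]) auto
    then have "emeasure M A = 0" by (simp add: emeasure_eq_measure measure_le_0_iff)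
    then have "AE \<omega> in M. \<omega> \<notin> A" by (intro AE_not_in) auto
    then show ?thesis
      using AE_space by eventually_elim (auto simp: A_def not_le)
  qed
  then have "AE \<omega> in M. \<forall>r. \<exists>n. \<bar>increment B 1 n \<omega>\<bar> > real r"
    by (simp add: AE_all_countable)
  then show ?thesis
  proof eventually_elim
    case (elim \<omega>)
    show ?case
    proof
      fix R obtain r :: nat where "R \<le> real r" using real_arch_simple by blast
      then show "\<exists>n. \<bar>increment B 1 n \<omega>\<bar> > R" using elim by (meson le_less_trans)
    qed
  qed
qed

lemma orthogonal_sum_second_moment:
  fixes Y :: "nat \<Rightarrow> 'a \<Rightarrow> real"
  assumes int: "\<And>i j. i < n \<Longrightarrow> j < n \<Longrightarrow> integrable M (\<lambda>\<omega>. Y i \<omega> * Y j \<omega>)"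
    and orth: "\<And>i j. i < j \<Longrightarrow> j < n \<Longrightarrow> (\<integral>\<omega>. Y i \<omega> * Y j \<omega> \<partial>M) = 0"
    and var: "\<And>i. i < n \<Longrightarrow> (\<integral>\<omega>. Y i \<omega> * Y i \<omega> \<partial>M) \<le> c"
  shows "integrable M (\<lambda>\<omega>. (\<Sum>i<n. Y i \<omega>)\<^sup>2) \<and> (\<integral>\<omega>. (\<Sum>i<n. Y i \<omega>)\<^sup>2 \<partial>M) \<le> real n * c"
proof -
  have eq: "(\<Sum>i<m. Y i \<omega>)\<^sup>2 = (\<Sum>i<m. \<Sum>j<m. Y i \<omega> * Y j \<omega>)" for m \<omega>
    by (simp add: power2_eq_square sum_product)
  have sym: "(\<integral>\<omega>. Y i \<omega> * Y j \<omega> \<partial>M) = 0" if "i \<noteq> j" "i < n" "j < n" for i j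
    using that orth[of i j] orth[of j i] by (cases "i < j") (auto simp: mult.commute)
  have "integrable M (\<lambda>\<omega>. \<Sum>i<n. \<Sum>j<n. Y i \<omega> * Y j \<omega>)"
    by (intro Bochner_Integration.integrable_sum int) auto
  moreover have "(\<integral>\<omega>. (\<Sum>i<n. \<Sum>j<n. Y i \<omega> * Y j \<omega>) \<partial>M) = (\<Sum>i<n. \<Sum>j<n. \<integral>\<omega>. Y i \<omega> * Y j \<omega> \<partial>M)"
    using int by (subst Bochner_Integration.integral_sum)
      (auto intro!: Bochner_Integration.integrable_sum sum.cong Bochner_Integration.integral_sum)
  moreover have "\<dots> = (\<Sum>i<n. \<Sum>j<n. if j = i then \<integral>\<omega>. Y i \<omega> * Y i \<omega> \<partial>M else 0)"
    using sym by (intro sum.cong) auto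
  moreover have "\<dots> = (\<Sum>i<n. \<integral>\<omega>. Y i \<omega> * Y i \<omega> \<partial>M)" by simp
  moreover have "\<dots> \<le> real n * c" using sum_bounded_above[of "{..<n}" "\<lambda>i. \<integral>\<omega>. Y i \<omega> * Y i \<omega> \<partial>M" c] var by simp
  ultimately show ?thesis by (simp add: eq)
qed

lemma second_moment_tail:
  fixes S :: "'a \<Rightarrow> real"
  assumes "S \<in> borel_measurable M" "integrable M (\<lambda>\<omega>. (S \<omega>)\<^sup>2)" "(\<integral>\<omega>. (S \<omega>)\<^sup>2 \<partial>M) \<le> c" "\<eta> > 0"
  shows "measure M {\<omega> \<in> space M. \<bar>S \<omega>\<bar> \<ge> \<eta>} \<le> c / \<eta>\<^sup>2"
proof -
  have "{\<omega> \<in> space M. \<bar>S \<omega>\<bar> \<ge> \<eta>} = {\<omega> \<in> space M. (S \<omega>)\<^sup>2 \<ge> \<eta>\<^sup>2}"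
    using assms(4) by (auto simp: abs_le_square_iff[symmetric])
  also have "measure M \<dots> \<le> (\<integral>\<omega>. (S \<omega>)\<^sup>2 \<partial>M) / \<eta>\<^sup>2"
    by (rule integral_Markov_inequality_measure[where A="{}"]) (use assms in auto)
  also have "\<dots> \<le> c / \<eta>\<^sup>2" using assms by (intro divide_right_mono) auto
  finally show ?thesis .
qed

lemma quadratic_variation_second_moment:
  assumes bm: "standard_brownian_motion M B" and h: "h > 0"
  shows "integrable M (\<lambda>\<omega>. ((\<Sum>i<n. (increment B h i \<omega>)\<^sup>2) - real n * h)\<^sup>2) \<and>
    (\<integral>\<omega>. ((\<Sum>i<n. (increment B h i \<omega>)\<^sup>2) - real n * h)\<^sup>2 \<partial>M) \<le> real n * (2 * h\<^sup>2)"
proof -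
  interpret prob_space M by (rule standard_brownian_motionD(1)[OF bm])
  define Y where "Y i \<omega> = (increment B h i \<omega>)\<^sup>2 - h" for i \<omega>
  note pw = integrable_increment_power[OF bm h]
  have Yint: "integrable M (Y i)" for i
    unfolding Y_def using pw[of i 2] by simp
  have YE: "expectation (Y i) = 0" for i
    unfolding Y_def using pw[of i 2] expectation_increment(2)[OF bm h, of i] by (simp add: prob_space)
  have sq: "Y i \<omega> * Y i \<omega> = increment B h i \<omega> ^ 4 - 2 * h * increment B h i \<omega> ^ 2 + h\<^sup>2" for i \<omega>
    by (simp add: Y_def power4_eq_xxxx power2_eq_square algebra_simps)
  have Ysq: "integrable M (\<lambda>\<omega>. Y i \<omega> * Y i \<omega>)" for i
    unfolding sq using pw[of i 2] pw[of i 4] by simp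
  have Yv: "(\<integral>\<omega>. Y i \<omega> * Y i \<omega> \<partial>M) = 2 * h\<^sup>2" for i
    unfolding sq using pw[of i 2] pw[of i 4] expectation_increment(2,3)[OF bm h, of i]
    by (simp add: prob_space power2_eq_square)
  have ind: "indep_var borel (Y i) borel (Y j)" if "i < j" for i j
  proof -
    have "indep_var borel ((\<lambda>y. (y i)\<^sup>2 - h) \<circ> (\<lambda>\<omega>. \<lambda>k\<in>{i}. increment B h k \<omega>))
        borel ((\<lambda>y. (y j)\<^sup>2 - h) \<circ> (\<lambda>\<omega>. \<lambda>k\<in>{j}. increment B h k \<omega>))"
      using that
      by (intro indep_var_compose[OF indep_var_restrict[OF indep_increments[OF bm h, of "Suc j"]]]) auto
    then show ?thesis by (simp add: comp_def Y_def[abs_def])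
  qed
  have "integrable M (\<lambda>\<omega>. (\<Sum>i<n. Y i \<omega>)\<^sup>2) \<and> (\<integral>\<omega>. (\<Sum>i<n. Y i \<omega>)\<^sup>2 \<partial>M) \<le> real n * (2 * h\<^sup>2)"
  proof (rule orthogonal_sum_second_moment)
    fix i j :: nat
    show "integrable M (\<lambda>\<omega>. Y i \<omega> * Y j \<omega>)"
      using indep_var_integrable[OF ind Yint Yint, of i j] indep_var_integrable[OF ind Yint Yint, of j i]
        Ysq[of i] by (cases i j rule: linorder_cases) (auto simp: mult.commute)
    show "i < j \<Longrightarrow> (\<integral>\<omega>. Y i \<omega> * Y j \<omega> \<partial>M) = 0"
      using indep_var_lebesgue_integral[OF ind Yint Yint, of i j] YE by simp
  qed (simp add: Yv)
  then show ?thesis by (simp add: Y_def sum_subtractf)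
qed

section \<open>The Volterra equation for the drift\<close>

lemma integrable_on_of_continuous_on_nonneg:
  fixes g :: "real \<Rightarrow> real"
  assumes "continuous_on {0..} g" "0 \<le> s"
  shows "g integrable_on {s..t}"
  using assms by (intro integrable_continuous_real continuous_on_subset[OF assms(1)]) auto

lemma integral_split_nonneg:
  fixes g :: "real \<Rightarrow> real"
  assumes "continuous_on {0..} g" "0 \<le> s" "s \<le> t"
  shows "integral {0..t} g = integral {0..s} g + integral {s..t} g"
  using assms by (intro Henstock_Kurzweil_Integration.integral_combine[symmetric]
      integrable_on_of_continuous_on_nonneg) auto

lemma abs_integral_le:
  fixes g :: "real \<Rightarrow> real"
  assumes "continuous_on {0..} g" "0 \<le> s" "s \<le> t" "\<And>r. s \<le> r \<Longrightarrow> r \<le> t \<Longrightarrow> \<bar>g r\<bar> \<le> c"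
  shows "\<bar>integral {s..t} g\<bar> \<le> c * (t - s)"
proof -
  have "continuous_on {s..t} g" using assms(2) by (intro continuous_on_subset[OF assms(1)]) auto
  then show ?thesis using integral_bound[of s t g c] assms by auto
qed

lemma has_real_derivative_integral_nonneg:
  fixes g :: "real \<Rightarrow> real"
  assumes g: "continuous_on {0..} g" and t: "t \<ge> 0"
  shows "((\<lambda>t. integral {0..t} g) has_real_derivative g t) (at t within {0..})"
proof -
  have "continuous_on {0..t + 1} g" by (rule continuous_on_subset[OF g]) auto
  then have "((\<lambda>t. integral {0..t} g) has_vector_derivative g t) (at t within {0..t + 1})"
    using t by (intro integral_has_vector_derivative) auto
  moreover have "at t within {0..t + 1} = at t within {0..}"
    by (rule at_within_nhd[of _ "{..<t + 1}"]) auto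
  ultimately show ?thesis by (simp add: has_real_derivative_iff_has_vector_derivative)
qed

lemma continuous_on_integral_nonneg:
  fixes g :: "real \<Rightarrow> real"
  assumes "continuous_on {0..} g"
  shows "continuous_on {0..} (\<lambda>t. integral {0..t} g)"
  using has_real_derivative_integral_nonneg[OF assms]
  by (auto simp: continuous_on_eq_continuous_within intro: DERIV_continuous)

text \<open>
  The solution operator of \<open>x = g - \<integral> x\<close>, that is \<open>g(t) - \<integral> exp (s - t) g(s) ds\<close> over \<open>[0, t]\<close>.
\<close>

definition relax :: "(real \<Rightarrow> real) \<Rightarrow> real \<Rightarrow> real" where
  "relax g t = g t - exp (- t) * integral {0..t} (\<lambda>s. exp s * g s)"

lemma continuous_on_relax:
  assumes "continuous_on {0..} g"
  shows "continuous_on {0..} (relax g)"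
  unfolding relax_def[abs_def]
  by (intro continuous_intros assms continuous_on_integral_nonneg)

text \<open>
  With \<open>y = \<integral> x\<close> the equation reads \<open>y' + y = g\<close>, so \<open>exp t * y t\<close> has derivative \<open>exp t * g t\<close>.
\<close>

lemma relax_unique:
  assumes x: "continuous_on {0..} x" and g: "continuous_on {0..} g"
    and eq: "\<And>t. t \<ge> 0 \<Longrightarrow> x t = g t - integral {0..t} x" and t: "t \<ge> 0"
  shows "x t = relax g t"
proof -
  \<comment> \<open>The integrating factor.\<close>
  define k where "k t = exp t * integral {0..t} x" for t
  have "(k has_vector_derivative exp s * g s) (at s within {0..t})" if "s \<in> {0..t}" for s
  proof -
    have "(k has_real_derivative exp s * x s + exp s * integral {0..s} x) (at s within {0..})"
      unfolding k_def
      by (rule DERIV_cong, rule DERIV_mult, rule has_field_derivative_at_within, rule DERIV_exp,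
          rule has_real_derivative_integral_nonneg[OF x]) (use that in auto)
    moreover have "exp s * x s + exp s * integral {0..s} x = exp s * g s"
    proof -
      have "x s + integral {0..s} x = g s" using eq[of s] that by simp
      then show ?thesis by (metis distrib_left)
    qed
    ultimately have "(k has_real_derivative exp s * g s) (at s within {0..t})"
      by (auto intro: has_field_derivative_subset)
    then show ?thesis by (simp add: has_real_derivative_iff_has_vector_derivative)
  qed
  then have "((\<lambda>s. exp s * g s) has_integral (k t - k 0)) {0..t}"
    using t by (intro fundamental_theorem_of_calculus) auto
  then have "integral {0..t} (\<lambda>s. exp s * g s) = exp t * integral {0..t} x"
    by (simp add: k_def integral_unique)
  then show ?thesis
    using eq[OF t] by (simp add: relax_def exp_minus field_simps)
qed

lemma relax_diff:
  assumes "continuous_on {0..} f" "continuous_on {0..} g" "t \<ge> 0"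
  shows "relax (\<lambda>s. f s - g s) t = relax f t - relax g t"
proof -
  have "integral {0..t} (\<lambda>s. exp s * f s - exp s * g s) =
      integral {0..t} (\<lambda>s. exp s * f s) - integral {0..t} (\<lambda>s. exp s * g s)"
    by (intro Henstock_Kurzweil_Integration.integral_diff integrable_on_of_continuous_on_nonneg
        continuous_intros assms) auto
  then show ?thesis by (simp add: relax_def right_diff_distrib)
qed

text \<open>
  The weights \<open>exp (s - t)\<close> have total mass \<open>1 - exp (- t) < 1\<close> on \<open>[0, t]\<close>.
\<close>

lemma exp_weighted_average_bound:
  fixes z :: "real \<Rightarrow> real"
  assumes z: "continuous_on {0..} z" and b: "\<And>s. 0 \<le> s \<Longrightarrow> s \<le> t \<Longrightarrow> \<bar>z s\<bar> \<le> c" and t: "t \<ge> 0"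
  shows "\<bar>exp (- t) * integral {0..t} (\<lambda>s. exp s * z s)\<bar> \<le> c"
proof -
  have c: "c \<ge> 0" using abs_ge_zero[of "z 0"] b[of 0] t by linarith
  have exp: "integral {0..t} (\<lambda>s. exp s * c) = (exp t - 1) * c"
  proof -
    have "((\<lambda>s. exp s * c) has_integral (exp t * c - exp 0 * c)) {0..t}"
      using t by (intro fundamental_theorem_of_calculus)
        (auto intro!: derivative_eq_intros simp flip: has_real_derivative_iff_has_vector_derivative)
    from integral_unique[OF this] show ?thesis by (simp add: left_diff_distrib)
  qed
  have "\<bar>integral {0..t} (\<lambda>s. exp s * z s)\<bar> \<le> integral {0..t} (\<lambda>s. exp s * c)"
    unfolding real_norm_def[symmetric] using b
    by (intro integral_norm_bound_integral integrable_on_of_continuous_on_nonneg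
        continuous_intros z) (auto simp: abs_mult)
  then have "\<bar>exp (- t) * integral {0..t} (\<lambda>s. exp s * z s)\<bar> \<le> exp (- t) * ((exp t - 1) * c)"
    unfolding exp by (simp add: abs_mult)
  also have "\<dots> = (1 - exp (- t)) * c"
    by (simp add: exp_minus field_simps)
  also have "\<dots> \<le> 1 * c" using c by (intro mult_right_mono) auto
  finally show ?thesis by simp
qed

lemma relax_bound:
  assumes "continuous_on {0..} z" "\<And>s. 0 \<le> s \<Longrightarrow> s \<le> t \<Longrightarrow> \<bar>z s\<bar> \<le> c" "t \<ge> 0"
  shows "\<bar>relax z t\<bar> \<le> 2 * c"
  using exp_weighted_average_bound[OF assms] assms(2)[of t] assms(3) unfolding relax_def by linarith

text \<open>
  Both \<open>z t\<close> and the weighted average subtracted from it lie in \<open>[0, c]\<close>, which saves the factor \<open>2\<close> of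
  \<open>relax_bound\<close>.
\<close>

lemma relax_nonneg_bound:
  assumes z: "continuous_on {0..} z" and b: "\<And>s. s \<ge> 0 \<Longrightarrow> 0 \<le> z s \<and> z s \<le> c" and t: "t \<ge> 0"
  shows "\<bar>relax z t\<bar> \<le> c"
proof -
  have "\<bar>exp (- t) * integral {0..t} (\<lambda>s. exp s * z s)\<bar> \<le> c"
    using b t by (intro exp_weighted_average_bound z) (simp_all add: abs_of_nonneg)
  moreover have "0 \<le> integral {0..t} (\<lambda>s. exp s * z s)"
    using b by (intro Henstock_Kurzweil_Integration.integral_nonneg
        integrable_on_of_continuous_on_nonneg continuous_intros z) auto
  ultimately have "0 \<le> exp (- t) * integral {0..t} (\<lambda>s. exp s * z s)"
    "exp (- t) * integral {0..t} (\<lambda>s. exp s * z s) \<le> c" by auto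
  then show ?thesis using b[OF t] unfolding relax_def by linarith
qed

text \<open>
  The Ornstein--Uhlenbeck path started at \<open>v\<close>, as a function of its noise \<open>x\<close> with \<open>x(0) = 0\<close>.
\<close>

definition relax_path :: "real \<Rightarrow> cpath \<Rightarrow> cpath" where
  "relax_path v x = mk_path (relax (\<lambda>t. v + path_at x t))"

lemma path_at_relax_path: "t \<ge> 0 \<Longrightarrow> path_at (relax_path v x) t = relax (\<lambda>t. v + path_at x t) t"
  unfolding relax_path_def
  by (intro path_at_mk_path continuous_on_relax continuous_intros path_at_continuous)

lemma continuous_on_relax_path: "continuous_on UNIV (relax_path v)"
proof -
  have lip: "dist (relax_path v x) (relax_path v y) \<le> 2 * e" if e: "dist x y < e" for x y e
  proof (rule dist_cpath_leI)
    have e0: "e > 0" using e zero_le_dist[of x y] by linarith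
    then show "2 * e > 0" by simp
    fix t assume t: "0 \<le> t" "t \<le> 1 / (2 * e)"
    have "1 / (2 * e) \<le> 1 / e" using e0 by (simp add: field_simps)
    then have te: "t \<le> 1 / e" using t by linarith
    have "path_at (relax_path v x) t - path_at (relax_path v y) t =
        relax (\<lambda>s. (v + path_at x s) - (v + path_at y s)) t"
      using t by (subst relax_diff) (auto simp: path_at_relax_path intro!: continuous_intros path_at_continuous)
    also have "\<bar>\<dots>\<bar> \<le> 2 * e"
      using t te dist_cpath_lessD[OF e]
      by (intro relax_bound) (auto intro!: continuous_intros path_at_continuous)
    finally show "\<bar>path_at (relax_path v x) t - path_at (relax_path v y) t\<bar> \<le> 2 * e" .
  qed
  show ?thesis
  proof (intro continuous_at_imp_continuous_on ballI)
    fix x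
    show "isCont (relax_path v) x"
      unfolding continuous_at_eps_delta
    proof (intro allI impI)
      fix e :: real assume e: "e > 0"
      have "dist (relax_path v y) (relax_path v x) < e" if "dist y x < e / 4" for y
        using lip[OF that] e by simp
      then show "\<exists>d>0. \<forall>y. dist y x < d \<longrightarrow> dist (relax_path v y) (relax_path v x) < e"
        using e by (intro exI[of _ "e / 4"]) auto
    qed
  qed
qed

lemma measurable_relax_path: "relax_path v \<in> borel_measurable borel"
  by (rule borel_measurable_continuous_onI[OF continuous_on_relax_path])

section \<open>Deterministic analysis of a reflected path\<close>

lemma oscillation_le:
  fixes f :: "real \<Rightarrow> real"
  assumes f: "continuous_on {0..} f" and "\<delta> > 0"
  shows "\<exists>d>0. \<forall>r s. 0 \<le> r \<longrightarrow> r \<le> T \<longrightarrow> 0 \<le> s \<longrightarrow> s \<le> T \<longrightarrow> \<bar>r - s\<bar> \<le> d \<longrightarrow> \<bar>f r - f s\<bar> \<le> \<delta>"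
proof -
  have "uniformly_continuous_on {0..T} f"
    by (intro compact_uniformly_continuous continuous_on_subset[OF f]) auto
  then obtain d where d: "d > 0"
    "\<And>r s. r \<in> {0..T} \<Longrightarrow> s \<in> {0..T} \<Longrightarrow> dist s r < d \<Longrightarrow> dist (f s) (f r) < \<delta>"
    using \<open>\<delta> > 0\<close> unfolding uniformly_continuous_on_def by metis
  have "\<bar>f r - f s\<bar> \<le> \<delta>" if "0 \<le> r" "r \<le> T" "0 \<le> s" "s \<le> T" "\<bar>r - s\<bar> \<le> d / 2" for r s
    using d(2)[of s r] that d(1) by (simp add: dist_real_def)
  then show ?thesis using d(1) by (intro exI[of _ "d / 2"]) auto
qed

text \<open>
  A projected Euler scheme for position and drift, with step \<open>h\<close> and noise increments \<open>x\<close>.  The amount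
  by which the projection onto \<open>[0, l]\<close> corrects the position is added to the drift, as the boundary local
  times are in the continuous dynamics.  Its state after \<open>k\<close> steps is an explicit function of the
  first \<open>k\<close> increments, and this makes its limit non-anticipating.
\<close>

fun clamp_scheme :: "real \<Rightarrow> real \<Rightarrow> real \<Rightarrow> (nat \<Rightarrow> real) \<Rightarrow> nat \<Rightarrow> real \<times> real" where
  "clamp_scheme l v h x 0 = (0, v)"
| "clamp_scheme l v h x (Suc k) =
    (let (z, u) = clamp_scheme l v h x k; w = z + x k + h * u; z' = max 0 (min l w)
     in (z', u + (z' - w)))"

abbreviation "scheme_z l v h x k \<equiv> fst (clamp_scheme l v h x k)"
abbreviation "scheme_v l v h x k \<equiv> snd (clamp_scheme l v h x k)"

lemma scheme_z_range: "l \<ge> 0 \<Longrightarrow> 0 \<le> scheme_z l v h x k \<and> scheme_z l v h x k \<le> l"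
  by (cases k) (auto simp: Let_def split_beta)

lemma scheme_v_increase:
  "l \<ge> 0 \<Longrightarrow> scheme_v l v h x (Suc k) > scheme_v l v h x k \<Longrightarrow> scheme_z l v h x (Suc k) = 0"
  by (auto simp: Let_def split_beta)

lemma scheme_v_decrease:
  "l \<ge> 0 \<Longrightarrow> scheme_v l v h x (Suc k) < scheme_v l v h x k \<Longrightarrow> scheme_z l v h x (Suc k) = l"
  by (auto simp: Let_def split_beta min_def max_def split: if_splits)

lemma scheme_z_eq:
  "scheme_z l v h x k = (\<Sum>i<k. x i) + (scheme_v l v h x k - v) + h * (\<Sum>i<k. scheme_v l v h x i)"
  by (induction k) (auto simp: Let_def split_beta algebra_simps)

text \<open>
  The maximum admits steps in which nothing is known except that the error does not grow; such steps
  occur in \<open>scheme_error\<close>.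
\<close>

lemma discrete_gronwall:
  fixes a :: "nat \<Rightarrow> real"
  assumes h: "h \<ge> 0" and c: "c \<ge> 0" and a0: "a 0 \<le> c"
    and step: "\<And>k. k < N \<Longrightarrow> a (Suc k) \<le> max (a k) (c + h * (\<Sum>i\<le>k. a i))"
    and "k \<le> N"
  shows "a k \<le> c * (1 + h) ^ k"
proof -
  have geo: "h * (\<Sum>i\<le>k. c * (1 + h) ^ i) = c * (1 + h) ^ Suc k - c" for k
    by (induction k) (auto simp: algebra_simps)
  have "k \<le> N \<Longrightarrow> \<forall>i\<le>k. a i \<le> c * (1 + h) ^ i" for k
  proof (induction k)
    case 0
    then show ?case using a0 by simp
  next
    case (Suc k)
    then have IH: "a i \<le> c * (1 + h) ^ i" if "i \<le> k" for i using that by simp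
    have "c + h * (\<Sum>i\<le>k. a i) \<le> c + h * (\<Sum>i\<le>k. c * (1 + h) ^ i)"
      using h IH by (intro add_left_mono mult_left_mono sum_mono) auto
    then have "c + h * (\<Sum>i\<le>k. a i) \<le> c * (1 + h) ^ Suc k" unfolding geo by simp
    moreover have "a k \<le> c * (1 + h) ^ Suc k"
    proof (rule order_trans[OF IH[OF order_refl]])
      show "c * (1 + h) ^ k \<le> c * (1 + h) ^ Suc k"
        using h c by (intro mult_left_mono power_increasing) auto
    qed
    ultimately have "a (Suc k) \<le> c * (1 + h) ^ Suc k"
      using step[of k] Suc.prems by simp
    then show ?case using IH by (auto simp: le_Suc_eq)
  qed
  then show ?thesis using \<open>k \<le> N\<close> by blast
qed

locale inert_path =
  fixes l v :: real and b z V L0 Ll :: "real \<Rightarrow> real"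
  assumes l: "l > 0" and b: "continuous_on {0..} b" and b0: "b 0 = 0"
    and path: "inert_drift_path l v b z V L0 Ll"
begin

abbreviation L :: "real \<Rightarrow> real" where "L t \<equiv> L0 t + Ll t"

lemma z_range: "t \<ge> 0 \<Longrightarrow> 0 \<le> z t \<and> z t \<le> l"
  using path unfolding inert_drift_path_def by (metis atLeastAtMost_iff)

lemma z_eq: "t \<ge> 0 \<Longrightarrow> z t = b t + L0 t - Ll t + integral {0..t} V"
  and V_eq: "t \<ge> 0 \<Longrightarrow> V t = v + L0 t - Ll t"
  using path unfolding inert_drift_path_def by blast+

lemma local_time:
  shows L0_cont: "continuous_on {0..} L0" and Ll_cont: "continuous_on {0..} Ll"
    and L0_mono: "0 \<le> s \<Longrightarrow> s \<le> t \<Longrightarrow> L0 s \<le> L0 t"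
    and Ll_mono: "0 \<le> s \<Longrightarrow> s \<le> t \<Longrightarrow> Ll s \<le> Ll t"
    and L0_0: "L0 0 = 0" and Ll_0: "Ll 0 = 0"
    and L0_flat: "0 \<le> s \<Longrightarrow> s \<le> t \<Longrightarrow> L0 s \<noteq> L0 t \<Longrightarrow> \<exists>r. s \<le> r \<and> r \<le> t \<and> z r = 0"
    and Ll_flat: "0 \<le> s \<Longrightarrow> s \<le> t \<Longrightarrow> Ll s \<noteq> Ll t \<Longrightarrow> \<exists>r. s \<le> r \<and> r \<le> t \<and> z r = l"
proof -
  have b0: "boundary_local_time L0 {t. z t = 0}" and bl: "boundary_local_time Ll {t. z t = l}"
    using path unfolding inert_drift_path_def by blast+
  show "continuous_on {0..} L0" "L0 0 = 0" "continuous_on {0..} Ll" "Ll 0 = 0"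
    using b0 bl by (auto simp: boundary_local_time_def)
  show "0 \<le> s \<Longrightarrow> s \<le> t \<Longrightarrow> L0 s \<le> L0 t" "0 \<le> s \<Longrightarrow> s \<le> t \<Longrightarrow> Ll s \<le> Ll t"
    using b0 bl mono_onD[of "{0..}" L0 s t] mono_onD[of "{0..}" Ll s t]
    by (auto simp: boundary_local_time_def)
  show "\<exists>r. s \<le> r \<and> r \<le> t \<and> z r = 0" if "0 \<le> s" "s \<le> t" "L0 s \<noteq> L0 t"
  proof -
    have "{s..t} \<inter> {t. z t = 0} \<noteq> {}"
      using b0 that unfolding boundary_local_time_def flat_off_def by blast
    then show ?thesis by auto
  qed
  show "\<exists>r. s \<le> r \<and> r \<le> t \<and> z r = l" if "0 \<le> s" "s \<le> t" "Ll s \<noteq> Ll t"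
  proof -
    have "{s..t} \<inter> {t. z t = l} \<noteq> {}"
      using bl that unfolding boundary_local_time_def flat_off_def by blast
    then show ?thesis by auto
  qed
qed

lemma L_mono: "0 \<le> s \<Longrightarrow> s \<le> t \<Longrightarrow> L s \<le> L t"
  using L0_mono[of s t] Ll_mono[of s t] by simp

lemma L_cont: "continuous_on {0..} L"
  by (intro continuous_intros L0_cont Ll_cont)

lemma L_nonneg: "t \<ge> 0 \<Longrightarrow> 0 \<le> L t"
  using L_mono[of 0 t] L0_0 Ll_0 by simp

lemma V_cont: "continuous_on {0..} V"
proof -
  have "continuous_on {0..} (\<lambda>t. v + L0 t - Ll t)"
    by (intro continuous_intros L0_cont Ll_cont)
  then show ?thesis by (rule continuous_on_eq) (simp add: V_eq)
qed

lemma z_cont: "continuous_on {0..} z"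
proof -
  have "continuous_on {0..} (\<lambda>t. b t + L0 t - Ll t + integral {0..t} V)"
    by (intro continuous_intros L0_cont Ll_cont b continuous_on_integral_nonneg V_cont)
  then show ?thesis by (rule continuous_on_eq) (simp only: z_eq atLeast_iff)
qed

lemma z_0: "z 0 = 0"
  using z_eq[OF order_refl] by (simp add: b0 L0_0 Ll_0)

text \<open>
  The heart of the matter: up to the confined perturbation \<open>z\<close>, the drift solves the
  Ornstein--Uhlenbeck equation in the original time.
\<close>

lemma V_close_to_relax:
  assumes t: "t \<ge> 0"
  shows "\<bar>V t - relax (\<lambda>s. v + - b s) t\<bar> \<le> l"
proof -
  have c: "continuous_on {0..} (\<lambda>s. v - b s + z s)"
    by (intro continuous_intros b z_cont)
  have "V t = relax (\<lambda>s. v - b s + z s) t"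
    by (rule relax_unique[OF V_cont c _ t]) (simp add: V_eq z_eq)
  moreover have "relax (\<lambda>s. (v - b s + z s) - z s) t = relax (\<lambda>s. v - b s + z s) t - relax z t"
    by (rule relax_diff[OF c z_cont t])
  ultimately have "V t - relax (\<lambda>s. v + - b s) t = relax z t" by simp
  then show ?thesis
    using relax_nonneg_bound[OF z_cont z_range t] by simp
qed

lemma V_le_L: "0 \<le> s \<Longrightarrow> s \<le> t \<Longrightarrow> \<bar>V t - V s\<bar> \<le> L t - L s"
  using L0_mono[of s t] Ll_mono[of s t] V_eq[of s] V_eq[of t] by simp

text \<open>
  If \<open>L\<close> stayed below \<open>C\<close>, then \<open>V\<close> would be bounded, and the position equation would bound all unit
  increments of \<open>b\<close>.
\<close>

lemma L_unbounded:
  assumes inc: "\<And>R. \<exists>n. \<bar>b (real (Suc n)) - b (real n)\<bar> > R"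
  shows "\<exists>t\<ge>0. L t > C"
proof (rule ccontr)
  assume "\<not> ?thesis"
  then have LC: "L t \<le> C" if "t \<ge> 0" for t using that by (auto simp: not_less)
  have VC: "\<bar>V t\<bar> \<le> \<bar>v\<bar> + C" if "t \<ge> 0" for t
    using V_le_L[of 0 t] LC[OF that] V_eq[of 0] L0_0 Ll_0 that by simp
  obtain n where n: "\<bar>b (real (Suc n)) - b (real n)\<bar> > l + C + (\<bar>v\<bar> + C)"
    using inc by blast
  define s where "s = real n"
  have s: "s \<ge> 0" "real (Suc n) = s + 1" by (simp_all add: s_def)
  have I: "\<bar>integral {s..s + 1} V\<bar> \<le> (\<bar>v\<bar> + C) * (s + 1 - s)"
    using s VC by (intro abs_integral_le[OF V_cont]) auto
  have "b (s + 1) - b s = z (s + 1) - z s - (V (s + 1) - V s) - integral {s..s + 1} V"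
    using s z_eq[of s] z_eq[of "s + 1"] V_eq[of s] V_eq[of "s + 1"]
      integral_split_nonneg[OF V_cont s(1), of "s + 1"] by simp
  moreover have "\<bar>V (s + 1) - V s\<bar> \<le> C"
    using V_le_L[of s "s + 1"] LC[of "s + 1"] L_nonneg[of s] s by simp
  ultimately have "\<bar>b (s + 1) - b s\<bar> \<le> l + C + (\<bar>v\<bar> + C)"
    using z_range[OF s(1)] z_range[of "s + 1"] s(1) I by auto
  then show False using n by (simp add: s_def add.commute)
qed

lemma L_right_inverse:
  assumes unb: "\<exists>t\<ge>0. L t > \<tau>" and \<tau>: "\<tau> \<ge> 0"
  shows "right_inverse L \<tau> \<ge> 0 \<and> L (right_inverse L \<tau>) = \<tau>"
proof -
  define S where "S = {t. 0 \<le> t \<and> L t > \<tau>}"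
  define T where "T = Inf S"
  have S: "S \<noteq> {}" "bdd_below S" using unb by (auto simp: S_def intro!: bdd_belowI[of _ 0])
  have T_le: "T \<le> t" if "t \<in> S" for t unfolding T_def using that S by (intro cInf_lower)
  obtain u where u: "u \<ge> 0" "L u > \<tau>" using unb by blast
  have "\<exists>t\<ge>0. t \<le> u \<and> L t = \<tau>"
    using u \<tau> L0_0 Ll_0
    by (intro IVT'[of L]) (auto intro: continuous_on_subset[OF L_cont])
  then obtain t0 where t0: "t0 \<ge> 0" "L t0 = \<tau>" by blast
  have t0_le: "t0 \<le> T"
    unfolding T_def
  proof (rule cInf_greatest[OF S(1)])
    fix s assume "s \<in> S"
    then show "t0 \<le> s" using L_mono[of s t0] t0 by (fastforce simp: S_def)
  qed
  then have T: "T \<ge> 0" "\<tau> \<le> L T" using t0 L_mono[of t0 T] by auto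
  have "L T = \<tau>"
  proof (rule ccontr)
    assume "L T \<noteq> \<tau>"
    then have less: "\<tau> < L T" using T by simp
    have "\<exists>r\<ge>t0. r \<le> T \<and> L r = (\<tau> + L T) / 2"
      using less t0 t0_le by (intro IVT'[of L]) (auto intro: continuous_on_subset[OF L_cont])
    then obtain r where r: "t0 \<le> r" "r \<le> T" "L r = (\<tau> + L T) / 2" by blast
    then have "r \<in> S" using less t0 by (simp add: S_def)
    then have "r = T" using T_le r by force
    then show False using r less by simp
  qed
  moreover have "right_inverse L \<tau> = T" by (simp add: right_inverse_def T_def S_def)
  ultimately show ?thesis using T by simp
qed

text \<open>
  Although the inverse of \<open>L\<close> jumps, \<open>V\<close> does not move while \<open>L\<close> is at rest; \<open>L\<close> itself inverts its right
  inverse, and \<open>V\<close> varies by no more than \<open>L\<close>.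
\<close>

lemma time_changed_drift_lipschitz:
  assumes unb: "\<And>C. \<exists>t\<ge>0. L t > C" and "\<sigma> \<ge> 0" "\<tau> \<ge> 0"
  shows "\<bar>V (right_inverse L \<sigma>) - V (right_inverse L \<tau>)\<bar> \<le> \<bar>\<sigma> - \<tau>\<bar>"
proof -
  define p q where "p = right_inverse L \<sigma>" and "q = right_inverse L \<tau>"
  have "p \<ge> 0" "L p = \<sigma>" "q \<ge> 0" "L q = \<tau>"
    using L_right_inverse[OF unb] assms by (auto simp: p_def q_def)
  then show ?thesis
    using V_le_L[of p q] V_le_L[of q p] unfolding p_def[symmetric] q_def[symmetric]
    by (cases "p \<le> q") auto
qed

lemma time_changed_drift_cont:
  assumes unb: "\<And>C. \<exists>t\<ge>0. L t > C"
  shows "continuous_on {0..} (\<lambda>t. V (right_inverse L (t / l)))"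
  unfolding continuous_on_iff
proof (intro ballI allI impI)
  fix x e :: real assume "x \<in> {0..}" "e > 0"
  then show "\<exists>d>0. \<forall>x'\<in>{0..}. dist x' x < d \<longrightarrow>
      dist (V (right_inverse L (x' / l))) (V (right_inverse L (x / l))) < e"
  proof (intro exI[of _ "e * l"] conjI ballI impI)
    fix y assume y: "y \<in> {0..}" "dist y x < e * l"
    have "\<bar>V (right_inverse L (y / l)) - V (right_inverse L (x / l))\<bar> \<le> \<bar>y / l - x / l\<bar>"
      using y \<open>x \<in> {0..}\<close> l by (intro time_changed_drift_lipschitz unb) auto
    also have "\<dots> = \<bar>y - x\<bar> / l" using l by (simp add: diff_divide_distrib[symmetric])
    also have "\<dots> < e" using y l by (simp add: dist_real_def field_simps)
    finally show "dist (V (right_inverse L (y / l))) (V (right_inverse L (x / l))) < e"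
      by (simp add: dist_real_def)
  qed (use l in auto)
qed

lemma right_inverse_less_iff:
  assumes unb: "\<exists>t\<ge>0. L t > \<tau>"
  shows "right_inverse L \<tau> < s \<longleftrightarrow> (\<exists>q\<in>\<rat>. 0 \<le> q \<and> q < s \<and> L q > \<tau>)"
proof
  assume "right_inverse L \<tau> < s"
  then obtain t where t: "0 \<le> t" "L t > \<tau>" "t < s"
    using unb unfolding right_inverse_def
    by (subst (asm) cInf_less_iff) (auto intro!: bdd_belowI[of _ 0])
  then obtain q where "q \<in> \<rat>" "t < q" "q < s" using Rats_dense_in_real by blast
  moreover have "L q > \<tau>" using L_mono[of t q] t calculation by simp
  moreover have "0 \<le> q" using t(1) calculation(2) by linarith
  ultimately show "\<exists>q\<in>\<rat>. 0 \<le> q \<and> q < s \<and> L q > \<tau>" by blast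
next
  assume "\<exists>q\<in>\<rat>. 0 \<le> q \<and> q < s \<and> L q > \<tau>"
  then obtain q where q: "0 \<le> q" "q < s" "L q > \<tau>" by blast
  then have "right_inverse L \<tau> \<le> q"
    unfolding right_inverse_def by (intro cInf_lower) (auto intro!: bdd_belowI[of _ 0])
  then show "right_inverse L \<tau> < s" using q by simp
qed

text \<open>
  Between two grid points \<open>l L\<close> is trapped by its values there, so its inverse is off by at most two
  grid steps.
\<close>

lemma right_inverse_close:
  assumes unb: "\<And>C. \<exists>t\<ge>0. L t > C" and \<eta>: "\<eta> > 0"
    and grid: "\<And>k. k \<le> K \<Longrightarrow> \<bar>l * L (real k * \<eta>) - real k * \<eta>\<bar> < \<eta>"
    and t: "0 \<le> t" "t + 2 * \<eta> \<le> real K * \<eta>"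
  shows "\<bar>right_inverse L (t / l) - t\<bar> \<le> 2 * \<eta>"
proof -
  define s where "s = right_inverse L (t / l)"
  have s: "s \<ge> 0" "l * L s = t"
    using L_right_inverse[OF unb, of "t / l"] t l by (auto simp: s_def)
  have "s \<le> t + 2 * \<eta>"
  proof (rule ccontr)
    assume *: "\<not> s \<le> t + 2 * \<eta>"
    \<comment> \<open>A grid point in \<open>(t + \<eta>, t + 2 \<eta>]\<close>, where \<open>l L\<close> already exceeds \<open>t\<close>.\<close>
    define k where "k = nat \<lfloor>t / \<eta>\<rfloor> + 2"
    have "0 \<le> t / \<eta>" using t \<eta> by simp
    then have "real k \<le> t / \<eta> + 2" "real k > t / \<eta> + 1"
      unfolding k_def by linarith+
    then have k: "real k * \<eta> \<le> t + 2 * \<eta>" "real k * \<eta> > t + \<eta>"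
      using \<eta> by (simp_all add: field_simps)
    then have "real k * \<eta> \<le> real K * \<eta>" using t by linarith
    then have "k \<le> K" using \<eta> by simp
    from grid[OF this] have "l * L (real k * \<eta>) > t" using k by linarith
    moreover have "l * L (real k * \<eta>) \<le> l * L s"
      using k * l \<eta> by (intro mult_left_mono L_mono) auto
    ultimately show False using s by simp
  qed
  moreover have "t - 2 * \<eta> \<le> s"
  proof (rule ccontr)
    assume *: "\<not> t - 2 * \<eta> \<le> s"
    \<comment> \<open>A grid point in \<open>[t - 2 \<eta>, t - \<eta>)\<close>, where \<open>l L\<close> is still below \<open>t\<close>.\<close>
    define k where "k = nat (\<lceil>t / \<eta>\<rceil> - 2)"
    have "t / \<eta> > 2" using * s \<eta> by (simp add: field_simps)
    then have "real k \<ge> t / \<eta> - 2" "real k < t / \<eta> - 1"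
      unfolding k_def by linarith+
    then have k: "real k * \<eta> \<ge> t - 2 * \<eta>" "real k * \<eta> < t - \<eta>"
      using \<eta> by (simp_all add: field_simps)
    then have "real k * \<eta> \<le> real K * \<eta>" using t \<eta> by linarith
    then have "k \<le> K" using \<eta> by simp
    from grid[OF this] have "l * L (real k * \<eta>) < t" using k by linarith
    moreover have "l * L s \<le> l * L (real k * \<eta>)"
      using k * l s by (intro mult_left_mono L_mono) auto
    ultimately show False using s by simp
  qed
  ultimately show ?thesis by (simp add: s_def abs_le_iff)
qed

text \<open>
  One step of the discrete Ito formula for \<open>z (l - z)\<close>.  Local time at \<open>0\<close> grows only in steps during which
  \<open>z\<close> visits \<open>0\<close>, where the weight \<open>l - 2 z\<close> is within \<open>2 \<delta>\<close> of \<open>l\<close>; likewise at \<open>l\<close> the weight is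
  within \<open>2 \<delta>\<close> of \<open>- l\<close>, and both local times enter with factor \<open>l\<close>.
\<close>

lemma occupation_step:
  assumes s: "0 \<le> s" "s \<le> s'" and c: "\<And>r. s \<le> r \<Longrightarrow> r \<le> s' \<Longrightarrow> \<bar>V r\<bar> \<le> c"
    and osc: "\<And>r. s \<le> r \<Longrightarrow> r \<le> s' \<Longrightarrow> \<bar>z r - z s\<bar> \<le> \<delta>" "\<bar>b s' - b s\<bar> \<le> \<delta>"
  shows "\<bar>l * (L s' - L s) - (b s' - b s)\<^sup>2 + (l - 2 * z s) * (b s' - b s)
      - (z s' * (l - z s') - z s * (l - z s))\<bar>
    \<le> 4 * \<delta> * (L s' - L s) + (l * c + 2 * \<delta> * c) * (s' - s)"
proof -
  define d0 dl db dz I where "d0 = L0 s' - L0 s" and "dl = Ll s' - Ll s"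
    and "db = b s' - b s" and "dz = z s' - z s" and "I = integral {s..s'} V"
  have \<delta>: "\<delta> \<ge> 0" using osc(2) by linarith
  have d: "d0 \<ge> 0" "dl \<ge> 0" using L0_mono[OF s] Ll_mono[OF s] by (auto simp: d0_def dl_def)
  have I: "\<bar>I\<bar> \<le> c * (s' - s)"
    unfolding I_def by (rule abs_integral_le[OF V_cont s c])
  have dz: "dz = db + d0 - dl + I"
    using z_eq[of s] z_eq[of s'] s integral_split_nonneg[OF V_cont s]
    by (simp add: dz_def db_def d0_def dl_def I_def)
  have zs: "0 \<le> z s" "z s \<le> l" using z_range[of s] s by auto
  have t0: "\<bar>z s * d0\<bar> \<le> \<delta> * d0"
  proof (cases "d0 = 0")
    case False
    then obtain r where "s \<le> r" "r \<le> s'" "z r = 0" using L0_flat[OF s] by (auto simp: d0_def)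
    then have "z s \<le> \<delta>" using osc(1)[of r] by simp
    then show ?thesis using d zs by (simp add: abs_mult mult_right_mono)
  qed simp
  have tl: "\<bar>(l - z s) * dl\<bar> \<le> \<delta> * dl"
  proof (cases "dl = 0")
    case False
    then obtain r where "s \<le> r" "r \<le> s'" "z r = l" using Ll_flat[OF s] by (auto simp: dl_def)
    then have "l - z s \<le> \<delta>" using osc(1)[of r] by simp
    then show ?thesis using d zs by (simp add: abs_mult mult_right_mono)
  qed simp
  have tI: "\<bar>(l - 2 * z s) * I\<bar> \<le> l * (c * (s' - s))"
    unfolding abs_mult using zs I by (intro mult_mono) auto
  have tq: "\<bar>(dz - db) * (dz + db)\<bar> \<le> (d0 + dl + c * (s' - s)) * (2 * \<delta>)"
    unfolding abs_mult
  proof (intro mult_mono)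
    show "\<bar>dz - db\<bar> \<le> d0 + dl + c * (s' - s)" using dz d I by linarith
    show "\<bar>dz + db\<bar> \<le> 2 * \<delta>" using osc(1)[of s'] osc(2) s by (simp add: dz_def db_def)
  qed (use d I in auto)
  have "l * (L s' - L s) - (b s' - b s)\<^sup>2 + (l - 2 * z s) * (b s' - b s)
      - (z s' * (l - z s') - z s * (l - z s)) =
    l * (d0 + dl) - db\<^sup>2 + (l - 2 * z s) * db - ((l - 2 * z s) * dz - dz\<^sup>2)"
    by (simp add: d0_def dl_def db_def dz_def power2_eq_square algebra_simps)
  also have "\<dots> = 2 * (z s * d0) + 2 * ((l - z s) * dl) - (l - 2 * z s) * I + (dz - db) * (dz + db)"
    unfolding dz by (simp add: power2_eq_square algebra_simps)
  also have "\<bar>\<dots>\<bar> \<le> 2 * (\<delta> * d0) + 2 * (\<delta> * dl) + l * (c * (s' - s)) +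
      (d0 + dl + c * (s' - s)) * (2 * \<delta>)"
    using t0 tl tI tq by linarith
  also have "\<dots> = 4 * \<delta> * (L s' - L s) + (l * c + 2 * \<delta> * c) * (s' - s)"
    by (simp add: d0_def dl_def algebra_simps)
  finally show ?thesis .
qed

lemma occupation_sum:
  assumes h: "h > 0" and T: "T = real n * h" and c: "\<And>r. 0 \<le> r \<Longrightarrow> r \<le> T \<Longrightarrow> \<bar>V r\<bar> \<le> c"
    and oscz: "\<And>r s. 0 \<le> r \<Longrightarrow> r \<le> T \<Longrightarrow> 0 \<le> s \<Longrightarrow> s \<le> T \<Longrightarrow> \<bar>r - s\<bar> \<le> h \<Longrightarrow> \<bar>z r - z s\<bar> \<le> \<delta>"
    and oscb: "\<And>r s. 0 \<le> r \<Longrightarrow> r \<le> T \<Longrightarrow> 0 \<le> s \<Longrightarrow> s \<le> T \<Longrightarrow> \<bar>r - s\<bar> \<le> h \<Longrightarrow> \<bar>b r - b s\<bar> \<le> \<delta>"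
  shows "\<bar>l * L T - (\<Sum>i<n. (b (real (Suc i) * h) - b (real i * h))\<^sup>2)
      + (\<Sum>i<n. (l - 2 * z (real i * h)) * (b (real (Suc i) * h) - b (real i * h)))\<bar>
    \<le> l\<^sup>2 + 4 * \<delta> * L T + (l * c + 2 * \<delta> * c) * T"
proof -
  define D where "D i = l * (L (real (Suc i) * h) - L (real i * h))
      - (b (real (Suc i) * h) - b (real i * h))\<^sup>2
      + (l - 2 * z (real i * h)) * (b (real (Suc i) * h) - b (real i * h))
      - (z (real (Suc i) * h) * (l - z (real (Suc i) * h)) - z (real i * h) * (l - z (real i * h)))" for i
  define E where "E i = 4 * \<delta> * (L (real (Suc i) * h) - L (real i * h))
      + (l * c + 2 * \<delta> * c) * (real (Suc i) * h - real i * h)" for i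
  have L0: "L 0 = 0" using L0_0 Ll_0 by simp
  have "\<bar>D i\<bar> \<le> E i" if "i < n" for i
  proof -
    have m: "real (Suc i) * h \<le> T" unfolding T using that h by (intro mult_right_mono) auto
    have m': "0 \<le> real i * h" "real i * h \<le> real (Suc i) * h" "real (Suc i) * h - real i * h = h"
      using h by (auto simp: algebra_simps)
    show ?thesis
      unfolding D_def E_def
    proof (rule occupation_step)
      fix r assume r: "real i * h \<le> r" "r \<le> real (Suc i) * h"
      have "0 \<le> r" "r \<le> T" "real i * h \<le> T" "\<bar>r - real i * h\<bar> \<le> h"
        using r m m' by linarith+
      then show "\<bar>z r - z (real i * h)\<bar> \<le> \<delta>" "\<bar>V r\<bar> \<le> c"
        using m'(1) by (auto intro!: oscz c)
    qed (use m m' h in \<open>auto intro!: oscb\<close>)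
  qed
  then have "\<bar>\<Sum>i<n. D i\<bar> \<le> (\<Sum>i<n. E i)"
    by (intro order_trans[OF sum_abs] sum_mono) auto
  also have "(\<Sum>i<n. E i) = 4 * \<delta> * (\<Sum>i<n. L (real (Suc i) * h) - L (real i * h))
      + (l * c + 2 * \<delta> * c) * (\<Sum>i<n. real (Suc i) * h - real i * h)"
    unfolding E_def sum.distrib sum_distrib_left ..
  also have "\<dots> = 4 * \<delta> * L T + (l * c + 2 * \<delta> * c) * T"
    using sum_lessThan_telescope[of "\<lambda>i. L (real i * h)" n]
      sum_lessThan_telescope[of "\<lambda>i. real i * h" n] L0 by (simp add: T)
  finally have DE: "\<bar>\<Sum>i<n. D i\<bar> \<le> 4 * \<delta> * L T + (l * c + 2 * \<delta> * c) * T" .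
  have "(\<Sum>i<n. D i) = l * (\<Sum>i<n. L (real (Suc i) * h) - L (real i * h))
      - (\<Sum>i<n. (b (real (Suc i) * h) - b (real i * h))\<^sup>2)
      + (\<Sum>i<n. (l - 2 * z (real i * h)) * (b (real (Suc i) * h) - b (real i * h)))
      - (\<Sum>i<n. z (real (Suc i) * h) * (l - z (real (Suc i) * h)) - z (real i * h) * (l - z (real i * h)))"
    unfolding D_def
    by (subst sum_subtractf, subst sum.distrib, subst sum_subtractf) (simp only: sum_distrib_left)
  also have "\<dots> = l * L T
      - (\<Sum>i<n. (b (real (Suc i) * h) - b (real i * h))\<^sup>2)
      + (\<Sum>i<n. (l - 2 * z (real i * h)) * (b (real (Suc i) * h) - b (real i * h)))
      - z T * (l - z T)"
    using sum_lessThan_telescope[of "\<lambda>i. L (real i * h)" n]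
      sum_lessThan_telescope[of "\<lambda>i. z (real i * h) * (l - z (real i * h))" n] L0 z_0 by (simp add: T)
  finally have D_eq: "(\<Sum>i<n. D i) = \<dots>" .
  have "T \<ge> 0" using T h by simp
  then have "0 \<le> z T * (l - z T)" "z T * (l - z T) \<le> l * l"
    using z_range[of T] by (auto intro!: mult_mono)
  then show ?thesis using DE D_eq by (simp add: power2_eq_square)
qed

lemma occupation_limit:
  assumes T: "T > 0" and c: "\<And>r. 0 \<le> r \<Longrightarrow> r \<le> T \<Longrightarrow> \<bar>V r\<bar> \<le> c" and \<epsilon>: "\<epsilon> > 0"
  shows "\<forall>\<^sub>F n in sequentially.
    \<bar>l * L T - (\<Sum>i<n. (b (real (Suc i) * (T / n)) - b (real i * (T / n)))\<^sup>2)
      + (\<Sum>i<n. (l - 2 * z (real i * (T / n))) * (b (real (Suc i) * (T / n)) - b (real i * (T / n))))\<bar>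
    \<le> l\<^sup>2 + l * c * T + \<epsilon>"
proof -
  have cn: "c \<ge> 0" using c[of 0] abs_ge_zero[of "V 0"] T by linarith
  have LT: "L T \<ge> 0" using L_nonneg T by simp
  \<comment> \<open>The factor of \<open>\<delta>\<close> in \<open>occupation_sum\<close>, made positive.\<close>
  define D where "D = 4 * L T + 2 * c * T + 1"
  have D: "D > 0" using cn LT T by (auto simp: D_def intro!: add_nonneg_pos)
  define \<delta> where "\<delta> = \<epsilon> / D"
  have \<delta>: "\<delta> > 0" using D \<epsilon> by (simp add: \<delta>_def)
  obtain d1 where d1: "d1 > 0" "\<And>r s. 0 \<le> r \<Longrightarrow> r \<le> T \<Longrightarrow> 0 \<le> s \<Longrightarrow> s \<le> T \<Longrightarrow> \<bar>r - s\<bar> \<le> d1 \<Longrightarrow> \<bar>z r - z s\<bar> \<le> \<delta>"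
    using oscillation_le[OF z_cont \<delta>, of T] by blast
  obtain d2 where d2: "d2 > 0" "\<And>r s. 0 \<le> r \<Longrightarrow> r \<le> T \<Longrightarrow> 0 \<le> s \<Longrightarrow> s \<le> T \<Longrightarrow> \<bar>r - s\<bar> \<le> d2 \<Longrightarrow> \<bar>b r - b s\<bar> \<le> \<delta>"
    using oscillation_le[OF b \<delta>, of T] by blast
  have lim: "(\<lambda>n. T / real n) \<longlonglongrightarrow> 0" by real_asymp
  have "\<forall>\<^sub>F n in sequentially. T / real n < min d1 d2"
    using d1(1) d2(1) by (intro order_tendstoD(2)[OF lim]) simp
  then have "\<forall>\<^sub>F n in sequentially. T / real n < min d1 d2 \<and> n > 0"
    using eventually_gt_at_top by (rule eventually_conj)
  then show ?thesis
  proof eventually_elim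
    case (elim n)
    define h where "h = T / real n"
    have h: "h > 0" "T = real n * h" "h \<le> d1" "h \<le> d2" using elim T by (auto simp: h_def)
    have "\<bar>l * L T - (\<Sum>i<n. (b (real (Suc i) * h) - b (real i * h))\<^sup>2)
      + (\<Sum>i<n. (l - 2 * z (real i * h)) * (b (real (Suc i) * h) - b (real i * h)))\<bar>
      \<le> l\<^sup>2 + 4 * \<delta> * L T + (l * c + 2 * \<delta> * c) * T"
      using h d1(2) d2(2) by (intro occupation_sum c) auto
    also have "\<dots> = l\<^sup>2 + l * c * T + \<delta> * (4 * L T + 2 * c * T)" by (simp add: algebra_simps)
    also have "\<delta> * (4 * L T + 2 * c * T) \<le> \<delta> * D" using \<delta> by (simp add: D_def)
    also have "\<delta> * D = \<epsilon>" using D by (simp add: \<delta>_def)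
    finally show ?case by (simp add: h_def)
  qed
qed

text \<open>
  Let \<open>e k\<close> be the difference between the true and the discrete drift at step \<open>k\<close>.  If \<open>e\<close> increases in a
  step, then either the true path is reflected at \<open>0\<close> or the scheme is projected to \<open>l\<close>; in both cases the
  true position exceeds the discrete one by at most \<open>\<delta>\<close>.  As the positions differ by \<open>e\<close>, the accumulated
  error \<open>h * (\<Sum>i<k. e i)\<close> and a small quadrature error, this bounds \<open>e\<close> from above by the accumulated error.
  Decreases are symmetric, and Gronwall's inequality concludes.  In particular no error builds up from
  repeated contact with the boundary.
\<close>

lemma scheme_error:
  assumes h: "h > 0" and N: "real N * h \<le> T"
    and oscz: "\<And>r s. 0 \<le> r \<Longrightarrow> r \<le> T \<Longrightarrow> 0 \<le> s \<Longrightarrow> s \<le> T \<Longrightarrow> \<bar>r - s\<bar> \<le> h \<Longrightarrow> \<bar>z r - z s\<bar> \<le> \<delta>"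
    and oscV: "\<And>r s. 0 \<le> r \<Longrightarrow> r \<le> T \<Longrightarrow> 0 \<le> s \<Longrightarrow> s \<le> T \<Longrightarrow> \<bar>r - s\<bar> \<le> h \<Longrightarrow> \<bar>V r - V s\<bar> \<le> \<delta>"
    and k: "k \<le> N"
  defines "x \<equiv> \<lambda>i. b (real (Suc i) * h) - b (real i * h)"
  shows "\<bar>z (real k * h) - scheme_z l v h x k\<bar> \<le> 2 * (\<delta> * (1 + T)) * exp T"
proof -
  have T0: "0 \<le> T" using N h by (meson mult_nonneg_nonneg of_nat_0_le_iff less_imp_le order_trans)
  have \<delta>: "\<delta> \<ge> 0" using oscz[of 0 0] T0 h by simp
  define u where "u k = scheme_v l v h x k" for k
  define y where "y k = scheme_z l v h x k" for k
  define e where "e k = V (real k * h) - u k" for k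
  \<comment> \<open>The quadrature error of the drift term.\<close>
  define r where "r k = integral {0..real k * h} V - h * (\<Sum>i<k. V (real i * h))" for k
  have grid: "0 \<le> real k * h" "real k * h \<le> T" if "k \<le> N" for k
  proof -
    have "real k * h \<le> real N * h" using that h by (intro mult_right_mono) auto
    then show "real k * h \<le> T" using N by (rule order_trans)
    show "0 \<le> real k * h" using h by simp
  qed
  have Suc_h: "real (Suc k) * h - real k * h = h" "real k * h \<le> real (Suc k) * h" for k
    using h by (auto simp: algebra_simps)
  have r: "\<bar>r k\<bar> \<le> \<delta> * (real k * h)" if "k \<le> N" for k
    using that
  proof (induction k)
    case 0
    then show ?case by (simp add: r_def)
  next
    case (Suc k)
    let ?s = "real k * h" and ?t = "real (Suc k) * h"
    have k: "0 \<le> ?s" "?t \<le> T" using grid(1)[of k] grid(2)[of "Suc k"] Suc.prems by auto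
    have "integral {?s..?t} (\<lambda>q. V q - V ?s) = integral {?s..?t} V - h * V ?s"
      using Suc_h[of k] k by (subst Henstock_Kurzweil_Integration.integral_diff)
        (auto intro: integrable_on_of_continuous_on_nonneg[OF V_cont])
    moreover have "\<bar>integral {?s..?t} (\<lambda>q. V q - V ?s)\<bar> \<le> \<delta> * (?t - ?s)"
    proof (rule abs_integral_le)
      fix q assume q: "?s \<le> q" "q \<le> ?t"
      then have "0 \<le> q" "q \<le> T" "?s \<le> T" "\<bar>q - ?s\<bar> \<le> h" using k Suc_h[of k] by linarith+
      then show "\<bar>V q - V ?s\<bar> \<le> \<delta>" using k by (intro oscV)
    qed (use Suc_h[of k] k in \<open>auto intro!: continuous_intros V_cont\<close>)
    moreover have "r (Suc k) = r k + (integral {?s..?t} V - h * V ?s)"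
      using integral_split_nonneg[OF V_cont k(1) Suc_h(2)] by (simp add: r_def algebra_simps)
    ultimately have "\<bar>r (Suc k)\<bar> \<le> \<bar>r k\<bar> + \<delta> * (?t - ?s)" by linarith
    then show ?case using Suc by (simp add: algebra_simps)
  qed
  have sum_x: "(\<Sum>i<k. x i) = b (real k * h)" for k
    unfolding x_def using sum_lessThan_telescope[of "\<lambda>i. b (real i * h)" k] b0 by simp
  have diff: "z (real k * h) - y k = e k + h * (\<Sum>i<k. e i) + r k" if "k \<le> N" for k
    using z_eq[OF grid(1)[OF that]] V_eq[OF grid(1)[OF that]] scheme_z_eq[of l v h x k] sum_x[of k]
    by (simp add: y_def u_def e_def r_def sum_subtractf algebra_simps)
  define c where "c = \<delta> * (1 + T)"
  have c: "c \<ge> 0" using \<delta> T0 by (simp add: c_def)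
  have rc: "\<delta> + \<bar>r k\<bar> \<le> c" if "k \<le> N" for k
  proof -
    have "\<delta> * (real k * h) \<le> \<delta> * T" using grid(2)[OF that] \<delta> by (intro mult_left_mono)
    then show ?thesis using r[OF that] by (simp add: c_def algebra_simps)
  qed
  have yr: "0 \<le> y k" "y k \<le> l" for k using scheme_z_range[of l] l by (auto simp: y_def)
  have step: "\<bar>e (Suc k)\<bar> \<le> max \<bar>e k\<bar> (c + h * (\<Sum>i\<le>k. \<bar>e i\<bar>))" if k: "k < N" for k
  proof -
    let ?s = "real k * h" and ?t = "real (Suc k) * h"
    have st: "0 \<le> ?s" "?s \<le> ?t" "?t \<le> T" "0 \<le> ?t"
      using grid[of k] grid[of "Suc k"] k Suc_h[of k] by auto
    have zt: "0 \<le> z ?t" "z ?t \<le> l" using z_range[OF st(4)] by auto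
    have near: "\<bar>z ?t - z q\<bar> \<le> \<delta>" if "?s \<le> q" "q \<le> ?t" for q
    proof -
      have "0 \<le> q" "q \<le> T" "\<bar>?t - q\<bar> \<le> h" using that st Suc_h[of k] by linarith+
      then show ?thesis using st by (intro oscz)
    qed
    have e_diff: "e (Suc k) - e k = (L0 ?t - L0 ?s) - (Ll ?t - Ll ?s) - (u (Suc k) - u k)"
      using V_eq[OF st(1)] V_eq[OF st(4)] by (simp add: e_def)
    have sum_le: "\<bar>h * (\<Sum>i\<le>k. e i)\<bar> \<le> h * (\<Sum>i\<le>k. \<bar>e i\<bar>)"
      using h by (simp add: abs_mult sum_abs)
    have id: "z ?t - y (Suc k) = e (Suc k) + h * (\<Sum>i\<le>k. e i) + r (Suc k)"
      using diff[of "Suc k"] k by (simp add: lessThan_Suc_atMost)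
    have up: "z ?t - y (Suc k) \<le> \<delta>" if "e (Suc k) > e k"
    proof -
      have "L0 ?t - L0 ?s > 0 \<or> u (Suc k) < u k"
        using that e_diff Ll_mono[OF st(1,2)] by linarith
      then show ?thesis
      proof
        assume "L0 ?t - L0 ?s > 0"
        then obtain q where "?s \<le> q" "q \<le> ?t" "z q = 0" using L0_flat[OF st(1,2)] by auto
        then show ?thesis using near[of q] yr(1)[of "Suc k"] by simp
      next
        assume "u (Suc k) < u k"
        then have "y (Suc k) = l" unfolding u_def y_def using l by (intro scheme_v_decrease) auto
        then show ?thesis using zt \<delta> by simp
      qed
    qed
    have down: "- \<delta> \<le> z ?t - y (Suc k)" if "e (Suc k) < e k"
    proof -
      have "Ll ?t - Ll ?s > 0 \<or> u (Suc k) > u k"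
        using that e_diff L0_mono[OF st(1,2)] by linarith
      then show ?thesis
      proof
        assume "Ll ?t - Ll ?s > 0"
        then obtain q where "?s \<le> q" "q \<le> ?t" "z q = l" using Ll_flat[OF st(1,2)] by auto
        then show ?thesis using near[of q] yr(2)[of "Suc k"] by simp
      next
        assume "u (Suc k) > u k"
        then have "y (Suc k) = 0" unfolding u_def y_def using l by (intro scheme_v_increase) auto
        then show ?thesis using zt \<delta> by simp
      qed
    qed
    have rk: "\<delta> + \<bar>r (Suc k)\<bar> \<le> c" using rc[of "Suc k"] k by simp
    have "e (Suc k) \<le> max \<bar>e k\<bar> (c + h * (\<Sum>i\<le>k. \<bar>e i\<bar>))"
      using up id sum_le rk by linarith
    moreover have "- e (Suc k) \<le> max \<bar>e k\<bar> (c + h * (\<Sum>i\<le>k. \<bar>e i\<bar>))"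
      using down id sum_le rk by linarith
    ultimately show ?thesis by linarith
  qed
  have e0: "\<bar>e 0\<bar> \<le> c" using V_eq[of 0] L0_0 Ll_0 c by (simp add: e_def u_def)
  have ek: "\<bar>e k\<bar> \<le> c * (1 + h) ^ k" if "k \<le> N" for k
    by (rule discrete_gronwall[where N=N and a="\<lambda>k. \<bar>e k\<bar>"]) (use h c e0 step that in auto)
  have geo: "h * (\<Sum>i<k. c * (1 + h) ^ i) = c * (1 + h) ^ k - c" for k
    by (induction k) (auto simp: algebra_simps)
  have "\<bar>h * (\<Sum>i<k. e i)\<bar> \<le> h * (\<Sum>i<k. \<bar>e i\<bar>)" using h by (simp add: abs_mult sum_abs)
  also have "\<dots> \<le> h * (\<Sum>i<k. c * (1 + h) ^ i)"
    using h ek k by (intro mult_left_mono sum_mono) auto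
  finally have he: "\<bar>h * (\<Sum>i<k. e i)\<bar> \<le> c * (1 + h) ^ k - c" unfolding geo .
  have "\<bar>z (real k * h) - y k\<bar> \<le> 2 * c * (1 + h) ^ k"
    using diff[OF k] ek[OF k] he rc[OF k] \<delta> by linarith
  moreover have "(1 + h) ^ k \<le> exp T"
  proof -
    have "(1 + h) ^ k \<le> exp h ^ k" using h by (intro power_mono) auto
    also have "exp h ^ k = exp (real k * h)" by (simp add: exp_of_nat_mult)
    also have "\<dots> \<le> exp T" using grid(2)[OF k] by simp
    finally show ?thesis .
  qed
  then have "2 * c * (1 + h) ^ k \<le> 2 * c * exp T" using c by (intro mult_left_mono) auto
  ultimately show ?thesis by (simp add: y_def c_def)
qed

text \<open>
  The grid with step \<open>T / n\<close> is refined by a factor \<open>m\<close>, so that its points remain grid points, with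
  index \<open>i * m\<close>.
\<close>

lemma scheme_tendsto:
  assumes T: "T > 0" and n: "n > 0" and i: "i \<le> n"
  shows "(\<lambda>m. scheme_z l v (T / (n * m)) (\<lambda>k. b (real (Suc k) * (T / (n * m))) - b (real k * (T / (n * m)))) (i * m))
    \<longlonglongrightarrow> z (real i * (T / n))"
  unfolding tendsto_iff
proof (intro allI impI)
  fix \<epsilon> :: real assume \<epsilon>: "\<epsilon> > 0"
  define D where "D = 2 * (1 + T) * exp T"
  have D: "D > 0" using T by (simp add: D_def)
  define \<delta> where "\<delta> = \<epsilon> / (2 * D)"
  have \<delta>: "\<delta> > 0" using D \<epsilon> by (simp add: \<delta>_def)
  obtain d1 where d1: "d1 > 0" "\<And>r s. 0 \<le> r \<Longrightarrow> r \<le> T \<Longrightarrow> 0 \<le> s \<Longrightarrow> s \<le> T \<Longrightarrow> \<bar>r - s\<bar> \<le> d1 \<Longrightarrow> \<bar>z r - z s\<bar> \<le> \<delta>"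
    using oscillation_le[OF z_cont \<delta>, of T] by blast
  obtain d2 where d2: "d2 > 0" "\<And>r s. 0 \<le> r \<Longrightarrow> r \<le> T \<Longrightarrow> 0 \<le> s \<Longrightarrow> s \<le> T \<Longrightarrow> \<bar>r - s\<bar> \<le> d2 \<Longrightarrow> \<bar>V r - V s\<bar> \<le> \<delta>"
    using oscillation_le[OF V_cont \<delta>, of T] by blast
  have lim: "(\<lambda>m. T / (real n * real m)) \<longlonglongrightarrow> 0" using n by real_asymp
  have "\<forall>\<^sub>F m in sequentially. T / (real n * real m) < min d1 d2"
    using d1(1) d2(1) by (intro order_tendstoD(2)[OF lim]) simp
  then have "\<forall>\<^sub>F m in sequentially. T / (real n * real m) < min d1 d2 \<and> m > 0"
    using eventually_gt_at_top by (rule eventually_conj)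
  then show "\<forall>\<^sub>F m in sequentially. dist (scheme_z l v (T / (n * m))
      (\<lambda>k. b (real (Suc k) * (T / (n * m))) - b (real k * (T / (n * m)))) (i * m)) (z (real i * (T / n))) < \<epsilon>"
  proof eventually_elim
    case (elim m)
    define h where "h = T / (real n * real m)"
    have h: "h > 0" "real (n * m) * h = T" "h \<le> d1" "h \<le> d2"
      using elim T n by (auto simp: h_def)
    have "\<bar>z (real (i * m) * h) - scheme_z l v h (\<lambda>k. b (real (Suc k) * h) - b (real k * h)) (i * m)\<bar>
        \<le> 2 * (\<delta> * (1 + T)) * exp T"
      using h d1(2) d2(2) i by (intro scheme_error[where N="n * m"]) auto
    also have "\<dots> = \<delta> * D" by (simp add: D_def)
    also have "\<dots> = \<epsilon> / 2" using D by (simp add: \<delta>_def)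
    also have "\<dots> < \<epsilon>" using \<epsilon> by simp
    also have "real (i * m) * h = real i * (T / n)" using elim n by (simp add: h_def)
    finally show ?case by (simp add: h_def dist_real_def abs_minus_commute)
  qed
qed

end

section \<open>The rate of the boundary local time\<close>

lemma scheme_cong:
  "(\<And>i. i < k \<Longrightarrow> x i = y i) \<Longrightarrow> clamp_scheme l v h x k = clamp_scheme l v h y k"
  by (induction k) auto

lemma measurable_scheme:
  assumes "k \<le> N"
  shows "(\<lambda>x. scheme_z l v h x k) \<in> borel_measurable (PiM {..<N} (\<lambda>_. borel)) \<and>
    (\<lambda>x. scheme_v l v h x k) \<in> borel_measurable (PiM {..<N} (\<lambda>_. borel))"
  using assms
proof (induction k)
  case 0
  then show ?case by simp
next
  case (Suc k)
  then have [measurable]: "(\<lambda>x. scheme_z l v h x k) \<in> borel_measurable (PiM {..<N} (\<lambda>_. borel))"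
    "(\<lambda>x. scheme_v l v h x k) \<in> borel_measurable (PiM {..<N} (\<lambda>_. borel))" by auto
  have [measurable]: "(\<lambda>x. x k) \<in> borel_measurable (PiM {..<N} (\<lambda>_. borel :: real measure))"
    using Suc.prems by (intro measurable_component_singleton) auto
  show ?case by (simp add: Let_def split_beta)
qed

lemma sum_increment_block:
  "a \<le> c \<Longrightarrow> (\<Sum>k\<in>{a..<c}. increment B h k \<omega>) = B (real c * h) \<omega> - B (real a * h) \<omega>"
  unfolding increment_def using sum_Suc_diff'[of a c "\<lambda>k. B (real k * h) \<omega>"] by simp

locale inert_process =
  fixes M :: "'a measure" and l v :: real and B Z V L0 Ll :: "real \<Rightarrow> 'a \<Rightarrow> real"
  assumes l: "l > 0" and rbm: "reflected_bm_inert_drift M l v B Z V L0 Ll"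
begin

lemma bm: "standard_brownian_motion M B"
  and meas: "t \<ge> 0 \<Longrightarrow> Z t \<in> borel_measurable M" "t \<ge> 0 \<Longrightarrow> V t \<in> borel_measurable M"
    "t \<ge> 0 \<Longrightarrow> L0 t \<in> borel_measurable M" "t \<ge> 0 \<Longrightarrow> Ll t \<in> borel_measurable M"
  using rbm unfolding reflected_bm_inert_drift_def by blast+

sublocale prob_space M by (rule standard_brownian_motionD(1)[OF bm])

abbreviation good :: "'a \<Rightarrow> bool" where
  "good \<omega> \<equiv> inert_path l v (\<lambda>t. B t \<omega>) (\<lambda>t. Z t \<omega>) (\<lambda>t. V t \<omega>) (\<lambda>t. L0 t \<omega>) (\<lambda>t. Ll t \<omega>)"

lemma AE_good: "AE \<omega> in M. good \<omega>"
proof -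
  have "AE \<omega> in M. inert_drift_path l v (\<lambda>t. B t \<omega>) (\<lambda>t. Z t \<omega>) (\<lambda>t. V t \<omega>) (\<lambda>t. L0 t \<omega>) (\<lambda>t. Ll t \<omega>)"
    using rbm unfolding reflected_bm_inert_drift_def by blast
  with standard_brownian_motionD(3,5)[OF bm] show ?thesis
    by eventually_elim (simp add: inert_path_def l)
qed

lemma AE_unbounded: "AE \<omega> in M. \<forall>C. \<exists>t\<ge>0. L0 t \<omega> + Ll t \<omega> > C"
  using AE_good brownian_increments_unbounded[OF bm]
proof eventually_elim
  case (elim \<omega>)
  then interpret inert_path l v "\<lambda>t. B t \<omega>" "\<lambda>t. Z t \<omega>" "\<lambda>t. V t \<omega>" "\<lambda>t. L0 t \<omega>" "\<lambda>t. Ll t \<omega>" by simp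
  show ?case
    using L_unbounded elim(2) by (simp add: increment_def)
qed

lemma good_event:
  obtains G where "G \<in> sets M" "AE \<omega> in M. \<omega> \<in> G" "\<And>\<omega>. \<omega> \<in> G \<Longrightarrow> good \<omega>"
    "\<And>\<omega> C. \<omega> \<in> G \<Longrightarrow> \<exists>t\<ge>0. L0 t \<omega> + Ll t \<omega> > C"
proof -
  have "AE \<omega> in M. good \<omega> \<and> (\<forall>C. \<exists>t\<ge>0. L0 t \<omega> + Ll t \<omega> > C)"
    using AE_good AE_unbounded by eventually_elim simp
  then obtain N where N: "N \<in> null_sets M"
    "{\<omega> \<in> space M. \<not> (good \<omega> \<and> (\<forall>C. \<exists>t\<ge>0. L0 t \<omega> + Ll t \<omega> > C))} \<subseteq> N"
    unfolding eventually_ae_filter by blast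
  show thesis
  proof (rule that[of "space M - N"])
    show "space M - N \<in> sets M" using N(1) by auto
    show "AE \<omega> in M. \<omega> \<in> space M - N" using AE_not_in[OF N(1)] by auto
    show "good \<omega>" if "\<omega> \<in> space M - N" for \<omega> using N(2) that by blast
    show "\<exists>t\<ge>0. L0 t \<omega> + Ll t \<omega> > C" if "\<omega> \<in> space M - N" for \<omega> C using N(2) that by blast
  qed
qed

text \<open>
  The event that the inverse local time is below \<open>s\<close> is a countable union over rational times.  The drift
  at this random time is then the limit of its values at discretised random times.
\<close>

lemma time_changed_drift_path_version:
  "\<exists>P. path_version M (\<lambda>t. time_changed_drift V L0 Ll (t / l)) P"
proof -
  obtain G where G[measurable]: "G \<in> sets M" and AEG: "AE \<omega> in M. \<omega> \<in> G"
    and good: "\<And>\<omega>. \<omega> \<in> G \<Longrightarrow> good \<omega>"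
    and unb: "\<And>\<omega> C. \<omega> \<in> G \<Longrightarrow> \<exists>t\<ge>0. L0 t \<omega> + Ll t \<omega> > C"
    by (rule good_event) blast
  let ?inv = "\<lambda>\<tau> \<omega>. right_inverse (\<lambda>t. L0 t \<omega> + Ll t \<omega>) \<tau>"
  have Tm: "(\<lambda>\<omega>. if \<omega> \<in> G then ?inv \<tau> \<omega> else 0) \<in> borel_measurable M" for \<tau>
    unfolding borel_measurable_iff_less
  proof
    fix s
    have "{\<omega> \<in> space M. (if \<omega> \<in> G then ?inv \<tau> \<omega> else 0) < s} =
        (G \<inter> (\<Union>q\<in>\<rat> \<inter> {0..<s}. {\<omega> \<in> space M. L0 q \<omega> + Ll q \<omega> > \<tau>})) \<union> (if 0 < s then space M - G else {})"
    proof -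
      have "?inv \<tau> \<omega> < s \<longleftrightarrow> (\<exists>q\<in>\<rat>. 0 \<le> q \<and> q < s \<and> L0 q \<omega> + Ll q \<omega> > \<tau>)" if "\<omega> \<in> G" for \<omega>
        using inert_path.right_inverse_less_iff[OF good[OF that] unb[OF that]] by simp
      then show ?thesis using sets.sets_into_space[OF G] by (auto split: if_splits)
    qed
    moreover have "(\<Union>q\<in>\<rat> \<inter> {0..<s}. {\<omega> \<in> space M. L0 q \<omega> + Ll q \<omega> > \<tau>}) \<in> sets M"
    proof (rule sets.countable_UN'')
      show "countable (\<rat> \<inter> {0..<s})" using countable_rat by (rule countable_Int1)
      show "{\<omega> \<in> space M. L0 q \<omega> + Ll q \<omega> > \<tau>} \<in> sets M" if "q \<in> \<rat> \<inter> {0..<s}" for q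
        using that meas(3)[of q] meas(4)[of q] by simp
    qed
    ultimately show "{\<omega> \<in> space M. (if \<omega> \<in> G then ?inv \<tau> \<omega> else 0) < s} \<in> sets M"
      by (simp add: sets.Un sets.Int sets.Diff)
  qed
  have "path_version M (\<lambda>t. time_changed_drift V L0 Ll (t / l))
      (\<lambda>\<omega>. mk_path (\<lambda>t. if \<omega> \<in> G then time_changed_drift V L0 Ll (t / l) \<omega> else 0))"
  proof (rule path_versionI[OF G AEG])
    fix \<omega> assume "\<omega> \<in> G"
    then interpret inert_path l v "\<lambda>t. B t \<omega>" "\<lambda>t. Z t \<omega>" "\<lambda>t. V t \<omega>" "\<lambda>t. L0 t \<omega>" "\<lambda>t. Ll t \<omega>"
      by (rule good)
    show "continuous_on {0..} (\<lambda>t. time_changed_drift V L0 Ll (t / l) \<omega>)"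
      unfolding time_changed_drift_def
      by (rule time_changed_drift_cont) (rule unb[OF \<open>\<omega> \<in> G\<close>])
  next
    fix t :: real assume t: "t \<ge> 0"
    define T where "T \<omega> = (if \<omega> \<in> G then ?inv (t / l) \<omega> else 0)" for \<omega>
    have T[measurable]: "T \<in> borel_measurable M" unfolding T_def[abs_def] by (rule Tm)
    have T0: "T \<omega> \<ge> 0" for \<omega>
      using inert_path.L_right_inverse[OF good unb, of \<omega> "t / l"] t l by (auto simp: T_def)
    define k where "k n \<omega> = nat \<lceil>real (Suc n) * T \<omega>\<rceil>" for n \<omega>
    show "(\<lambda>\<omega>. if \<omega> \<in> G then time_changed_drift V L0 Ll (t / l) \<omega> else 0) \<in> borel_measurable M"
    proof (rule borel_measurable_LIMSEQ_real)
      fix n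
      have "(\<lambda>\<omega>. V (real (k n \<omega>) / real (Suc n)) \<omega>) \<in> borel_measurable M"
      proof (rule measurable_compose_countable[where f="\<lambda>i. V (real i / real (Suc n))" and g="k n"])
        show "V (real i / real (Suc n)) \<in> borel_measurable M" for i by (intro meas) simp
        show "k n \<in> measurable M (count_space UNIV)" unfolding k_def[abs_def] by measurable
      qed
      then show "(\<lambda>\<omega>. if \<omega> \<in> G then V (real (k n \<omega>) / real (Suc n)) \<omega> else 0) \<in> borel_measurable M"
        by measurable
    next
      fix \<omega>
      have "(\<lambda>n. V (real (k n \<omega>) / real (Suc n)) \<omega>) \<longlonglongrightarrow> V (T \<omega>) \<omega>" if \<omega>: "\<omega> \<in> G"
      proof -
        have "(\<lambda>n. real (k n \<omega>) / real (Suc n)) \<longlonglongrightarrow> T \<omega>"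
        proof (rule tendsto_sandwich)
          have eq: "real (k n \<omega>) = real_of_int \<lceil>real (Suc n) * T \<omega>\<rceil>" for n
          proof -
            have "0 \<le> real (Suc n) * T \<omega>" using T0 by simp
            then show ?thesis unfolding k_def by linarith
          qed
          have low: "T \<omega> \<le> real (k n \<omega>) / real (Suc n)" for n
            unfolding eq by (subst pos_le_divide_eq) (simp_all add: mult.commute del: of_nat_Suc)
          have up: "real (k n \<omega>) / real (Suc n) \<le> T \<omega> + 1 / real (Suc n)" for n
          proof -
            have "real (k n \<omega>) \<le> real (Suc n) * T \<omega> + 1" unfolding eq by linarith
            then have "real (k n \<omega>) / real (Suc n) \<le> (real (Suc n) * T \<omega> + 1) / real (Suc n)"
              by (intro divide_right_mono) auto
            then show ?thesis by (simp add: add_divide_distrib del: of_nat_Suc)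
          qed
          show "\<forall>\<^sub>F n in sequentially. T \<omega> \<le> real (k n \<omega>) / real (Suc n)" using low by simp
          show "\<forall>\<^sub>F n in sequentially. real (k n \<omega>) / real (Suc n) \<le> T \<omega> + 1 / real (Suc n)" using up by simp
          show "(\<lambda>n. T \<omega> + 1 / real (Suc n)) \<longlonglongrightarrow> T \<omega>" by real_asymp
        qed auto
        then show ?thesis
          using T0 by (intro continuous_on_tendsto_compose[OF inert_path.V_cont[OF good[OF \<omega>]]]) auto
      qed
      then show "(\<lambda>n. if \<omega> \<in> G then V (real (k n \<omega>) / real (Suc n)) \<omega> else 0) \<longlonglongrightarrow>
          (if \<omega> \<in> G then time_changed_drift V L0 Ll (t / l) \<omega> else 0)"
        by (auto simp: time_changed_drift_def T_def)
    qed
  qed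
  then show ?thesis by blast
qed

lemma integrable_increment_prod:
  assumes "h > 0"
  shows "integrable M (\<lambda>\<omega>. increment B h i \<omega> * increment B h j \<omega>)"
proof (rule Bochner_Integration.integrable_bound)
  show "integrable M (\<lambda>\<omega>. increment B h i \<omega> ^ 2 + increment B h j \<omega> ^ 2)"
    by (intro Bochner_Integration.integrable_add integrable_increment_power[OF bm assms])
  show "(\<lambda>\<omega>. increment B h i \<omega> * increment B h j \<omega>) \<in> borel_measurable M"
    using measurable_increment[OF bm assms] by measurable
  have "\<bar>x * y\<bar> \<le> x\<^sup>2 + y\<^sup>2" for x y :: real
  proof -
    have "0 \<le> (\<bar>x\<bar> - \<bar>y\<bar>)\<^sup>2" by simp
    then have "2 * \<bar>x * y\<bar> \<le> x\<^sup>2 + y\<^sup>2" by (simp add: power2_diff abs_mult)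
    then show ?thesis using abs_ge_zero[of "x * y"] by linarith
  qed
  then show "AE \<omega> in M. norm (increment B h i \<omega> * increment B h j \<omega>) \<le>
      norm (increment B h i \<omega> ^ 2 + increment B h j \<omega> ^ 2)" by simp
qed

lemma AE_weight_le: "AE \<omega> in M. \<forall>t\<ge>0. \<bar>l - 2 * Z t \<omega>\<bar> \<le> l"
  using AE_good
proof eventually_elim
  case (elim \<omega>)
  then interpret inert_path l v "\<lambda>t. B t \<omega>" "\<lambda>t. Z t \<omega>" "\<lambda>t. V t \<omega>" "\<lambda>t. L0 t \<omega>" "\<lambda>t. Ll t \<omega>" .
  show ?case
  proof (intro allI impI)
    fix t :: real assume "t \<ge> 0"
    then show "\<bar>l - 2 * Z t \<omega>\<bar> \<le> l" using z_range[of t] by auto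
  qed
qed

lemma integrable_weighted_increments:
  assumes h: "h > 0" and st: "s \<ge> 0" "t \<ge> 0"
  shows "integrable M (\<lambda>\<omega>. ((l - 2 * Z s \<omega>) * increment B h i \<omega>) * ((l - 2 * Z t \<omega>) * increment B h j \<omega>))"
proof (rule Bochner_Integration.integrable_bound)
  show "integrable M (\<lambda>\<omega>. l * l * (increment B h i \<omega> * increment B h j \<omega>))"
    by (intro integrable_mult_right integrable_increment_prod h)
  show "(\<lambda>\<omega>. ((l - 2 * Z s \<omega>) * increment B h i \<omega>) * ((l - 2 * Z t \<omega>) * increment B h j \<omega>)) \<in> borel_measurable M"
    using measurable_increment[OF bm h] meas(1)[OF st(1)] meas(1)[OF st(2)] by measurable
  show "AE \<omega> in M. norm (((l - 2 * Z s \<omega>) * increment B h i \<omega>) * ((l - 2 * Z t \<omega>) * increment B h j \<omega>))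
      \<le> norm (l * l * (increment B h i \<omega> * increment B h j \<omega>))"
    using AE_weight_le
  proof eventually_elim
    case (elim \<omega>)
    have "\<bar>l - 2 * Z s \<omega>\<bar> * \<bar>l - 2 * Z t \<omega>\<bar> * \<bar>increment B h i \<omega> * increment B h j \<omega>\<bar>
        \<le> l * l * \<bar>increment B h i \<omega> * increment B h j \<omega>\<bar>"
      using elim st by (intro mult_right_mono mult_mono) auto
    then show ?case using l by (simp add: abs_mult mult_ac)
  qed
qed

text \<open>
  On the refined grid, everything but the last increment is a function of the first \<open>j * m\<close> fine
  increments, and the last increment is the sum of the next \<open>m\<close> fine ones, centred and independent of the
  former.
\<close>

lemma scheme_increments_orthogonal:
  assumes T: "T > 0" and n: "n > 0" and m: "m > 0" and ij: "i < j"
  defines "h \<equiv> T / real (n * m)"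
  defines "\<zeta> \<equiv> \<lambda>k \<omega>. scheme_z l v h (\<lambda>a. increment B h a \<omega>) (k * m)"
  shows "expectation (\<lambda>\<omega>. ((l - 2 * \<zeta> i \<omega>) * increment B (T / n) i \<omega>) *
      ((l - 2 * \<zeta> j \<omega>) * increment B (T / n) j \<omega>)) = 0" (is ?zero)
    and "\<zeta> k \<in> borel_measurable M" (is ?meas)
proof -
  have h: "h > 0" using T n m by (simp add: h_def)
  have hn: "T / real n > 0" using T n by simp
  have block: "(\<Sum>a\<in>{k * m..<Suc k * m}. increment B h a \<omega>) = increment B (T / n) k \<omega>" for k \<omega>
  proof -
    have eq: "real (k * m) * h = real k * (T / n)" for k using m n by (simp add: h_def)
    show ?thesis
      using sum_increment_block[of "k * m" "Suc k * m" B h \<omega>] unfolding eq increment_def[of B "T / n"]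
      by simp
  qed
  have X: "(\<lambda>\<omega>. \<lambda>a\<in>A. increment B h a \<omega>) \<in> measurable M (PiM A (\<lambda>_. borel))" for A
    by (intro measurable_restrict measurable_increment[OF bm h])
  have \<zeta>: "\<zeta> k \<omega> = scheme_z l v h (\<lambda>a\<in>{..<N}. increment B h a \<omega>) (k * m)" if "k * m \<le> N" for k N \<omega>
    unfolding \<zeta>_def using that by (intro arg_cong[where f=fst] scheme_cong) auto
  have \<zeta>_meas: "\<zeta> k \<in> borel_measurable M" for k
  proof -
    have "\<zeta> k = (\<lambda>\<omega>. scheme_z l v h (\<lambda>a\<in>{..<k * m}. increment B h a \<omega>) (k * m))"
      by (rule ext) (rule \<zeta>[OF order_refl])
    then show ?thesis
      using measurable_compose[OF X conjunct1[OF measurable_scheme[OF order_refl]]] by (simp only:)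
  qed
  then show ?meas .
  define G where "G x = (l - 2 * scheme_z l v h x (i * m)) * (\<Sum>a\<in>{i * m..<Suc i * m}. x a) *
      (l - 2 * scheme_z l v h x (j * m))" for x
  have im: "Suc i * m \<le> j * m" using ij by (intro mult_right_mono) auto
  have im': "i * m \<le> j * m" using ij by (intro mult_right_mono) auto
  have sc[measurable]: "(\<lambda>x. scheme_z l v h x (i * m)) \<in> borel_measurable (PiM {..<j * m} (\<lambda>_. borel))"
    "(\<lambda>x. scheme_z l v h x (j * m)) \<in> borel_measurable (PiM {..<j * m} (\<lambda>_. borel))"
    using measurable_scheme[OF im'] measurable_scheme[OF order_refl] by auto
  have sum_meas: "(\<lambda>x. \<Sum>a\<in>{a..<c}. x a :: real) \<in> borel_measurable (PiM A (\<lambda>_. borel))"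
    if "{a..<c} \<subseteq> A" for a c :: nat and A
  proof (rule borel_measurable_sum[where f="\<lambda>i y. y i"])
    fix i assume "i \<in> {a..<c}"
    then show "(\<lambda>y. y i) \<in> borel_measurable (PiM A (\<lambda>_. borel :: real measure))"
      using that by (intro measurable_component_singleton) auto
  qed
  have [measurable]: "(\<lambda>x. \<Sum>a\<in>{i * m..<Suc i * m}. x a) \<in> borel_measurable (PiM {..<j * m} (\<lambda>_. borel :: real measure))"
    by (rule sum_meas) (use im in auto)
  have G: "G \<in> borel_measurable (PiM {..<j * m} (\<lambda>_. borel))"
    unfolding G_def by measurable
  have S: "(\<lambda>x. \<Sum>a\<in>{j * m..<Suc j * m}. x a :: real) \<in> borel_measurable (PiM {j * m..<Suc j * m} (\<lambda>_. borel))"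
    by (rule sum_meas) auto
  have "indep_var borel (G \<circ> (\<lambda>\<omega>. \<lambda>a\<in>{..<j * m}. increment B h a \<omega>))
      borel ((\<lambda>x. \<Sum>a\<in>{j * m..<Suc j * m}. x a) \<circ> (\<lambda>\<omega>. \<lambda>a\<in>{j * m..<Suc j * m}. increment B h a \<omega>))"
    by (intro indep_var_compose[OF indep_var_restrict[OF indep_increments[OF bm h, of "Suc j * m"]] G S])
      auto
  moreover have "G (\<lambda>a\<in>{..<j * m}. increment B h a \<omega>) =
      ((l - 2 * \<zeta> i \<omega>) * increment B (T / n) i \<omega>) * (l - 2 * \<zeta> j \<omega>)" for \<omega>
  proof -
    have "(\<Sum>a\<in>{i * m..<Suc i * m}. (\<lambda>a\<in>{..<j * m}. increment B h a \<omega>) a) =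
        (\<Sum>a\<in>{i * m..<Suc i * m}. increment B h a \<omega>)"
      using im by (intro sum.cong) auto
    then show ?thesis
      by (simp add: G_def block \<zeta>[OF im'] \<zeta>[OF order_refl, of j] del: mult_Suc)
  qed
  moreover have "(\<Sum>a\<in>{j * m..<Suc j * m}. (\<lambda>a\<in>{j * m..<Suc j * m}. increment B h a \<omega>) a) =
      increment B (T / n) j \<omega>" for \<omega>
    by (simp add: block[symmetric] del: mult_Suc)
  ultimately have ind: "indep_var borel (\<lambda>\<omega>. ((l - 2 * \<zeta> i \<omega>) * increment B (T / n) i \<omega>) * (l - 2 * \<zeta> j \<omega>))
      borel (increment B (T / n) j)"
    by (simp add: comp_def)
  have "integrable M (\<lambda>\<omega>. ((l - 2 * \<zeta> i \<omega>) * increment B (T / n) i \<omega>) * (l - 2 * \<zeta> j \<omega>))"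
  proof (rule Bochner_Integration.integrable_bound)
    show "integrable M (\<lambda>\<omega>. l * l * increment B (T / n) i \<omega>)"
      using integrable_increment_power[OF bm hn, of i 1] by simp
    show "(\<lambda>\<omega>. ((l - 2 * \<zeta> i \<omega>) * increment B (T / n) i \<omega>) * (l - 2 * \<zeta> j \<omega>)) \<in> borel_measurable M"
      using \<zeta>_meas measurable_increment[OF bm hn] by measurable
    have "\<bar>l - 2 * \<zeta> k \<omega>\<bar> \<le> l" for k \<omega>
      using scheme_z_range[of l v h "\<lambda>a. increment B h a \<omega>" "k * m"] l unfolding \<zeta>_def by linarith
    then have "\<bar>l - 2 * \<zeta> i \<omega>\<bar> * \<bar>l - 2 * \<zeta> j \<omega>\<bar> * \<bar>increment B (T / n) i \<omega>\<bar> \<le> l * l * \<bar>increment B (T / n) i \<omega>\<bar>" for \<omega>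
      using l by (intro mult_right_mono mult_mono) auto
    then show "AE \<omega> in M. norm (((l - 2 * \<zeta> i \<omega>) * increment B (T / n) i \<omega>) * (l - 2 * \<zeta> j \<omega>))
        \<le> norm (l * l * increment B (T / n) i \<omega>)"
      using l by (simp add: abs_mult mult_ac)
  qed
  from indep_var_lebesgue_integral[OF ind this] integrable_increment_power[OF bm hn, of j 1]
  show ?zero by (simp add: expectation_increment(1)[OF bm hn] mult.assoc)
qed

text \<open>
  Dominated convergence along the refinement; this expresses that \<open>Z\<close> does not anticipate \<open>B\<close>.
\<close>

lemma weighted_increments_orthogonal:
  fixes n :: nat
  assumes T: "T > 0" and n: "n > 0" and ij: "i < j" "j < n"
  shows "expectation (\<lambda>\<omega>. ((l - 2 * Z (real i * (T / n)) \<omega>) * increment B (T / n) i \<omega>) *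
      ((l - 2 * Z (real j * (T / n)) \<omega>) * increment B (T / n) j \<omega>)) = 0"
proof -
  define \<zeta> where "\<zeta> m k \<omega> = scheme_z l v (T / real (n * Suc m))
    (\<lambda>a. increment B (T / real (n * Suc m)) a \<omega>) (k * Suc m)" for m k \<omega>
  have hn: "T / real n > 0" using T n by simp
  have Z0: "0 \<le> real k * (T / real n)" for k using T by simp
  note zero = scheme_increments_orthogonal(1)[OF T n zero_less_Suc ij(1), folded \<zeta>_def]
  note \<zeta>_meas = scheme_increments_orthogonal(2)[OF T n zero_less_Suc ij(1), folded \<zeta>_def]
  have lim: "(\<lambda>m. expectation (\<lambda>\<omega>. ((l - 2 * \<zeta> m i \<omega>) * increment B (T / n) i \<omega>) *
      ((l - 2 * \<zeta> m j \<omega>) * increment B (T / n) j \<omega>))) \<longlonglongrightarrow>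
    expectation (\<lambda>\<omega>. ((l - 2 * Z (real i * (T / n)) \<omega>) * increment B (T / n) i \<omega>) *
      ((l - 2 * Z (real j * (T / n)) \<omega>) * increment B (T / n) j \<omega>))"
  proof (rule integral_dominated_convergence[where
        w="\<lambda>\<omega>. l * l * \<bar>increment B (T / n) i \<omega> * increment B (T / n) j \<omega>\<bar>"])
    show "(\<lambda>\<omega>. ((l - 2 * Z (real i * (T / n)) \<omega>) * increment B (T / n) i \<omega>) *
      ((l - 2 * Z (real j * (T / n)) \<omega>) * increment B (T / n) j \<omega>)) \<in> borel_measurable M"
      using integrable_weighted_increments[OF hn Z0 Z0] by (rule borel_measurable_integrable)
    show "(\<lambda>\<omega>. ((l - 2 * \<zeta> m i \<omega>) * increment B (T / n) i \<omega>) *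
      ((l - 2 * \<zeta> m j \<omega>) * increment B (T / n) j \<omega>)) \<in> borel_measurable M" for m
      using \<zeta>_meas[of m] measurable_increment[OF bm hn] by measurable
    show "integrable M (\<lambda>\<omega>. l * l * \<bar>increment B (T / n) i \<omega> * increment B (T / n) j \<omega>\<bar>)"
      by (intro integrable_mult_right integrable_abs integrable_increment_prod hn)
    show "AE \<omega> in M. (\<lambda>m. ((l - 2 * \<zeta> m i \<omega>) * increment B (T / n) i \<omega>) *
        ((l - 2 * \<zeta> m j \<omega>) * increment B (T / n) j \<omega>)) \<longlonglongrightarrow>
      ((l - 2 * Z (real i * (T / n)) \<omega>) * increment B (T / n) i \<omega>) *
        ((l - 2 * Z (real j * (T / n)) \<omega>) * increment B (T / n) j \<omega>)"
      using AE_good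
    proof eventually_elim
      case (elim \<omega>)
      then interpret inert_path l v "\<lambda>t. B t \<omega>" "\<lambda>t. Z t \<omega>" "\<lambda>t. V t \<omega>" "\<lambda>t. L0 t \<omega>" "\<lambda>t. Ll t \<omega>" .
      have "(\<lambda>m. \<zeta> m k \<omega>) \<longlonglongrightarrow> Z (real k * (T / n)) \<omega>" if "k \<le> n" for k
        using LIMSEQ_Suc[OF scheme_tendsto[OF T n that]] unfolding \<zeta>_def increment_def by simp
      then show ?case using ij by (intro tendsto_intros) auto
    qed
    have "\<bar>l - 2 * \<zeta> m k \<omega>\<bar> \<le> l" for m k \<omega>
      using scheme_z_range[of l v "T / real (n * Suc m)" "\<lambda>a. increment B (T / real (n * Suc m)) a \<omega>" "k * Suc m"] l
      unfolding \<zeta>_def by linarith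
    then have "\<bar>l - 2 * \<zeta> m i \<omega>\<bar> * \<bar>l - 2 * \<zeta> m j \<omega>\<bar> * \<bar>increment B (T / n) i \<omega> * increment B (T / n) j \<omega>\<bar>
        \<le> l * l * \<bar>increment B (T / n) i \<omega> * increment B (T / n) j \<omega>\<bar>" for m \<omega>
      using l by (intro mult_right_mono mult_mono) auto
    then show "AE \<omega> in M. norm (((l - 2 * \<zeta> m i \<omega>) * increment B (T / n) i \<omega>) *
      ((l - 2 * \<zeta> m j \<omega>) * increment B (T / n) j \<omega>)) \<le>
        l * l * \<bar>increment B (T / n) i \<omega> * increment B (T / n) j \<omega>\<bar>" for m
      by (simp add: abs_mult mult_ac)
  qed
  have "(\<lambda>m. 0) \<longlonglongrightarrow>
    expectation (\<lambda>\<omega>. ((l - 2 * Z (real i * (T / n)) \<omega>) * increment B (T / n) i \<omega>) *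
      ((l - 2 * Z (real j * (T / n)) \<omega>) * increment B (T / n) j \<omega>))"
    using lim unfolding zero .
  then show ?thesis using LIMSEQ_unique tendsto_const by blast
qed

lemma stochastic_sum_second_moment:
  fixes n :: nat
  assumes T: "T > 0" and n: "n > 0"
  defines "S \<equiv> \<lambda>\<omega>. \<Sum>i<n. (l - 2 * Z (real i * (T / n)) \<omega>) * increment B (T / n) i \<omega>"
  shows "integrable M (\<lambda>\<omega>. (S \<omega>)\<^sup>2) \<and> expectation (\<lambda>\<omega>. (S \<omega>)\<^sup>2) \<le> l\<^sup>2 * T"
    and "S \<in> borel_measurable M"
proof -
  have hn: "T / real n > 0" using T n by simp
  have Z0: "0 \<le> real k * (T / real n)" for k using T by simp
  have "integrable M (\<lambda>\<omega>. (S \<omega>)\<^sup>2) \<and> expectation (\<lambda>\<omega>. (S \<omega>)\<^sup>2) \<le> real n * (l\<^sup>2 * (T / n))"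
    unfolding S_def
  proof (rule orthogonal_sum_second_moment)
    fix i
    have "expectation (\<lambda>\<omega>. ((l - 2 * Z (real i * (T / n)) \<omega>) * increment B (T / n) i \<omega>) *
      ((l - 2 * Z (real i * (T / n)) \<omega>) * increment B (T / n) i \<omega>)) \<le>
      expectation (\<lambda>\<omega>. l\<^sup>2 * increment B (T / n) i \<omega> ^ 2)"
    proof (rule integral_mono_AE)
      show "integrable M (\<lambda>\<omega>. l\<^sup>2 * increment B (T / n) i \<omega> ^ 2)"
        by (intro integrable_mult_right integrable_increment_power[OF bm hn])
      show "AE \<omega> in M. ((l - 2 * Z (real i * (T / n)) \<omega>) * increment B (T / n) i \<omega>) *
        ((l - 2 * Z (real i * (T / n)) \<omega>) * increment B (T / n) i \<omega>) \<le> l\<^sup>2 * increment B (T / n) i \<omega> ^ 2"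
        using AE_weight_le
      proof eventually_elim
        case (elim \<omega>)
        then have "(l - 2 * Z (real i * (T / n)) \<omega>)\<^sup>2 \<le> l\<^sup>2"
          using Z0[of i] l by (simp add: abs_le_square_iff[symmetric])
        then have "(l - 2 * Z (real i * (T / n)) \<omega>)\<^sup>2 * increment B (T / n) i \<omega> ^ 2 \<le> l\<^sup>2 * increment B (T / n) i \<omega> ^ 2"
          by (intro mult_right_mono) auto
        then show ?case by (simp add: power2_eq_square mult_ac)
      qed
    qed (rule integrable_weighted_increments[OF hn Z0 Z0])
    then show "expectation (\<lambda>\<omega>. ((l - 2 * Z (real i * (T / n)) \<omega>) * increment B (T / n) i \<omega>) *
      ((l - 2 * Z (real i * (T / n)) \<omega>) * increment B (T / n) i \<omega>)) \<le> l\<^sup>2 * (T / n)"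
      by (simp add: expectation_increment(2)[OF bm hn])
  qed (use integrable_weighted_increments[OF hn Z0 Z0] weighted_increments_orthogonal[OF T n] in auto)
  then show "integrable M (\<lambda>\<omega>. (S \<omega>)\<^sup>2) \<and> expectation (\<lambda>\<omega>. (S \<omega>)\<^sup>2) \<le> l\<^sup>2 * T"
    using n by simp
  show "S \<in> borel_measurable M"
    unfolding S_def using meas(1)[OF Z0] measurable_increment[OF bm hn] by measurable
qed

text \<open>
  For every partition, \<open>l L(T) - T\<close> is the sum of a remainder, the error of the quadratic variation and a
  martingale sum.  As the mesh tends to zero, the first is pathwise eventually below \<open>\<eta> / 3\<close> off \<open>D\<close> and the
  second vanishes in mean square, while the third has second moment at most \<open>l\<^sup>2 T\<close> for every mesh.
\<close>

lemma local_time_tail: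
  assumes T: "T > 0" and \<eta>: "\<eta> > 0" and D[measurable]: "D \<in> sets M"
    and V_bound: "AE \<omega> in M. \<omega> \<notin> D \<longrightarrow> (\<forall>r. 0 \<le> r \<longrightarrow> r \<le> T \<longrightarrow> \<bar>V r \<omega>\<bar> \<le> c)"
    and small: "l\<^sup>2 + l * c * T < \<eta> / 3"
  shows "prob {\<omega> \<in> space M. \<bar>l * (L0 T \<omega> + Ll T \<omega>) - T\<bar> \<ge> \<eta>} \<le> prob D + 9 * l\<^sup>2 * T / \<eta>\<^sup>2"
proof -
  define Q where "Q n \<omega> = (\<Sum>i<n. (increment B (T / n) i \<omega>)\<^sup>2)" for n \<omega>
  define S where "S n \<omega> = (\<Sum>i<n. (l - 2 * Z (real i * (T / n)) \<omega>) * increment B (T / n) i \<omega>)" for n \<omega>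
  define R where "R n \<omega> = l * (L0 T \<omega> + Ll T \<omega>) - Q n \<omega> + S n \<omega>" for n \<omega>
  have [measurable]: "L0 T \<in> borel_measurable M" "Ll T \<in> borel_measurable M"
    using T by (auto intro: meas)
  have hn: "T / real (Suc n) > 0" for n using T by simp
  have [measurable]: "S (Suc n) \<in> borel_measurable M" for n
    unfolding S_def[abs_def] by (rule stochastic_sum_second_moment(2)[OF T zero_less_Suc])
  have [measurable]: "Q (Suc n) \<in> borel_measurable M" for n
    unfolding Q_def[abs_def] using measurable_increment[OF bm hn] by measurable
  have [measurable]: "R (Suc n) \<in> borel_measurable M" for n
    unfolding R_def[abs_def] by measurable
  \<comment> \<open>The pathwise remainder is eventually below \<open>\<eta> / 3\<close> off \<open>D\<close>, though not uniformly in the path.\<close>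
  define E where "E n = {\<omega> \<in> space M. \<omega> \<notin> D \<and> \<bar>R (Suc n) \<omega>\<bar> \<ge> \<eta> / 3}" for n
  have E[measurable]: "E n \<in> sets M" for n unfolding E_def by measurable
  have lim_E: "(\<lambda>n. prob (E n)) \<longlonglongrightarrow> 0"
  proof -
    have "(\<lambda>n. \<integral>\<omega>. indicator (E n) \<omega> \<partial>M) \<longlonglongrightarrow> ((\<integral>\<omega>. 0 \<partial>M) :: real)"
    proof (rule integral_dominated_convergence[where w="\<lambda>_. 1"])
      show "AE \<omega> in M. (\<lambda>n. indicator (E n) \<omega>) \<longlonglongrightarrow> (0 :: real)"
        using AE_good V_bound
      proof eventually_elim
        case (elim \<omega>)
        interpret inert_path l v "\<lambda>t. B t \<omega>" "\<lambda>t. Z t \<omega>" "\<lambda>t. V t \<omega>" "\<lambda>t. L0 t \<omega>" "\<lambda>t. Ll t \<omega>"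
          by (rule elim(1))
        show ?case
        proof (cases "\<omega> \<in> D")
          case True
          then show ?thesis by (simp add: E_def)
        next
          case False
          define \<epsilon> where "\<epsilon> = (\<eta> / 3 - (l\<^sup>2 + l * c * T)) / 2"
          have \<epsilon>: "\<epsilon> > 0" using small by (simp add: \<epsilon>_def)
          have "\<forall>\<^sub>F n in sequentially. \<bar>R n \<omega>\<bar> \<le> l\<^sup>2 + l * c * T + \<epsilon>"
            using occupation_limit[OF T _ \<epsilon>, of c] elim(2) False
            by (simp add: R_def Q_def S_def increment_def)
          then have "\<forall>\<^sub>F n in sequentially. \<bar>R (Suc n) \<omega>\<bar> \<le> l\<^sup>2 + l * c * T + \<epsilon>"
            by (rule eventually_sequentially_Suc[THEN iffD2])
          moreover have "l\<^sup>2 + l * c * T + \<epsilon> < \<eta> / 3" using small by (simp add: \<epsilon>_def field_simps)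
          ultimately have "\<forall>\<^sub>F n in sequentially. indicator (E n) \<omega> = (0 :: real)"
            by (auto elim!: eventually_mono simp: E_def)
          then show ?thesis by (rule tendsto_eventually)
        qed
      qed
    qed auto
    then show ?thesis by simp
  qed
  have bound: "prob {\<omega> \<in> space M. \<bar>l * (L0 T \<omega> + Ll T \<omega>) - T\<bar> \<ge> \<eta>} \<le>
      prob D + prob (E n) + 9 * l\<^sup>2 * T / \<eta>\<^sup>2 + 18 * T\<^sup>2 / \<eta>\<^sup>2 * (1 / real (Suc n))" for n
  proof -
    let ?SE = "{\<omega> \<in> space M. \<bar>S (Suc n) \<omega>\<bar> \<ge> \<eta> / 3}"
    let ?QE = "{\<omega> \<in> space M. \<bar>Q (Suc n) \<omega> - T\<bar> \<ge> \<eta> / 3}"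
    have "prob {\<omega> \<in> space M. \<bar>l * (L0 T \<omega> + Ll T \<omega>) - T\<bar> \<ge> \<eta>} \<le> prob (D \<union> E n \<union> ?SE \<union> ?QE)"
    proof (rule finite_measure_mono)
      show "{\<omega> \<in> space M. \<bar>l * (L0 T \<omega> + Ll T \<omega>) - T\<bar> \<ge> \<eta>} \<subseteq> D \<union> E n \<union> ?SE \<union> ?QE"
      proof
        fix \<omega> assume \<omega>: "\<omega> \<in> {\<omega> \<in> space M. \<bar>l * (L0 T \<omega> + Ll T \<omega>) - T\<bar> \<ge> \<eta>}"
        have eq: "l * (L0 T \<omega> + Ll T \<omega>) - T = R (Suc n) \<omega> - S (Suc n) \<omega> + (Q (Suc n) \<omega> - T)"
          by (simp add: R_def)
        have "\<bar>R (Suc n) \<omega>\<bar> \<ge> \<eta> / 3 \<or> \<bar>S (Suc n) \<omega>\<bar> \<ge> \<eta> / 3 \<or> \<bar>Q (Suc n) \<omega> - T\<bar> \<ge> \<eta> / 3"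
        proof -
          have "\<eta> \<le> \<bar>l * (L0 T \<omega> + Ll T \<omega>) - T\<bar>" using \<omega> by simp
          then show ?thesis using eq by linarith
        qed
        then show "\<omega> \<in> D \<union> E n \<union> ?SE \<union> ?QE" using \<omega> by (auto simp: E_def)
      qed
    qed measurable
    also have "\<dots> \<le> prob D + prob (E n) + prob ?SE + prob ?QE"
    proof -
      have "prob (D \<union> E n \<union> ?SE \<union> ?QE) \<le> prob (D \<union> E n \<union> ?SE) + prob ?QE"
        by (rule measure_Un_le) measurable
      moreover have "prob (D \<union> E n \<union> ?SE) \<le> prob (D \<union> E n) + prob ?SE"
        by (rule measure_Un_le) measurable
      moreover have "prob (D \<union> E n) \<le> prob D + prob (E n)"
        by (rule measure_Un_le) measurable
      ultimately show ?thesis by linarith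
    qed
    also have "prob ?SE \<le> l\<^sup>2 * T / (\<eta> / 3)\<^sup>2"
      using stochastic_sum_second_moment[OF T zero_less_Suc, of n, folded S_def] \<eta>
      by (intro second_moment_tail) auto
    also have "prob ?QE \<le> real (Suc n) * (2 * (T / real (Suc n))\<^sup>2) / (\<eta> / 3)\<^sup>2"
    proof (rule second_moment_tail)
      show "(\<lambda>\<omega>. Q (Suc n) \<omega> - T) \<in> borel_measurable M" by measurable
    qed (use quadratic_variation_second_moment[OF bm hn[of n], of "Suc n"] \<eta> in
        \<open>auto simp: Q_def simp del: of_nat_Suc sum.lessThan_Suc\<close>)
    also have "real (Suc n) * (2 * (T / real (Suc n))\<^sup>2) / (\<eta> / 3)\<^sup>2 = 18 * T\<^sup>2 / \<eta>\<^sup>2 * (1 / real (Suc n))"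
      using \<eta> by (simp add: power2_eq_square field_simps del: of_nat_Suc)
    also have "l\<^sup>2 * T / (\<eta> / 3)\<^sup>2 = 9 * l\<^sup>2 * T / \<eta>\<^sup>2" by (simp add: power2_eq_square)
    finally show ?thesis by simp
  qed
  have "(\<lambda>n. 1 / real (Suc n)) \<longlonglongrightarrow> 0" by real_asymp
  then have "(\<lambda>n. prob D + prob (E n) + 9 * l\<^sup>2 * T / \<eta>\<^sup>2 + 18 * T\<^sup>2 / \<eta>\<^sup>2 * (1 / real (Suc n))) \<longlonglongrightarrow>
      prob D + 0 + 9 * l\<^sup>2 * T / \<eta>\<^sup>2 + 18 * T\<^sup>2 / \<eta>\<^sup>2 * 0"
    by (intro tendsto_intros lim_E)
  then have "prob {\<omega> \<in> space M. \<bar>l * (L0 T \<omega> + Ll T \<omega>) - T\<bar> \<ge> \<eta>} \<le>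
      prob D + 0 + 9 * l\<^sup>2 * T / \<eta>\<^sup>2 + 18 * T\<^sup>2 / \<eta>\<^sup>2 * 0"
    using bound by (intro LIMSEQ_le_const) auto
  then show ?thesis by simp
qed

end

section \<open>Convergence to the Ornstein--Uhlenbeck process\<close>

definition big_paths :: "real \<Rightarrow> real \<Rightarrow> cpath set" where
  "big_paths T c = {x. \<exists>t\<in>{0..T}. \<bar>path_at x t\<bar> > c}"

definition rough_paths :: "real \<Rightarrow> real \<Rightarrow> real \<Rightarrow> cpath set" where
  "rough_paths T d e = {x. \<exists>s\<in>{0..T}. \<exists>t\<in>{0..T}. \<bar>s - t\<bar> \<le> d \<and> \<bar>path_at x s - path_at x t\<bar> > e}"

lemma open_big_paths: "open (big_paths T c)"
proof -
  have "open (\<Union>t\<in>{0..T}. {x. c < \<bar>path_at x t\<bar>})"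
    by (intro open_UN ballI open_Collect_less continuous_intros continuous_on_path_at) auto
  also have "(\<Union>t\<in>{0..T}. {x. c < \<bar>path_at x t\<bar>}) = big_paths T c"
    by (auto simp: big_paths_def)
  finally show ?thesis .
qed

lemma open_rough_paths: "open (rough_paths T d e)"
proof -
  have "open (\<Union>s\<in>{0..T}. \<Union>t\<in>{0..T} \<inter> {t. \<bar>s - t\<bar> \<le> d}. {x. e < \<bar>path_at x s - path_at x t\<bar>})"
    by (intro open_UN ballI open_Collect_less continuous_intros continuous_on_path_at) auto
  also have "(\<Union>s\<in>{0..T}. \<Union>t\<in>{0..T} \<inter> {t. \<bar>s - t\<bar> \<le> d}. {x. e < \<bar>path_at x s - path_at x t\<bar>})
      = rough_paths T d e"
    unfolding rough_paths_def by blast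
  finally show ?thesis .
qed

lemma decreasing_open_sets_small:
  fixes \<nu> :: "'a :: topological_space measure"
  assumes "prob_space \<nu>" "sets \<nu> = sets borel" "\<And>n. open (A n)" "decseq A" "\<And>x. \<exists>n. x \<notin> A n" "\<rho> > 0"
  shows "\<exists>n :: nat. measure \<nu> (A n) < \<rho>"
proof -
  interpret prob_space \<nu> by fact
  have "(\<lambda>n. measure \<nu> (A n)) \<longlonglongrightarrow> measure \<nu> (\<Inter>n. A n)"
    using assms by (intro finite_Lim_measure_decseq) auto
  also have "(\<Inter>n. A n) = {}" using assms(5) by blast
  finally have "(\<lambda>n. measure \<nu> (A n)) \<longlonglongrightarrow> 0" by simp
  then have "\<forall>\<^sub>F n in sequentially. measure \<nu> (A n) < \<rho>"
    using \<open>\<rho> > 0\<close> by (intro order_tendstoD) auto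
  then show ?thesis by (auto simp: eventually_sequentially)
qed

lemma big_paths_small:
  assumes "prob_space \<nu>" "sets \<nu> = sets borel" "\<rho> > 0"
  shows "\<exists>c\<ge>0. measure \<nu> (big_paths T c) < \<rho>"
proof -
  have "\<exists>n. measure \<nu> (big_paths T (real n)) < \<rho>"
  proof (rule decreasing_open_sets_small[OF assms(1,2) _ _ _ assms(3)])
    show "decseq (\<lambda>n. big_paths T (real n))"
      by (rule decseq_SucI) (force simp: big_paths_def)
    show "\<exists>n. x \<notin> big_paths T (real n)" for x
    proof -
      have "bounded (path_at x ` {0..T})"
        by (intro compact_imp_bounded compact_continuous_image continuous_on_subset[OF path_at_continuous]) auto
      then obtain C where C: "\<And>t. t \<in> {0..T} \<Longrightarrow> \<bar>path_at x t\<bar> \<le> C"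
        unfolding bounded_iff by (metis imageI real_norm_def)
      obtain n :: nat where "C \<le> real n" using real_arch_simple by blast
      then have "x \<notin> big_paths T (real n)" using C by (force simp: big_paths_def)
      then show ?thesis ..
    qed
  qed (rule open_big_paths)
  then show ?thesis using of_nat_0_le_iff by blast
qed

lemma rough_paths_small:
  assumes "prob_space \<nu>" "sets \<nu> = sets borel" "\<rho> > 0" "e > 0"
  shows "\<exists>d>0. measure \<nu> (rough_paths T d e) < \<rho>"
proof -
  have "\<exists>n. measure \<nu> (rough_paths T (1 / real (Suc n)) e) < \<rho>"
  proof (rule decreasing_open_sets_small[OF assms(1,2) _ _ _ assms(3)])
    show "decseq (\<lambda>n. rough_paths T (1 / real (Suc n)) e)"
    proof (rule decseq_SucI, rule subsetI)
      fix n x assume "x \<in> rough_paths T (1 / real (Suc (Suc n))) e"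
      then obtain s t where st: "s \<in> {0..T}" "t \<in> {0..T}" "\<bar>s - t\<bar> \<le> 1 / real (Suc (Suc n))"
        "\<bar>path_at x s - path_at x t\<bar> > e" by (auto simp: rough_paths_def)
      have "1 / real (Suc (Suc n)) \<le> 1 / real (Suc n)" by (simp add: frac_le)
      then have "\<bar>s - t\<bar> \<le> 1 / real (Suc n)" using st(3) by linarith
      then show "x \<in> rough_paths T (1 / real (Suc n)) e" using st unfolding rough_paths_def by blast
    qed
    show "\<exists>n. x \<notin> rough_paths T (1 / real (Suc n)) e" for x
    proof -
      obtain d where d: "d > 0" "\<forall>r s. 0 \<le> r \<longrightarrow> r \<le> T \<longrightarrow> 0 \<le> s \<longrightarrow> s \<le> T \<longrightarrow> \<bar>r - s\<bar> \<le> d \<longrightarrow>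
          \<bar>path_at x r - path_at x s\<bar> \<le> e"
        using oscillation_le[OF path_at_continuous[of x] assms(4), of T] by blast
      obtain n where "1 / real (Suc n) < d" using d(1) nat_approx_posE by blast
      then have "x \<notin> rough_paths T (1 / real (Suc n)) e"
        using d(2) unfolding rough_paths_def by (fastforce simp: not_less)
      then show ?thesis ..
    qed
  qed (rule open_rough_paths)
  then show ?thesis by (metis of_nat_0_less_iff zero_less_Suc zero_less_divide_1_iff)
qed

context inert_process
begin

lemma drift_close_to_relaxed_path:
  assumes W: "path_version M (\<lambda>t \<omega>. - B t \<omega>) W"
  shows "AE \<omega> in M. \<forall>t\<ge>0. \<bar>V t \<omega> - path_at (relax_path v (W \<omega>)) t\<bar> \<le> l"
proof -
  have "AE \<omega> in M. \<forall>t\<ge>0. path_at (W \<omega>) t = - B t \<omega>" using W by (simp add: path_version_def)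
  with AE_good show ?thesis
  proof eventually_elim
    case (elim \<omega>)
    then interpret inert_path l v "\<lambda>t. B t \<omega>" "\<lambda>t. Z t \<omega>" "\<lambda>t. V t \<omega>" "\<lambda>t. L0 t \<omega>" "\<lambda>t. Ll t \<omega>" by simp
    show ?case
    proof (intro allI impI)
      fix t :: real assume t: "t \<ge> 0"
      have "relax (\<lambda>s. v + path_at (W \<omega>) s) t = relax (\<lambda>s. v + - B s \<omega>) t"
        unfolding relax_def using elim(2) t
        by (auto intro!: Henstock_Kurzweil_Integration.integral_cong)
      then show "\<bar>V t \<omega> - path_at (relax_path v (W \<omega>)) t\<bar> \<le> l"
        using V_close_to_relax[OF t] by (simp add: path_at_relax_path[OF t])
    qed
  qed
qed

text \<open>
  The exceptional event consists of a large modulus of continuity of the Ornstein--Uhlenbeck path and of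
  deviations of the local time at the grid points \<open>k * \<eta>\<close>.  Its probability is bounded through the law
  \<open>\<nu>\<close>, which is the same for every \<open>l\<close>.
\<close>

lemma time_changed_drift_close:
  assumes P: "path_version M (\<lambda>t. time_changed_drift V L0 Ll (t / l)) P"
    and W: "path_version M (\<lambda>t \<omega>. - B t \<omega>) W"
    and pos: "\<eta> > 0" "e > 0" and K: "T + 2 * \<eta> \<le> real K * \<eta>"
    and small: "l\<^sup>2 + l * (c + l) * (real K * \<eta>) < \<eta> / 3" and c: "c \<ge> 0"
  defines "\<nu> \<equiv> distr M borel (\<lambda>\<omega>. relax_path v (W \<omega>))"
  shows "\<exists>E\<in>sets M. prob E \<le> measure \<nu> (rough_paths (T + 2 * \<eta>) (2 * \<eta>) e)
      + real K * (measure \<nu> (big_paths (real K * \<eta>) c) + 9 * l\<^sup>2 * (real K * \<eta>) / \<eta>\<^sup>2) \<and>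
    (AE \<omega> in M. \<omega> \<notin> E \<longrightarrow>
      (\<forall>t\<in>{0..T}. \<bar>path_at (P \<omega>) t - path_at (relax_path v (W \<omega>)) t\<bar> \<le> l + e))"
proof -
  define Q where "Q \<omega> = relax_path v (W \<omega>)" for \<omega>
  have Q[measurable]: "Q \<in> borel_measurable M"
    unfolding Q_def using W by (auto simp: path_version_def intro: measurable_compose[OF _ measurable_relax_path])
  note [measurable] = borel_open[OF open_rough_paths] borel_open[OF open_big_paths]
  define R where "R = Q -` rough_paths (T + 2 * \<eta>) (2 * \<eta>) e \<inter> space M"
  define D where "D = Q -` big_paths (real K * \<eta>) c \<inter> space M"
  define A where "A k = {\<omega> \<in> space M. \<bar>l * (L0 (real k * \<eta>) \<omega> + Ll (real k * \<eta>) \<omega>) - real k * \<eta>\<bar> \<ge> \<eta>}" for k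
  have [measurable]: "R \<in> sets M" "D \<in> sets M" unfolding R_def D_def by measurable
  have [measurable]: "L0 (real k * \<eta>) \<in> borel_measurable M" "Ll (real k * \<eta>) \<in> borel_measurable M" for k
    using pos by (auto intro: meas)
  have A[measurable]: "A k \<in> sets M" for k unfolding A_def by measurable
  have probR: "prob R = measure \<nu> (rough_paths (T + 2 * \<eta>) (2 * \<eta>) e)"
    and probD: "prob D = measure \<nu> (big_paths (real K * \<eta>) c)"
    unfolding \<nu>_def R_def D_def Q_def[symmetric] by (simp_all add: measure_distr)
  have V_close: "AE \<omega> in M. \<forall>t\<ge>0. \<bar>V t \<omega> - path_at (Q \<omega>) t\<bar> \<le> l"
    using drift_close_to_relaxed_path[OF W] by (simp add: Q_def)
  have probA: "prob (A k) \<le> prob D + 9 * l\<^sup>2 * (real K * \<eta>) / \<eta>\<^sup>2" if k: "k \<in> {1..K}" for k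
  proof -
    have kK: "real k * \<eta> \<le> real K * \<eta>" using k pos by (intro mult_right_mono) auto
    have kpos: "real k * \<eta> > 0" using k pos by simp
    have "prob (A k) \<le> prob D + 9 * l\<^sup>2 * (real k * \<eta>) / \<eta>\<^sup>2"
      unfolding A_def
    proof (rule local_time_tail[where c="c + l"])
      show "AE \<omega> in M. \<omega> \<notin> D \<longrightarrow> (\<forall>r. 0 \<le> r \<longrightarrow> r \<le> real k * \<eta> \<longrightarrow> \<bar>V r \<omega>\<bar> \<le> c + l)"
        using V_close AE_space
      proof eventually_elim
        case (elim \<omega>)
        show ?case
        proof (intro impI allI)
          fix r assume \<omega>: "\<omega> \<notin> D" and r: "0 \<le> r" "r \<le> real k * \<eta>"
          have "\<bar>path_at (Q \<omega>) r\<bar> \<le> c"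
            using \<omega> r kK elim(2) by (force simp: D_def big_paths_def not_less)
          moreover have "\<bar>V r \<omega> - path_at (Q \<omega>) r\<bar> \<le> l" using elim(1) r by simp
          ultimately show "\<bar>V r \<omega>\<bar> \<le> c + l" by linarith
        qed
      qed
      have "l * (c + l) * (real k * \<eta>) \<le> l * (c + l) * (real K * \<eta>)"
        using kK l c by (intro mult_left_mono) auto
      then show "l\<^sup>2 + l * (c + l) * (real k * \<eta>) < \<eta> / 3" using small by linarith
    qed (use kpos pos in auto)
    also have "9 * l\<^sup>2 * (real k * \<eta>) / \<eta>\<^sup>2 \<le> 9 * l\<^sup>2 * (real K * \<eta>) / \<eta>\<^sup>2"
      using kK by (intro divide_right_mono mult_left_mono) auto
    finally show ?thesis by simp
  qed
  show ?thesis
  proof (intro bexI[of _ "R \<union> (\<Union>k\<in>{1..K}. A k)"] conjI)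
    have "prob (R \<union> (\<Union>k\<in>{1..K}. A k)) \<le> prob R + prob (\<Union>k\<in>{1..K}. A k)"
      by (rule measure_Un_le) auto
    also have "prob (\<Union>k\<in>{1..K}. A k) \<le> (\<Sum>k\<in>{1..K}. prob (A k))"
      by (rule measure_UNION_le) auto
    also have "\<dots> \<le> real (card {1..K}) * (prob D + 9 * l\<^sup>2 * (real K * \<eta>) / \<eta>\<^sup>2)"
      by (rule sum_bounded_above) (rule probA)
    finally show "prob (R \<union> (\<Union>k\<in>{1..K}. A k)) \<le> measure \<nu> (rough_paths (T + 2 * \<eta>) (2 * \<eta>) e)
      + real K * (measure \<nu> (big_paths (real K * \<eta>) c) + 9 * l\<^sup>2 * (real K * \<eta>) / \<eta>\<^sup>2)"
      by (simp add: probR probD)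
  next
    have "AE \<omega> in M. \<forall>t\<ge>0. path_at (P \<omega>) t = time_changed_drift V L0 Ll (t / l) \<omega>"
      using P by (simp add: path_version_def)
    with AE_good AE_unbounded V_close AE_space
    show "AE \<omega> in M. \<omega> \<notin> R \<union> (\<Union>k\<in>{1..K}. A k) \<longrightarrow>
      (\<forall>t\<in>{0..T}. \<bar>path_at (P \<omega>) t - path_at (relax_path v (W \<omega>)) t\<bar> \<le> l + e)"
    proof eventually_elim
      case (elim \<omega>)
      interpret inert_path l v "\<lambda>t. B t \<omega>" "\<lambda>t. Z t \<omega>" "\<lambda>t. V t \<omega>" "\<lambda>t. L0 t \<omega>" "\<lambda>t. Ll t \<omega>"
        by (rule elim(1))
      show ?case
      proof (intro impI ballI)
        fix t assume E: "\<omega> \<notin> R \<union> (\<Union>k\<in>{1..K}. A k)" and t: "t \<in> {0..T}"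
        define s where "s = right_inverse (\<lambda>t. L0 t \<omega> + Ll t \<omega>) (t / l)"
        have unb: "\<exists>t\<ge>0. L0 t \<omega> + Ll t \<omega> > C" for C using elim(2) by blast
        have s0: "s \<ge> 0" using L_right_inverse[OF unb, of "t / l"] t l by (auto simp: s_def)
        have st: "\<bar>s - t\<bar> \<le> 2 * \<eta>"
          unfolding s_def
        proof (rule right_inverse_close[OF unb pos(1)])
          fix k assume k: "k \<le> K"
          show "\<bar>l * (L0 (real k * \<eta>) \<omega> + Ll (real k * \<eta>) \<omega>) - real k * \<eta>\<bar> < \<eta>"
          proof (cases "k = 0")
            case True
            then show ?thesis using pos L0_0 Ll_0 by simp
          next
            case False
            then have "k \<in> {1..K}" using k by simp
            then have "\<omega> \<notin> A k" using E by blast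
            then show ?thesis using elim(4) by (simp add: A_def)
          qed
        qed (use t K in auto)
        have "\<bar>path_at (Q \<omega>) s - path_at (Q \<omega>) t\<bar> \<le> e"
        proof -
          have "Q \<omega> \<notin> rough_paths (T + 2 * \<eta>) (2 * \<eta>) e" using E elim(4) by (auto simp: R_def)
          moreover have "s \<in> {0..T + 2 * \<eta>}" "t \<in> {0..T + 2 * \<eta>}" using s0 st t pos by auto
          ultimately show ?thesis using st unfolding rough_paths_def by (auto simp: not_less)
        qed
        moreover have "\<bar>V s \<omega> - path_at (Q \<omega>) s\<bar> \<le> l" using elim(3) s0 by blast
        moreover have "path_at (P \<omega>) t = V s \<omega>"
          using elim(5) t by (simp add: time_changed_drift_def s_def)
        ultimately show "\<bar>path_at (P \<omega>) t - path_at (relax_path v (W \<omega>)) t\<bar> \<le> l + e"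
          unfolding Q_def by linarith
      qed
    qed
  qed auto
qed

end

text \<open>
  The equation determines \<open>X\<close> as a continuous functional of its noise, which reduces uniqueness in law
  to that of Brownian motion.
\<close>

lemma ornstein_uhlenbeck_path_version:
  assumes ou: "ornstein_uhlenbeck N v W X" and W: "path_version N W PW"
  shows "path_version N X (\<lambda>\<omega>. relax_path v (PW \<omega>))"
  unfolding path_version_def
proof
  have bm: "standard_brownian_motion N W" using ou by (simp add: ornstein_uhlenbeck_def)
  show "(\<lambda>\<omega>. relax_path v (PW \<omega>)) \<in> borel_measurable N"
    using W by (auto simp: path_version_def intro: measurable_compose[OF _ measurable_relax_path])
  have "AE \<omega> in N. \<forall>t\<ge>0. path_at (PW \<omega>) t = W t \<omega>" using W by (simp add: path_version_def)
  moreover have "AE \<omega> in N. continuous_on {0..} (\<lambda>t. X t \<omega>) \<and> X 0 \<omega> = v \<and>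
      (\<forall>t\<ge>0. X t \<omega> = v + W t \<omega> - integral {0..t} (\<lambda>s. X s \<omega>))"
    using ou by (simp add: ornstein_uhlenbeck_def)
  ultimately show "AE \<omega> in N. \<forall>t\<ge>0. path_at (relax_path v (PW \<omega>)) t = X t \<omega>"
  proof eventually_elim
    case (elim \<omega>)
    show ?case
    proof (intro allI impI)
      fix t :: real assume t: "t \<ge> 0"
      have "X t \<omega> = relax (\<lambda>s. v + path_at (PW \<omega>) s) t"
        by (rule relax_unique[OF _ _ _ t])
          (use elim in \<open>auto intro!: continuous_intros path_at_continuous\<close>)
      then show "path_at (relax_path v (PW \<omega>)) t = X t \<omega>" by (simp add: path_at_relax_path[OF t])
    qed
  qed
qed

lemma relaxed_brownian_law:
  assumes B: "standard_brownian_motion M B" "path_version M B P"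
    and W: "standard_brownian_motion N W" "path_version N W Q"
  shows "distr M borel (\<lambda>\<omega>. relax_path v (P \<omega>)) = distr N borel (\<lambda>\<omega>. relax_path v (Q \<omega>))"
proof -
  have "P \<in> borel_measurable M" "Q \<in> borel_measurable N" using B(2) W(2) by (auto simp: path_version_def)
  then have "distr M borel (\<lambda>\<omega>. relax_path v (P \<omega>)) = distr (distr M borel P) borel (relax_path v)"
    "distr N borel (\<lambda>\<omega>. relax_path v (Q \<omega>)) = distr (distr N borel Q) borel (relax_path v)"
    by (simp_all add: distr_distr[OF measurable_relax_path] comp_def)
  then show ?thesis using brownian_path_law_unique[OF B W] by simp
qed

theorem theorem3p12:
  fixes v :: real
    and M :: "real \<Rightarrow> 'a measure"
    and B Z V L\<^sub>0 L\<^sub>l :: "real \<Rightarrow> real \<Rightarrow> 'a \<Rightarrow> real"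
    and N :: "'b measure"
    and W X :: "real \<Rightarrow> 'b \<Rightarrow> real"
  assumes "\<And>l. l > 0 \<Longrightarrow> reflected_bm_inert_drift (M l) l v (B l) (Z l) (V l) (L\<^sub>0 l) (L\<^sub>l l)"
    and "ornstein_uhlenbeck N v W X"
  shows "processes_converge_weakly (at_right 0)
           M (\<lambda>l t. time_changed_drift (V l) (L\<^sub>0 l) (L\<^sub>l l) (t / l)) N X"
proof -
  have proc: "inert_process (M l) l v (B l) (Z l) (V l) (L\<^sub>0 l) (L\<^sub>l l)" if "l > 0" for l
    using assms(1)[OF that] that by (simp add: inert_process_def)
  have W: "standard_brownian_motion N W" using assms(2) by (simp add: ornstein_uhlenbeck_def)
  then obtain PW where PW: "path_version N W PW"
    using path_version_exists[of W N] standard_brownian_motionD[OF W] by blast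
  define \<nu> where "\<nu> = distr N borel (\<lambda>\<omega>. relax_path v (PW \<omega>))"
  have Q: "path_version N X (\<lambda>\<omega>. relax_path v (PW \<omega>))"
    by (rule ornstein_uhlenbeck_path_version[OF assms(2) PW])
  have \<nu>: "prob_space \<nu>" "sets \<nu> = sets borel"
    using Q standard_brownian_motionD(1)[OF W]
    by (auto simp: \<nu>_def path_version_def intro: prob_space.prob_space_distr)
  have "\<exists>P. path_version (M l) (\<lambda>t. time_changed_drift (V l) (L\<^sub>0 l) (L\<^sub>l l) (t / l)) P" if "l > 0" for l
    by (rule inert_process.time_changed_drift_path_version[OF proc[OF that]])
  then obtain P where P: "path_version (M l) (\<lambda>t. time_changed_drift (V l) (L\<^sub>0 l) (L\<^sub>l l) (t / l)) (P l)"
    if "l > 0" for l by metis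
  have bm: "standard_brownian_motion (M l) (\<lambda>t \<omega>. - B l t \<omega>)" if "l > 0" for l
    by (rule standard_brownian_motion_uminus[OF inert_process.bm[OF proc[OF that]]])
  have "\<exists>R. path_version (M l) (\<lambda>t \<omega>. - B l t \<omega>) R" if "l > 0" for l
    using path_version_exists[of "\<lambda>t \<omega>. - B l t \<omega>" "M l"] standard_brownian_motionD[OF bm[OF that]] by blast
  then obtain R where R: "path_version (M l) (\<lambda>t \<omega>. - B l t \<omega>) (R l)" if "l > 0" for l by metis
  have law: "distr (M l) borel (\<lambda>\<omega>. relax_path v (R l \<omega>)) = \<nu>" if "l > 0" for l
    unfolding \<nu>_def by (rule relaxed_brownian_law[OF bm[OF that] R[OF that] W PW])
  have pos: "\<forall>\<^sub>F l in at_right 0. l > (0 :: real)" by (rule eventually_at_right_less)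
  have "weakly_converges (at_right 0) (\<lambda>l. distr (M l) borel (P l)) \<nu>"
  proof (rule weakly_converges_of_close[OF \<nu>, where Q="\<lambda>l \<omega>. relax_path v (R l \<omega>)"])
    show "\<forall>\<^sub>F l in at_right 0. prob_space (M l) \<and> P l \<in> borel_measurable (M l) \<and>
      (\<lambda>\<omega>. relax_path v (R l \<omega>)) \<in> borel_measurable (M l) \<and> distr (M l) borel (\<lambda>\<omega>. relax_path v (R l \<omega>)) = \<nu>"
      using pos
    proof eventually_elim
      case (elim l)
      then show ?case
        using P[OF elim] R[OF elim] law[OF elim] standard_brownian_motionD(1)[OF bm[OF elim]]
        by (auto simp: path_version_def intro: measurable_compose[OF _ measurable_relax_path])
    qed
  next
    fix \<epsilon> \<delta> :: real assume \<epsilon>: "\<epsilon> > 0" and \<delta>: "\<delta> > 0"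
    \<comment> \<open>Uniform distance \<open>\<epsilon> / 2\<close> up to time \<open>2 / \<epsilon>\<close> means distance at most \<open>\<epsilon> / 2\<close> in the metric.\<close>
    define T where "T = 2 / \<epsilon>"
    define e where "e = \<epsilon> / 4"
    have e: "e > 0" "T > 0" using \<epsilon> by (auto simp: e_def T_def)
    obtain d where d: "d > 0" "measure \<nu> (rough_paths (T + 1) d e) < \<delta> / 3"
      using rough_paths_small[OF \<nu>, of "\<delta> / 3" e "T + 1"] \<delta> e by auto
    define \<eta> where "\<eta> = min d 1 / 2"
    have \<eta>: "\<eta> > 0" "2 * \<eta> \<le> d" "2 * \<eta> \<le> 1" using d(1) by (auto simp: \<eta>_def)
    obtain K :: nat where "(T + 2 * \<eta>) / \<eta> \<le> real K" using real_arch_simple by blast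
    then have K: "T + 2 * \<eta> \<le> real K * \<eta>" using \<eta>(1) by (simp add: pos_divide_le_eq)
    have K0: "K > 0" using K e \<eta> by (cases K) auto
    obtain c where c: "c \<ge> 0" "measure \<nu> (big_paths (real K * \<eta>) c) < \<delta> / (3 * real K)"
      using big_paths_small[OF \<nu>, of "\<delta> / (3 * real K)" "real K * \<eta>"] \<delta> K0 by auto
    have rough: "measure \<nu> (rough_paths (T + 2 * \<eta>) (2 * \<eta>) e) < \<delta> / 3"
    proof -
      interpret \<nu>: prob_space \<nu> by (rule \<nu>(1))
      have "measure \<nu> (rough_paths (T + 2 * \<eta>) (2 * \<eta>) e) \<le> measure \<nu> (rough_paths (T + 1) d e)"
        using \<eta> \<nu>(2) open_rough_paths[of "T + 1" d e]
        by (intro \<nu>.finite_measure_mono) (auto simp: rough_paths_def intro!: bexI)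
      then show ?thesis using d(2) by linarith
    qed
    have "((\<lambda>l. l\<^sup>2 + l * (c + l) * (real K * \<eta>)) \<longlongrightarrow> 0\<^sup>2 + 0 * (c + 0) * (real K * \<eta>)) (at_right 0)"
      by (intro tendsto_intros)
    then have lim1: "\<forall>\<^sub>F l in at_right 0. l\<^sup>2 + l * (c + l) * (real K * \<eta>) < \<eta> / 3"
      using \<eta> by (intro order_tendstoD(2)) auto
    have "((\<lambda>l. real K * (9 * l\<^sup>2 * (real K * \<eta>) / \<eta>\<^sup>2)) \<longlongrightarrow> real K * (9 * 0\<^sup>2 * (real K * \<eta>) / \<eta>\<^sup>2)) (at_right 0)"
      using \<eta> by (intro tendsto_intros) auto
    then have lim2: "\<forall>\<^sub>F l in at_right 0. real K * (9 * l\<^sup>2 * (real K * \<eta>) / \<eta>\<^sup>2) < \<delta> / 3"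
      using \<delta> by (intro order_tendstoD(2)) auto
    have lim3: "\<forall>\<^sub>F l in at_right 0. l < e"
      using e by (simp add: eventually_at_right_field) blast
    from pos lim1 lim2 lim3 show "\<forall>\<^sub>F l in at_right 0. \<exists>E\<in>sets (M l). measure (M l) E \<le> \<delta> \<and>
      (AE \<omega> in M l. \<omega> \<notin> E \<longrightarrow> dist (P l \<omega>) (relax_path v (R l \<omega>)) < \<epsilon>)"
    proof eventually_elim
      case (elim l)
      interpret inert_process "M l" l v "B l" "Z l" "V l" "L\<^sub>0 l" "L\<^sub>l l" by (rule proc[OF elim(1)])
      obtain E where E: "E \<in> sets (M l)"
        "prob E \<le> measure \<nu> (rough_paths (T + 2 * \<eta>) (2 * \<eta>) e)
          + real K * (measure \<nu> (big_paths (real K * \<eta>) c) + 9 * l\<^sup>2 * (real K * \<eta>) / \<eta>\<^sup>2)"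
        and close: "AE \<omega> in M l. \<omega> \<notin> E \<longrightarrow>
          (\<forall>t\<in>{0..T}. \<bar>path_at (P l \<omega>) t - path_at (relax_path v (R l \<omega>)) t\<bar> \<le> l + e)"
        using time_changed_drift_close[OF P[OF elim(1)] R[OF elim(1)] \<eta>(1) e(1) K elim(2) c(1)]
        unfolding law[OF elim(1)] by blast
      have "real K * measure \<nu> (big_paths (real K * \<eta>) c) \<le> real K * (\<delta> / (3 * real K))"
        using c(2) by (intro mult_left_mono) auto
      also have "\<dots> = \<delta> / 3" using K0 by simp
      finally have "prob E \<le> \<delta>" using E(2) rough elim(3) by (simp add: distrib_left)
      moreover have "AE \<omega> in M l. \<omega> \<notin> E \<longrightarrow> dist (P l \<omega>) (relax_path v (R l \<omega>)) < \<epsilon>"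
        using close
      proof eventually_elim
        case (elim \<omega>)
        show ?case
        proof
          assume "\<omega> \<notin> E"
          then have "\<bar>path_at (P l \<omega>) t - path_at (relax_path v (R l \<omega>)) t\<bar> \<le> \<epsilon> / 2"
            if "0 \<le> t" "t \<le> 1 / (\<epsilon> / 2)" for t
            using elim that \<open>l < e\<close> by (force simp: T_def e_def)
          then have "dist (P l \<omega>) (relax_path v (R l \<omega>)) \<le> \<epsilon> / 2"
            using \<epsilon> by (intro dist_cpath_leI) auto
          then show "dist (P l \<omega>) (relax_path v (R l \<omega>)) < \<epsilon>" using \<epsilon> by simp
        qed
      qed
      ultimately show ?case using E(1) by blast
    qed
  qed
  then have "weakly_converges (at_right 0) (\<lambda>l. distr (M l) borel (P l))
      (distr N borel (\<lambda>\<omega>. relax_path v (PW \<omega>)))" by (simp add: \<nu>_def)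
  moreover have "\<forall>\<^sub>F l in at_right 0. path_version (M l)
      (\<lambda>t. time_changed_drift (V l) (L\<^sub>0 l) (L\<^sub>l l) (t / l)) (P l)"
    using pos by eventually_elim (rule P)
  ultimately show ?thesis
    using Q unfolding processes_converge_weakly_def by blast
qed

end
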